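(* Let $n,m\ge1$ and let $\Psi=(\psi_1,\dots,\psi_m)$ be an $m$-tuple of (not necessarily monotonic) multivariable approximating functions $\psi_j:\mathbb Z^n\to\mathbb R_{\ge0}$. Suppose that $\sum_{\mathbf{q}\in\mathbb Z^n}\prod_{j=1}^m\psi_j(\mathbf{q})<\infty$ and that \[1>s(\Psi):=\inf\bigg\{s\ge0:\sum_{\mathbf{q}\in\mathbb Z^n\setminus\{0\}}\bigg(\min_{1\le j\le m}\frac{\psi_j(\mathbf{q})}{|\mathbf{q}|}\bigg)^s<\infty\bigg\}.\] Then $\dim_{\mathrm F}W(n,m;\Psi)=2s(\Psi)$.
   Context: $|\mathbf{q}|=\max_i|q_i|$; $\|\cdot\|$ is the distance to the nearest integer; $\mathbf{x}\in[0,1]^{nm}$ is an $n\times m$ matrix with columns $\mathbf{x}_j\in[0,1]^n$ and $\mathbf{q}$ a row vector; $W(n,m;\Psi)=\{\mathbf{x}\in[0,1]^{nm}:\|\mathbf{q}\mathbf{x}_j\|<\psi_j(\mathbf{q})\ (1\le j\le m)\text{ for infinitely many }\mathbf{q}\in\mathbb Z^n\}$. For a Borel probability measure $\mu$ on $\mathbb R^d$, $\widehat\mu(\mathbf{x})=\int e^{-2\pi i\boldsymbol\xi\cdot\mathbf{x}}\,d\mu(\boldsymbol\xi)$. For $E\subset\mathbb R^d$, let $\mathcal P(E)$ be the set of Borel probability measures on $\mathbb R^d$ whose support is a compact subset of $E$; the Fourier dimension is $\dim_{\mathrm F}E=\sup\{s\in[0,d]:\exists\mu\in\mathcal P(E)\text{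 with }|\widehat\mu(\mathbf{x})|\ll|\mathbf{x}|^{-s/2}\text{ for all }\mathbf{x}\}$. *)

theory Defs
  imports "HOL-Analysis.Analysis" "HOL-Probability.Probability"
begin

definition measure_support :: "'a::topological_space measure \<Rightarrow> 'a set" where
  "measure_support \<mu> = {x. \<forall>U. open U \<longrightarrow> x \<in> U \<longrightarrow> emeasure \<mu> U > 0}"

definition compact_prob_measures :: "'a::euclidean_space set \<Rightarrow> 'a measure set" where
  "compact_prob_measures E =
     {\<mu>. prob_space \<mu> \<and> sets \<mu> = sets borel \<and>
          compact (measure_support \<mu>) \<and> measure_support \<mu> \<subseteq> E}"

definition fourier_transform :: "'a::euclidean_space measure \<Rightarrow> 'a \<Rightarrow> complex" where
  "fourier_transform \<mu> x =
     (LINT \<xi>|\<mu>. exp (- (2 * of_real pi * \<i> * of_real (\<xi> \<bullet> x))))"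

text \<open>
  The supremum is taken in \<^typ>\<open>ennreal\<close>, so that it is \<open>0\<close> for the empty set, where no
  exponent is admissible. The point \<open>x = 0\<close> is excluded from the decay condition because
  \<open>|0|\<close> to a negative power is read as infinity, whereas \<open>0 powr a = 0\<close>.
\<close>

definition fourier_dim :: "'a::euclidean_space set \<Rightarrow> ennreal" where
  "fourier_dim E =
     Sup {ennreal s | s. 0 \<le> s \<and> s \<le> real DIM('a) \<and>
       (\<exists>\<mu>\<in>compact_prob_measures E. \<exists>C. \<forall>x. x \<noteq> 0 \<longrightarrow>
          cmod (fourier_transform \<mu> x) \<le> C * infnorm x powr (- s / 2))}"

definition int_dist :: "real \<Rightarrow> real" where
  "int_dist t = infdist t \<int>"

definition sup_abs :: "int ^ 'n \<Rightarrow> real" where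
  "sup_abs q = real_of_int (Max (range (\<lambda>i. \<bar>q $ i\<bar>)))"

definition real_vec :: "int ^ 'n \<Rightarrow> real ^ 'n" where
  "real_vec q = (\<chi> i. real_of_int (q $ i))"

text \<open>
  \<^typ>\<open>real ^ 'm ^ 'n\<close> is the type of \<open>n \<times> m\<close> matrices; as a Euclidean space it carries the
  entrywise inner product of \<open>nm\<close>-dimensional space.
\<close>

definition well_approx :: "('m \<Rightarrow> int ^ 'n \<Rightarrow> real) \<Rightarrow> (real ^ 'm ^ 'n) set" where
  "well_approx \<psi> =
     {x. (\<forall>i j. 0 \<le> x $ i $ j \<and> x $ i $ j \<le> 1) \<and>
         infinite {q. \<forall>j. int_dist (real_vec q \<bullet> column j x) < \<psi> j q}}"

text \<open>
  The infimum is taken in \<^typ>\<open>ennreal\<close>, so that it is \<open>\<infinity>\<close> when no exponent gives convergence.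
  The value \<open>0 powr 0 = 0\<close> is harmless: it only affects whether \<open>s = 0\<close> is in the set, and
  when it is, the summand has finite support, so every \<open>s > 0\<close> is in the set too.
\<close>

definition conv_exponent :: "('m::finite \<Rightarrow> int ^ 'n \<Rightarrow> real) \<Rightarrow> ennreal" where
  "conv_exponent \<psi> =
     Inf {ennreal s | s. 0 \<le> s \<and>
       (\<lambda>q. (Min (range (\<lambda>j. \<psi> j q / sup_abs q))) powr s) summable_on (UNIV - {0})}"

end

theory Submission
  imports Defs "HOL-Computational_Algebra.Primes"
begin

text \<open>
  Upper bound: the set of \<open>x\<close> satisfying the \<open>q\<close>-th system of inequalities is majorised by a product
  of Fejer kernels in the variables \<open>q x\<^sub>j\<close>, whose frequencies are the matrices \<open>q \<otimes> k\<close>. If the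
  Fourier transform of \<open>\<mu>\<close> decays like \<open>|x|\<close> to the power \<open>-\<sigma>\<close> with \<open>s(\<Psi>) < \<sigma> < 1\<close>, the
  \<open>\<mu>\<close>-measure of this set is \<open>O(\<Prod>\<^sub>j \<psi>\<^sub>j(q) + (min\<^sub>j \<psi>\<^sub>j(q) / |q|)\<^sup>\<sigma>)\<close>, which is summable, so by
  Borel--Cantelli \<open>\<mu>\<close> cannot live on \<open>W\<close>.

  Lower bound: for \<open>t < s(\<Psi>)\<close> multiply a product of triangular densities on the cube successively by weighted averages,
  over finitely many large \<open>q\<close>, of products of triangular bumps of width \<open>\<delta>\<^sub>q = min\<^sub>j \<psi>\<^sub>j(q)\<close> around
  \<open>q x\<^sub>j \<in> \<int>\<close>, with weights proportional to \<open>(\<delta>\<^sub>q / |q|)\<^sup>t\<close>. By the divisor bound each nonzero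
  frequency \<open>l\<close> comes from few pairs \<open>q \<otimes> k = l\<close>, so such a function has Fourier coefficients
  almost \<open>O(|l|\<close> to the power \<open>-t)\<close>, all at large frequencies. Measures whose transform is summable
  along translates of the integer lattice against the submultiplicative weight \<open>(1 + |x|)\<^sup>\<tau>\<close> are
  stable under these multiplications, which change the transform by arbitrarily little relative to
  \<open>(1 + |x|)\<close> to the power \<open>-\<tau>\<close>, \<open>\<tau> < t\<close>. A weak limit of the resulting measures is supported in
  \<open>W\<close> and has the required decay.
\<close>

section \<open>Characters and the distance to the nearest integer\<close>

text \<open>Multiplying a measure by a function with integer frequencies convolves its transform
  over the lattice. Pointwise decay of order \<open>-t\<close>, \<open>t < 1\<close>, for both
  factors would not control such a convolution. Hence an asymmetry: of the multiplier only a
  weighted bound per nonzero frequency has to be small, while the transform of the current measure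
  is kept in weighted l1 on every lattice coset. The l1 bound may explode from step to step, because
  the height of the next \<open>q\<close> is chosen after it; the pointwise bound survives as a sum
  of small changes. The gap between \<tau> and \<open>t\<close> pays for the divisor bound and for
  this smallness. The convergence of the sum of \<open>\<Prod>\<^sub>j \<psi>\<^sub>j(q)\<close>
  bounds the zero-frequency terms in the upper bound, makes \<open>\<delta>\<^sub>q \<le> 1\<close>
  for all but finitely many \<open>q\<close> in the lower bound, and keeps
  \<open>2 s(\<Psi>)\<close> below the dimension when \<open>n = m = 1\<close>. The bumps have
  half-width \<open>\<delta>\<^sub>q / 2\<close>, so that the closed conditions which survive a weak
  limit still imply the strict inequalities.\<close>

definition echar :: "real \<Rightarrow> complex" where
  "echar t = cis (2 * pi * t)"

lemma norm_echar [simp]: "cmod (echar t) = 1"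
  by (simp add: echar_def)

lemma echar_0 [simp]: "echar 0 = 1"
  by (simp add: echar_def)

lemma echar_add: "echar (s + t) = echar s * echar t"
  by (simp add: echar_def cis_mult distrib_left)

lemma echar_minus: "echar (- t) = cnj (echar t)"
  by (simp add: echar_def cis_cnj)

lemma echar_diff: "echar (s - t) = echar s * cnj (echar t)"
  using echar_add[of s "- t"] by (simp add: echar_minus)

lemma echar_of_int [simp]: "echar (of_int k) = 1"
  by (simp add: echar_def complex_eq_iff)

lemma echar_sum: "finite A \<Longrightarrow> echar (\<Sum>x\<in>A. f x) = (\<Prod>x\<in>A. echar (f x))"
  by (induction A rule: finite_induct) (auto simp: echar_add)

lemma echar_of_nat_mult: "echar (of_nat n * t) = echar t ^ n"
  using Complex.DeMoivre[of "2 * pi * t" n] by (simp add: echar_def mult_ac)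

lemma continuous_on_echar [continuous_intros]:
  "continuous_on S f \<Longrightarrow> continuous_on S (\<lambda>x. echar (f x))"
  unfolding echar_def cis_conv_exp by (intro continuous_intros)

lemma borel_measurable_echar [measurable]: "echar \<in> borel_measurable borel"
  by (intro borel_measurable_continuous_onI continuous_intros)

lemma echar_has_vector_derivative:
  "((\<lambda>u. echar (c * u)) has_vector_derivative (2 * pi * \<i> * c) * echar (c * u)) (at u within S)"
proof -
  have "((\<lambda>z. exp (2 * pi * \<i> * c * z)) has_field_derivative
          (2 * pi * \<i> * c) * exp (2 * pi * \<i> * c * of_real u)) (at (of_real u))"
    by (auto intro!: derivative_eq_intros)
  from has_vector_derivative_real_field[OF this]
  show ?thesis by (simp add: echar_def cis_conv_exp mult_ac has_vector_derivative_at_within)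
qed

lemma fourier_transform_echar:
  "fourier_transform \<mu> x = (LINT y|\<mu>. echar (- (y \<bullet> x)))"
  unfolding fourier_transform_def echar_def cis_conv_exp
  by (intro Bochner_Integration.integral_cong) (auto simp: mult_ac)

lemma int_dist_attained: "\<exists>k. int_dist t = \<bar>t - of_int k\<bar>"
proof -
  have "closed (\<int> :: real set)" by (rule closed_Ints)
  moreover have "(\<int> :: real set) \<noteq> {}" using Ints_0 by blast
  ultimately obtain y where "y \<in> \<int>" "infdist t \<int> = dist t y"
    using infdist_attains_inf by metis
  thus ?thesis by (auto simp: int_dist_def dist_real_def elim!: Ints_cases)
qed

lemma int_dist_le: "int_dist t \<le> \<bar>t - of_int k\<bar>"
  using infdist_le[of "of_int k" \<int> t] by (simp add: int_dist_def dist_real_def)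

lemma int_dist_nonneg [simp]: "0 \<le> int_dist t"
  by (simp add: int_dist_def infdist_nonneg)

lemma int_dist_le_half: "int_dist t \<le> 1 / 2"
  using int_dist_le[of t "round t"] of_int_round_abs_le[of t] by (simp add: abs_minus_commute)

lemma int_dist_eq_abs: "\<bar>t\<bar> \<le> 1 / 2 \<Longrightarrow> int_dist t = \<bar>t\<bar>"
proof -
  assume t: "\<bar>t\<bar> \<le> 1 / 2"
  obtain k where k: "int_dist t = \<bar>t - of_int k\<bar>" using int_dist_attained by blast
  have "\<bar>t\<bar> \<le> \<bar>t - of_int k\<bar>"
  proof (cases "k = 0")
    case False
    hence "1 \<le> \<bar>real_of_int k\<bar>" by linarith
    thus ?thesis using t by linarith
  qed auto
  thus ?thesis using k int_dist_le[of t 0] by simp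
qed

lemma int_dist_lipschitz: "\<bar>int_dist t - int_dist u\<bar> \<le> int_dist (t - u)"
proof -
  obtain k where k: "int_dist (t - u) = \<bar>t - u - of_int k\<bar>" using int_dist_attained by blast
  obtain k1 where k1: "int_dist t = \<bar>t - of_int k1\<bar>" using int_dist_attained by blast
  obtain k2 where k2: "int_dist u = \<bar>u - of_int k2\<bar>" using int_dist_attained by blast
  show ?thesis
    using k k1 k2 int_dist_le[of t "k2 + k"] int_dist_le[of u "k1 - k"]
    unfolding of_int_add of_int_diff by linarith
qed

lemma continuous_on_int_dist [continuous_intros]:
  "continuous_on S f \<Longrightarrow> continuous_on S (\<lambda>x. int_dist (f x))"
  unfolding int_dist_def by (intro continuous_intros)

text \<open>With \<open>v\<close> reduced to \<open>[-1/2, 1/2]\<close> and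
  \<open>x = pi * v\<close>, the right side is \<open>2 * \<bar>sin x\<bar>\<close>. The crude
  \<open>\<bar>x\<bar> \<le> 2\<close> suffices: the cubic Maclaurin remainder is then at most
  \<open>2 * \<bar>x\<bar> / 3\<close>, so a third of \<open>\<bar>x\<bar>\<close> is left.\<close>

lemma int_dist_le_norm_echar: "int_dist v \<le> cmod (1 - echar v)"
proof -
  obtain k where k: "int_dist v = \<bar>v - of_int k\<bar>" using int_dist_attained by blast
  define x where "x = pi * (v - of_int k)"
  have "\<bar>v - of_int k\<bar> \<le> 1 / 2" using k int_dist_le_half by metis
  hence "pi * \<bar>v - of_int k\<bar> \<le> 4 * (1 / 2)" using pi_less_4 by (intro mult_mono) auto
  hence xb: "\<bar>x\<bar> \<le> 2" by (simp add: x_def abs_mult)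
  have "echar v = echar (v - of_int k)" by (simp add: echar_diff)
  also have "\<dots> = cis (2 * x)" by (simp add: echar_def x_def mult.assoc)
  finally have e: "echar v = cis (2 * x)" .
  have "(cmod (1 - echar v))\<^sup>2 = (1 - cos (2 * x))\<^sup>2 + (sin (2 * x))\<^sup>2"
    by (simp add: e cmod_power2)
  also have "\<dots> = 2 - 2 * cos (2 * x)"
    using sin_cos_squared_add[of "2 * x"] by (simp add: power2_eq_square algebra_simps)
  also have "\<dots> = (2 * sin x)\<^sup>2" by (simp add: cos_double_sin power2_eq_square)
  finally have c: "cmod (1 - echar v) = 2 * \<bar>sin x\<bar>"
    using power2_eq_iff_nonneg[of "cmod (1 - echar v)" "\<bar>2 * sin x\<bar>"] by (simp add: abs_mult)
  have s: "(\<Sum>m<3. sin_coeff m * x ^ m) = x"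
    by (simp add: sin_coeff_def eval_nat_numeral)
  have "\<bar>sin x - x\<bar> \<le> inverse (fact 3) * \<bar>x\<bar> ^ 3"
    using Maclaurin_sin_bound[of x 3] by (simp only: s)
  also have "\<dots> = \<bar>x\<bar>\<^sup>2 * \<bar>x\<bar> / 6" by (simp add: eval_nat_numeral fact_numeral)
  also have "\<dots> \<le> 2\<^sup>2 * \<bar>x\<bar> / 6" using xb by (intro divide_right_mono mult_right_mono power_mono) auto
  finally have "\<bar>sin x - x\<bar> \<le> 2 * \<bar>x\<bar> / 3" by simp
  hence "2 * \<bar>sin x\<bar> \<ge> 2 * \<bar>x\<bar> / 3" by linarith
  moreover have "\<bar>x\<bar> = pi * int_dist v" by (simp add: k x_def abs_mult)
  moreover have "3 * int_dist v \<le> pi * int_dist v" using pi_gt3 by (intro mult_right_mono) auto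
  ultimately show ?thesis using c int_dist_nonneg[of v] by linarith
qed

section \<open>Fejer kernels\<close>

text \<open>The Fejer weight \<open>max 0 (N - \<bar>k\<bar>)\<close>, kept as a count: its bound
  \<open>N\<close>, its value at 0 and its total \<open>N\<^sup>2\<close> are all that is
  needed.\<close>

definition pair_diffs :: "nat \<Rightarrow> int \<Rightarrow> nat" where
  "pair_diffs N k = card {p \<in> {..<N} \<times> {..<N}. int (fst p) - int (snd p) = k}"

lemma sum_pair_diffs:
  fixes g :: "int \<Rightarrow> 'a::{real_vector,comm_ring_1}"
  shows "(\<Sum>a<N. \<Sum>b<N. g (int a - int b)) = (\<Sum>k\<in>{- int N..int N}. of_nat (pair_diffs N k) * g k)"
proof -
  define h where "h p = int (fst p) - int (snd p)" for p :: "nat \<times> nat"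
  have "(\<Sum>a<N. \<Sum>b<N. g (int a - int b)) = (\<Sum>p\<in>{..<N} \<times> {..<N}. g (h p))"
    by (simp add: sum.cartesian_product h_def split_def)
  also have "\<dots> = (\<Sum>k\<in>{- int N..int N}. \<Sum>p\<in>{p\<in>{..<N} \<times> {..<N}. h p = k}. g (h p))"
    by (subst sum.group) (auto simp: h_def)
  also have "\<dots> = (\<Sum>k\<in>{- int N..int N}. of_nat (pair_diffs N k) * g k)"
    by (intro sum.cong refl) (simp add: pair_diffs_def h_def)
  finally show ?thesis .
qed

lemma pair_diffs_le: "pair_diffs N k \<le> N"
proof -
  have "pair_diffs N k = card (fst ` {p \<in> {..<N} \<times> {..<N}. int (fst p) - int (snd p) = k})"
    unfolding pair_diffs_def by (intro card_image[symmetric] inj_onI) (auto simp: prod_eq_iff)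
  also have "\<dots> \<le> card {..<N}" by (intro card_mono) auto
  finally show ?thesis by simp
qed

lemma pair_diffs_0 [simp]: "pair_diffs N 0 = N"
proof -
  have "{p \<in> {..<N} \<times> {..<N}. int (fst p) - int (snd p) = 0} = (\<lambda>a. (a, a)) ` {..<N}"
    by auto
  thus ?thesis by (simp add: pair_diffs_def card_image inj_on_def)
qed

lemma sum_pair_diffs_eq: "(\<Sum>k\<in>{- int N..int N}. real (pair_diffs N k)) = (real N)\<^sup>2"
  using sum_pair_diffs[of "\<lambda>_. 1::real" N] by (simp add: power2_eq_square)

lemma dirichlet_square:
  "complex_of_real ((cmod (\<Sum>a<N. echar (real a * v)))\<^sup>2) = (\<Sum>a<N. \<Sum>b<N. echar (of_int (int a - int b) * v))"
proof -
  have "complex_of_real ((cmod (\<Sum>a<N. echar (real a * v)))\<^sup>2) = (\<Sum>a<N. echar (real a * v)) * cnj (\<Sum>a<N. echar (real a * v))"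
    by (rule complex_norm_square)
  also have "\<dots> = (\<Sum>a<N. \<Sum>b<N. echar (real a * v) * cnj (echar (real b * v)))"
    by (simp add: sum_product)
  also have "\<dots> = (\<Sum>a<N. \<Sum>b<N. echar (of_int (int a - int b) * v))"
    by (intro sum.cong refl) (simp add: echar_diff left_diff_distrib)
  finally show ?thesis .
qed

lemma dirichlet_telescope:
  "cmod (\<Sum>a<N. echar (real a * v)) * cmod (1 - echar v) \<le> 2"
proof -
  have "(\<Sum>a<N. echar (real a * v)) * (1 - echar v) = 1 - echar v ^ N"
    by (simp add: echar_of_nat_mult one_diff_power_eq[of "echar v"] del: mult_cancel_left mult_cancel_right)
  hence "cmod (\<Sum>a<N. echar (real a * v)) * cmod (1 - echar v) = cmod (1 - echar v ^ N)"
    by (metis norm_mult)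
  also have "\<dots> \<le> 1 + 1" by (rule order_trans[OF norm_triangle_ineq4]) (simp add: norm_power)
  finally show ?thesis by simp
qed

lemma has_integral_echar:
  "((\<lambda>u. echar (of_int k * (t - u))) has_integral (if k = 0 then 1 else 0)) {-1/2..1/2::real}"
proof (cases "k = 0")
  case True
  thus ?thesis using has_integral_const_real[of "1::complex" "-1/2" "1/2"] by simp
next
  case False
  define F where "F u = echar (of_int k * t) * (echar (- of_int k * u) / (- 2 * pi * \<i> * of_int k))" for u
  have "((\<lambda>u. echar (of_int k * (t - u))) has_integral (F (1/2) - F (-1/2))) {-1/2..1/2::real}"
  proof (rule fundamental_theorem_of_calculus)
    fix x :: real
    show "(F has_vector_derivative echar (of_int k * (t - x))) (at x within {-1/2..1/2})"
      unfolding F_def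
      by (rule has_vector_derivative_eq_rhs, (rule derivative_intros echar_has_vector_derivative)+)
         (use False in \<open>simp add: right_diff_distrib echar_diff echar_minus field_simps\<close>)
  qed auto
  moreover have "echar (- of_int k * (1/2)) = echar (- of_int k * (-1/2))"
    using echar_diff[of "of_int k / 2" "of_int k"] by simp
  ultimately show ?thesis using False by (simp add: F_def)
qed

text \<open>
  The kernel has mean \<open>1\<close> and, by telescoping, is at most \<open>4 / (N \<bar>1 - e(v)\<bar>\<^sup>2)\<close>; so for a Lipschitz
  function the deviation \<open>\<bar>1 - e(v)\<bar> \<le> \<epsilon> + \<bar>1 - e(v)\<bar>\<^sup>2 / \<epsilon>\<close> costs only \<open>\<epsilon> + 4 / (N \<epsilon>)\<close>.
\<close>

lemma fejer_convergence:
  fixes \<phi> :: "real \<Rightarrow> real"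
  assumes lip: "\<And>t u. \<bar>\<phi> t - \<phi> u\<bar> \<le> L * int_dist (t - u)"
    and c: "\<And>k. c k = integral {-1/2..1/2} (\<lambda>u. \<phi> u * echar (- of_int k * u))"
  shows "(\<lambda>N. (\<Sum>a<N. \<Sum>b<N. c (int a - int b) * echar (of_int (int a - int b) * t)) / of_nat N)
           \<longlonglongrightarrow> complex_of_real (\<phi> t)"
proof -
  let ?I = "{-1/2..1/2::real}"
  define D where "D N v = (cmod (\<Sum>a<N. echar (real a * v)))\<^sup>2 / real N" for N v
  have L0: "0 \<le> L"
    using lip[of "1/2" 0] int_dist_eq_abs[of "1/2"] abs_ge_zero[of "\<phi> (1/2) - \<phi> 0"]
    by (simp del: abs_ge_zero)
  have cont: "continuous_on S \<phi>" for S
  proof (rule continuous_on_subset[of UNIV])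
    show "continuous_on UNIV \<phi>"
    proof (rule lipschitz_on_continuous_on, rule lipschitz_onI)
      fix x y show "dist (\<phi> x) (\<phi> y) \<le> L * dist x y"
        using lip[of x y] mult_left_mono[OF int_dist_le[of "x - y" 0] L0] by (simp add: dist_real_def)
    qed (use L0 in auto)
  qed auto
  define \<sigma> where "\<sigma> N = (\<Sum>a<N. \<Sum>b<N. c (int a - int b) * echar (of_int (int a - int b) * t)) / of_nat N" for N
  have Deq: "complex_of_real (D N v) = (\<Sum>a<N. \<Sum>b<N. echar (of_int (int a - int b) * v)) / of_nat N" for N v
    unfolding dirichlet_square[symmetric] by (simp add: D_def)
  have contD: "continuous_on S (\<lambda>u. D N (t - u))" for N S
    unfolding D_def divide_inverse by (intro continuous_intros)
  have i1: "((\<lambda>u. complex_of_real (D N (t - u))) has_integral 1) ?I" if "N > 0" for N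
  proof -
    have "((\<lambda>u. (\<Sum>a<N. \<Sum>b<N. echar (of_int (int a - int b) * (t - u))) / of_nat N) has_integral
          (\<Sum>a<N. \<Sum>b<N. if int a - int b = 0 then 1 else 0) / of_nat N) ?I"
      by (intro has_integral_divide has_integral_sum has_integral_echar) auto
    moreover have "(\<Sum>a<N. \<Sum>b<N. if int a - int b = 0 then 1 else (0::complex)) = of_nat N"
      by (simp add: sum.delta)
    ultimately show ?thesis using that by (simp add: Deq)
  qed
  have i2: "((\<lambda>u. complex_of_real (\<phi> u * D N (t - u))) has_integral \<sigma> N) ?I" for N
  proof -
    have "((\<lambda>u. (\<Sum>a<N. \<Sum>b<N. (\<phi> u * echar (- of_int (int a - int b) * u)) * echar (of_int (int a - int b) * t)) / of_nat N) has_integral \<sigma> N) ?I"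
      unfolding \<sigma>_def c
      by (intro has_integral_divide has_integral_sum has_integral_mult_left integrable_integral
           integrable_continuous_interval continuous_intros cont) auto
    moreover have "(\<Sum>a<N. \<Sum>b<N. (\<phi> u * echar (- of_int (int a - int b) * u)) * echar (of_int (int a - int b) * t)) / of_nat N
        = complex_of_real (\<phi> u * D N (t - u))" for u
      by (simp add: Deq sum_distrib_left right_diff_distrib echar_diff echar_minus mult_ac)
    ultimately show ?thesis by simp
  qed
  have main: "cmod (complex_of_real (\<phi> t) - \<sigma> N) \<le> L * (\<epsilon> + 4 / (real N * \<epsilon>))" if "N > 0" "\<epsilon> > 0" for N \<epsilon>
  proof -
    have h: "((\<lambda>u. complex_of_real ((\<phi> t - \<phi> u) * D N (t - u))) has_integral (complex_of_real (\<phi> t) - \<sigma> N)) ?I"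
      using has_integral_diff[OF has_integral_mult_right[OF i1[OF \<open>N > 0\<close>], of "complex_of_real (\<phi> t)"] i2[of N]]
      by (simp add: left_diff_distrib)
    have r1: "((\<lambda>u. D N (t - u)) has_integral 1) ?I"
      using has_integral_linear[OF i1[OF \<open>N > 0\<close>] bounded_linear_Re] by (simp add: o_def)
    have g: "((\<lambda>u. L * (\<epsilon> * D N (t - u) + 4 / (real N * \<epsilon>))) has_integral L * (\<epsilon> * 1 + 4 / (real N * \<epsilon>))) ?I"
      using has_integral_const_real[of "4 / (real N * \<epsilon>)" "-1/2" "1/2"]
      by (intro has_integral_mult_right has_integral_add r1) simp
    have pw: "norm (complex_of_real ((\<phi> t - \<phi> u) * D N (t - u))) \<le> L * (\<epsilon> * D N (t - u) + 4 / (real N * \<epsilon>))" for u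
    proof -
      define x where "x = cmod (1 - echar (t - u))"
      define d where "d = D N (t - u)"
      have d0: "d \<ge> 0" by (simp add: d_def D_def)
      have x0: "x \<ge> 0" by (simp add: x_def)
      have "(cmod (\<Sum>a<N. echar (real a * (t - u))) * x)\<^sup>2 \<le> 2\<^sup>2"
        unfolding x_def by (intro power_mono dirichlet_telescope) auto
      hence dx: "d * x\<^sup>2 \<le> 4 / N" using that by (simp add: d_def D_def field_simps power_mult_distrib)
      have xe: "x \<le> \<epsilon> + x\<^sup>2 / \<epsilon>"
      proof (cases "x \<le> \<epsilon>")
        case False
        hence "x * \<epsilon> \<le> x * x" using x0 by (intro mult_left_mono) auto
        hence "x \<le> x\<^sup>2 / \<epsilon>" using that by (simp add: field_simps power2_eq_square)
        thus ?thesis using that by linarith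
      next
        case True
        moreover have "0 \<le> x\<^sup>2 / \<epsilon>" using that by simp
        ultimately show ?thesis by linarith
      qed
      have "\<bar>\<phi> t - \<phi> u\<bar> \<le> L * x"
        using lip[of t u] mult_left_mono[OF int_dist_le_norm_echar L0] unfolding x_def by (rule order_trans)
      hence "\<bar>\<phi> t - \<phi> u\<bar> * d \<le> (L * x) * d" using d0 by (intro mult_right_mono)
      also have "\<dots> \<le> (L * (\<epsilon> + x\<^sup>2 / \<epsilon>)) * d" using xe L0 d0 by (intro mult_right_mono mult_left_mono)
      also have "\<dots> = L * (\<epsilon> * d + (d * x\<^sup>2) / \<epsilon>)" by (simp add: algebra_simps)
      also have "\<dots> \<le> L * (\<epsilon> * d + (4 / N) / \<epsilon>)"
        using L0 that dx by (intro mult_left_mono add_left_mono divide_right_mono) auto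
      finally show ?thesis using d0 by (simp add: d_def norm_mult flip: of_real_diff)
    qed
    have "norm (integral ?I (\<lambda>u. complex_of_real ((\<phi> t - \<phi> u) * D N (t - u)))) \<le> integral ?I (\<lambda>u. L * (\<epsilon> * D N (t - u) + 4 / (real N * \<epsilon>)))"
      using h g pw by (intro integral_norm_bound_integral) (auto simp: integrable_on_def)
    thus ?thesis unfolding integral_unique[OF h] integral_unique[OF g] by simp
  qed
  have "(\<lambda>N. \<sigma> N - complex_of_real (\<phi> t)) \<longlonglongrightarrow> 0"
  proof (rule tendsto_0_le[where K = 1])
    \<comment> \<open>The choice \<open>\<epsilon> = 1 / sqrt N\<close> balances
      \<open>\<epsilon>\<close> against \<open>4 / (N * \<epsilon>)\<close>.\<close>
    have "(\<lambda>N. L * (1 / sqrt (real N) + 4 * (1 / sqrt (real N)))) \<longlonglongrightarrow> L * (0 + 4 * 0)"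
      by (intro tendsto_intros tendsto_divide_0[OF tendsto_const] filterlim_at_top_imp_at_infinity
          filterlim_compose[OF sqrt_at_top filterlim_real_sequentially])
    thus "(\<lambda>N. L * (1 / sqrt (real N) + 4 * (1 / sqrt (real N)))) \<longlonglongrightarrow> 0" by simp
    show "\<forall>\<^sub>F N in sequentially. norm (\<sigma> N - complex_of_real (\<phi> t)) \<le> norm (L * (1 / sqrt (real N) + 4 * (1 / sqrt (real N)))) * 1"
    proof (rule eventually_mono[OF eventually_gt_at_top[of 0]])
      fix N :: nat assume N: "N > 0"
      have "real N * (1 / sqrt (real N)) = sqrt (real N)"
        using N by (simp add: real_div_sqrt)
      thus "norm (\<sigma> N - complex_of_real (\<phi> t)) \<le> norm (L * (1 / sqrt (real N) + 4 * (1 / sqrt (real N)))) * 1"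
        using main[OF N, of "1 / sqrt (real N)"] N L0 by (simp add: norm_minus_commute)
    qed
  qed
  thus ?thesis unfolding \<sigma>_def by (rule LIM_zero_cancel)
qed

section \<open>Triangular bumps\<close>

text \<open>Normalised to mass 1, so that its periodisation has zeroth Fourier coefficient exactly
  1. A triangle rather than an indicator, because the transform then decays quadratically and stays
  summable against weights of order below 1.\<close>

definition tri :: "real \<Rightarrow> real \<Rightarrow> real" where
  "tri h u = max 0 (1 - \<bar>u\<bar> / h) / h"

lemma tri_nonneg [simp]: "h > 0 \<Longrightarrow> 0 \<le> tri h u"
  by (simp add: tri_def)

lemma tri_eq_0: "h > 0 \<Longrightarrow> h \<le> \<bar>u\<bar> \<Longrightarrow> tri h u = 0"
  by (simp add: tri_def field_simps)

lemma tri_abs [simp]: "tri h \<bar>u\<bar> = tri h u"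
  by (simp add: tri_def)

lemma continuous_on_tri [continuous_intros]:
  "continuous_on S f \<Longrightarrow> continuous_on S (\<lambda>x. tri h (f x))"
  unfolding tri_def divide_inverse by (intro continuous_intros)

lemma tri_lipschitz:
  assumes "h > 0"
  shows "\<bar>tri h u - tri h v\<bar> \<le> (1 / h\<^sup>2) * \<bar>u - v\<bar>"
proof -
  have "\<bar>max 0 (1 - \<bar>u\<bar> / h) - max 0 (1 - \<bar>v\<bar> / h)\<bar> \<le> \<bar>\<bar>u\<bar> / h - \<bar>v\<bar> / h\<bar>" by linarith
  also have "\<dots> = \<bar>\<bar>u\<bar> - \<bar>v\<bar>\<bar> / h" using assms by (simp flip: diff_divide_distrib)
  also have "\<dots> \<le> \<bar>u - v\<bar> / h" using assms by (intro divide_right_mono) linarith+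
  finally have "\<bar>max 0 (1 - \<bar>u\<bar> / h) - max 0 (1 - \<bar>v\<bar> / h)\<bar> / h \<le> \<bar>u - v\<bar> / h / h"
    using assms by (intro divide_right_mono) auto
  thus ?thesis using assms by (simp add: tri_def power2_eq_square flip: diff_divide_distrib)
qed

lemma has_integral_tri:
  assumes h: "0 < h"
  shows "(tri h has_integral 1) {-h..h}"
proof -
  have "((\<lambda>u. (1 + u / h) / h) has_integral ((\<lambda>u. (u + u\<^sup>2 / (2 * h)) / h) 0 - (\<lambda>u. (u + u\<^sup>2 / (2 * h)) / h) (-h))) {-h..0}"
    using h by (intro fundamental_theorem_of_calculus)
      (auto intro!: derivative_eq_intros simp: field_simps power2_eq_square simp flip: has_real_derivative_iff_has_vector_derivative)
  hence 1: "(tri h has_integral 1/2) {-h..0}"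
    using h by (subst has_integral_cong[of _ _ "\<lambda>u. (1 + u / h) / h"]) (auto simp: tri_def field_simps power2_eq_square)
  have "((\<lambda>u. (1 - u / h) / h) has_integral ((\<lambda>u. (u - u\<^sup>2 / (2 * h)) / h) h - (\<lambda>u. (u - u\<^sup>2 / (2 * h)) / h) 0)) {0..h}"
    using h by (intro fundamental_theorem_of_calculus)
      (auto intro!: derivative_eq_intros simp: field_simps power2_eq_square simp flip: has_real_derivative_iff_has_vector_derivative)
  hence 2: "(tri h has_integral 1/2) {0..h}"
    using h by (subst has_integral_cong[of _ _ "\<lambda>u. (1 - u / h) / h"]) (auto simp: tri_def field_simps power2_eq_square)
  show ?thesis using has_integral_combine[OF _ _ 1 2] h by simp
qed

text \<open>The value is the squared sinc function
  \<open>(sin (pi * y * h) / (pi * y * h))\<^sup>2\<close>, left in exponential form.\<close>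

lemma has_integral_tri_echar:
  assumes h: "0 < h" and y: "y \<noteq> 0"
  shows "((\<lambda>u. tri h u * echar (y * u)) has_integral
           ((echar (y * h) + echar (- (y * h)) - 2) / (h * (2 * pi * \<i> * y))\<^sup>2)) {-h..h}"
proof -
  define z where "z = 2 * complex_of_real pi * \<i> * complex_of_real y"
  have z: "z \<noteq> 0" using y by (simp add: z_def)
  have e: "((\<lambda>u. echar (y * u)) has_vector_derivative z * echar (y * u)) (at u within S)" for u S
    using echar_has_vector_derivative[of y u S] by (simp add: z_def)
  \<comment> \<open>Antiderivative, by parts, of the affine piece with slope sign \<open>s\<close>
    times the character: \<open>s = 1\<close> on the left half of the triangle,
    \<open>s = -1\<close> on the right half.\<close>
  define F where "F s u = ((1 + s * (complex_of_real u / h)) / z - s / (h * z\<^sup>2)) * echar (y * u) / h" for s u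
  have FD: "(F s has_vector_derivative ((1 + s * (complex_of_real u / h)) / h * echar (y * u))) (at u within S)" for s u S
  proof -
    have "((\<lambda>u. (1 + s * (complex_of_real u / h)) / z - s / (h * z\<^sup>2)) has_vector_derivative (s / (h * z))) (at u within S)"
      using z h by (auto intro!: derivative_eq_intros simp: field_simps)
    from has_vector_derivative_mult[OF this e]
    have "((\<lambda>u. (((1 + s * (complex_of_real u / h)) / z - s / (h * z\<^sup>2)) * echar (y * u))) has_vector_derivative
            ((1 + s * (complex_of_real u / h)) * echar (y * u))) (at u within S)"
      by (rule has_vector_derivative_eq_rhs) (use z h in \<open>simp add: field_simps power2_eq_square\<close>)
    from has_vector_derivative_divide[OF this, of "of_real h"] show ?thesis
      unfolding F_def by simp
  qed
  have 1: "((\<lambda>u. tri h u * echar (y * u)) has_integral (F 1 0 - F 1 (-h))) {-h..0}"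
  proof (rule fundamental_theorem_of_calculus)
    fix x assume x: "x \<in> {-h..0}"
    hence "complex_of_real (tri h x) = (1 + 1 * (complex_of_real x / h)) / h"
      using h by (auto simp: tri_def field_simps max_def)
    thus "(F 1 has_vector_derivative complex_of_real (tri h x) * echar (y * x)) (at x within {-h..0})"
      using FD[of 1 x] by simp
  qed (use h in auto)
  have 2: "((\<lambda>u. tri h u * echar (y * u)) has_integral (F (-1) h - F (-1) 0)) {0..h}"
  proof (rule fundamental_theorem_of_calculus)
    fix x assume x: "x \<in> {0..h}"
    hence "complex_of_real (tri h x) = (1 + (-1) * (complex_of_real x / h)) / h"
      using h by (auto simp: tri_def field_simps max_def)
    thus "(F (-1) has_vector_derivative complex_of_real (tri h x) * echar (y * x)) (at x within {0..h})"
      using FD[of "-1" x] by simp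
  qed (use h in auto)
  have "(F 1 0 - F 1 (-h)) + (F (-1) h - F (-1) 0) = (echar (y * h) + echar (- (y * h)) - 2) / (h * z)\<^sup>2"
    using z h by (simp add: F_def field_simps power2_eq_square)
  thus ?thesis using has_integral_combine[OF _ _ 1 2] h by (simp add: z_def)
qed

text \<open>The second bound is a product so as to include \<open>y = 0\<close>; its constant is
  \<open>4 / pi\<^sup>2 \<le> 1\<close>. The factor \<open>2 * h\<close> is the full width of the
  triangle, which becomes \<open>\<delta> q\<close> when \<open>h = \<delta> q / 2\<close>.\<close>

lemma tri_transform_bounds:
  assumes h: "0 < h"
  shows "cmod (integral {-h..h} (\<lambda>u. tri h u * echar (y * u))) \<le> 1"
    and "cmod (integral {-h..h} (\<lambda>u. tri h u * echar (y * u))) * (2 * h * y)\<^sup>2 \<le> 1"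
proof -
  have "cmod (integral {-h..h} (\<lambda>u. tri h u * echar (y * u))) \<le> integral {-h..h} (tri h)"
    using h has_integral_tri[OF h]
    by (intro integral_norm_bound_integral integrable_continuous_interval continuous_intros)
       (auto simp: norm_mult integrable_on_def)
  thus "cmod (integral {-h..h} (\<lambda>u. tri h u * echar (y * u))) \<le> 1"
    using integral_unique[OF has_integral_tri[OF h]] by simp
  show "cmod (integral {-h..h} (\<lambda>u. tri h u * echar (y * u))) * (2 * h * y)\<^sup>2 \<le> 1"
  proof (cases "y = 0")
    case False
    have "cmod (integral {-h..h} (\<lambda>u. tri h u * echar (y * u))) = cmod (echar (y * h) + echar (- (y * h)) - 2) / (h * (2 * pi * \<bar>y\<bar>))\<^sup>2"
      using integral_unique[OF has_integral_tri_echar[OF h False]] h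
      by (simp add: norm_divide norm_power norm_mult)
    also have "\<dots> \<le> 4 / (h * (2 * pi * \<bar>y\<bar>))\<^sup>2"
    proof (intro divide_right_mono)
      show "cmod (echar (y * h) + echar (- (y * h)) - 2) \<le> 4"
        by (rule order_trans[OF norm_triangle_ineq4], rule order_trans[OF add_right_mono[OF norm_triangle_ineq]]) simp
    qed auto
    finally have "cmod (integral {-h..h} (\<lambda>u. tri h u * echar (y * u))) * (2 * h * y)\<^sup>2 \<le> 4 / (h * (2 * pi * \<bar>y\<bar>))\<^sup>2 * (2 * h * y)\<^sup>2"
      by (intro mult_right_mono) auto
    also have "\<dots> = 4 / pi\<^sup>2" using h False by (simp add: field_simps power2_eq_square)
    also have "\<dots> \<le> 1"
      using power_mono[of 2 pi 2] pi_gt3 by simp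
    finally show ?thesis .
  qed simp
qed

text \<open>Fejer means multiply the Fourier coefficients by factors in \<open>[0, 1]\<close>, so
  the coefficient bounds hold uniformly in \<open>N\<close>, and the factor at frequency 0 is 1. For
  \<open>h \<le> 1/2\<close> one period contains the whole triangle, so the coefficients are the
  integrals over \<open>{-h..h}\<close>.\<close>

lemma triangle_fejer_approximation:
  assumes h: "0 < h" "h \<le> 1 / 2"
  obtains c :: "nat \<Rightarrow> int \<Rightarrow> complex" where
    "\<And>N k. cmod (c N k) \<le> 1" "\<And>N k. cmod (c N k) * (2 * h * of_int k)\<^sup>2 \<le> 1"
    "\<And>N. N > 0 \<Longrightarrow> c N 0 = 1"
    "\<And>t. (\<lambda>N. \<Sum>k\<in>{- int N..int N}. c N k * echar (of_int k * t)) \<longlonglongrightarrow> complex_of_real (tri h (int_dist t))"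
proof -
  define a where "a k = integral {-h..h} (\<lambda>u. tri h u * echar (- of_int k * u))" for k :: int
  have a_eq: "a k = integral {-1/2..1/2} (\<lambda>u. tri h (int_dist u) * echar (- of_int k * u))" for k
  proof -
    have "integral {-1/2..1/2} (\<lambda>u. tri h (int_dist u) * echar (- of_int k * u)) =
          integral {-1/2..1/2} (\<lambda>u. if u \<in> {-h..h} then tri h u * echar (- of_int k * u) else 0)"
      using h by (intro integral_cong) (auto simp: int_dist_eq_abs tri_eq_0)
    also have "\<dots> = a k"
      unfolding a_def using h by (subst integral_restrict_Int) (simp add: Int_absorb1)
    finally show ?thesis by simp
  qed
  define c where "c N k = of_nat (pair_diffs N k) / of_nat N * a k" for N k
  have pd: "real (pair_diffs N k) / real N \<le> 1" for N k
    using pair_diffs_le[of N k] by (cases "N = 0") (auto simp: divide_le_eq_1)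
  have cb: "cmod (c N k) \<le> cmod (a k)" for N k
    using mult_right_mono[OF pd[of N k], of "cmod (a k)"] by (simp add: c_def norm_mult norm_divide)
  show ?thesis
  proof
    show "cmod (c N k) \<le> 1" for N k
      using order_trans[OF cb tri_transform_bounds(1)[OF h(1), of "- of_int k", folded a_def]] .
    show "cmod (c N k) * (2 * h * of_int k)\<^sup>2 \<le> 1" for N k
      using order_trans[OF mult_right_mono[OF cb[of N k], of "(2 * h * of_int k)\<^sup>2"]]
        tri_transform_bounds(2)[OF h(1), of "- of_int k", folded a_def] by simp
    have "a 0 = 1"
      using has_integral_of_real[OF has_integral_tri[OF h(1)], where 'b = complex] by (simp add: a_def integral_unique o_def)
    thus "c N 0 = 1" if "N > 0" for N using that by (simp add: c_def)
    fix t
    have "(\<lambda>N. (\<Sum>x<N. \<Sum>y<N. a (int x - int y) * echar (of_int (int x - int y) * t)) / of_nat N)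
           \<longlonglongrightarrow> complex_of_real (tri h (int_dist t))"
    proof (rule fejer_convergence[where L = "1 / h\<^sup>2" and \<phi> = "\<lambda>t. tri h (int_dist t)"])
      show "\<bar>tri h (int_dist t) - tri h (int_dist u)\<bar> \<le> 1 / h\<^sup>2 * int_dist (t - u)" for t u
        by (rule order_trans[OF tri_lipschitz[OF h(1)]]) (intro mult_left_mono int_dist_lipschitz, simp)
      show "a k = integral {-1/2..1/2} (\<lambda>u. tri h (int_dist u) * echar (- of_int k * u))" for k
        by (rule a_eq)
    qed
    also have "(\<lambda>N. (\<Sum>x<N. \<Sum>y<N. a (int x - int y) * echar (of_int (int x - int y) * t)) / of_nat N) =
        (\<lambda>N. \<Sum>k\<in>{- int N..int N}. c N k * echar (of_int k * t))"
      by (rule ext, subst sum_pair_diffs[where g = "\<lambda>k. a k * echar (of_int k * t)"])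
         (simp add: c_def sum_divide_distrib mult.assoc)
    finally show "(\<lambda>N. \<Sum>k\<in>{- int N..int N}. c N k * echar (of_int k * t)) \<longlonglongrightarrow> complex_of_real (tri h (int_dist t))" .
  qed
qed

section \<open>Sums over integer vectors and matrices\<close>

lemma prod_sum_vec:
  fixes g :: "'n::finite \<Rightarrow> 'b \<Rightarrow> 'c::comm_semiring_1"
  assumes "\<And>i. finite (S i)"
  shows "(\<Prod>i\<in>UNIV. \<Sum>k\<in>S i. g i k) = (\<Sum>v\<in>{v :: 'b ^ 'n. \<forall>i. v $ i \<in> S i}. \<Prod>i\<in>UNIV. g i (v $ i))"
proof -
  have "(\<Prod>i\<in>UNIV. \<Sum>k\<in>S i. g i k) = (\<Sum>f\<in>PiE UNIV S. \<Prod>i\<in>UNIV. g i (f i))"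
    using assms by (intro prod_sum_PiE) auto
  also have "\<dots> = (\<Sum>v\<in>{v :: 'b ^ 'n. \<forall>i. v $ i \<in> S i}. \<Prod>i\<in>UNIV. g i (v $ i))"
    by (rule sum.reindex_bij_witness[where i = vec_nth and j = vec_lambda]) auto
  finally show ?thesis .
qed

lemma finite_vec_box:
  assumes "\<And>i. finite (S i)"
  shows "finite {v :: 'b ^ 'n::finite. \<forall>i. v $ i \<in> S i}"
proof -
  have "{v :: 'b ^ 'n. \<forall>i. v $ i \<in> S i} \<subseteq> vec_lambda ` (PiE UNIV S)"
    by (auto intro!: image_eqI[where x = "vec_nth _"])
  thus ?thesis by (rule finite_subset) (use assms in \<open>intro finite_imageI finite_PiE, auto\<close>)
qed

text \<open>By nonnegativity \<open>X\<close> may be enlarged to the box of its coordinate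
  projections, over which the sum of products factorises.\<close>

lemma sum_prod_vec_le:
  fixes g :: "'n::finite \<Rightarrow> 'b \<Rightarrow> real"
  assumes X: "finite X" and nn: "\<And>i y. 0 \<le> g i y"
    and B: "\<And>i Y. finite Y \<Longrightarrow> (\<Sum>y\<in>Y. g i y) \<le> B i"
  shows "(\<Sum>v\<in>X. \<Prod>i\<in>UNIV. g i (v $ i)) \<le> (\<Prod>i\<in>UNIV. B i)"
proof -
  define S where "S i = (\<lambda>v. v $ i) ` X" for i
  have fS: "finite (S i)" for i using X by (simp add: S_def)
  have "(\<Sum>v\<in>X. \<Prod>i\<in>UNIV. g i (v $ i)) \<le> (\<Sum>v\<in>{v. \<forall>i. v $ i \<in> S i}. \<Prod>i\<in>UNIV. g i (v $ i))"
    using nn by (intro sum_mono2 finite_vec_box fS prod_nonneg) (auto simp: S_def)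
  also have "\<dots> = (\<Prod>i\<in>UNIV. \<Sum>k\<in>S i. g i k)" by (rule prod_sum_vec[symmetric]) (rule fS)
  also have "\<dots> \<le> (\<Prod>i\<in>UNIV. B i)" using nn by (intro prod_mono conjI B sum_nonneg fS) auto
  finally show ?thesis .
qed

section \<open>Rank-one integer matrices and sup norms\<close>

definition outer :: "int ^ 'n \<Rightarrow> int ^ 'm \<Rightarrow> int ^ 'm ^ 'n" where
  "outer q k = (\<chi> i j. q $ i * k $ j)"

definition real_mat :: "int ^ 'm ^ 'n \<Rightarrow> real ^ 'm ^ 'n" where
  "real_mat l = (\<chi> i j. real_of_int (l $ i $ j))"

lemma outer_nth [simp]: "outer q k $ i $ j = q $ i * k $ j"
  by (simp add: outer_def)

lemma outer_0 [simp]: "outer q 0 = 0"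
  by (simp add: vec_eq_iff)

lemma real_mat_nth [simp]: "real_mat l $ i $ j = real_of_int (l $ i $ j)"
  by (simp add: real_mat_def)

lemma real_mat_0 [simp]: "real_mat 0 = 0"
  by (simp add: vec_eq_iff)

lemma inner_real_mat_outer:
  fixes x :: "real ^ 'm::finite ^ 'n::finite"
  shows "x \<bullet> real_mat (outer q k) = (\<Sum>j\<in>UNIV. of_int (k $ j) * (real_vec q \<bullet> column j x))"
proof -
  have "x \<bullet> real_mat (outer q k) = (\<Sum>i\<in>UNIV. \<Sum>j\<in>UNIV. x $ i $ j * (of_int (q $ i) * of_int (k $ j)))"
    by (simp add: inner_vec_def)
  also have "\<dots> = (\<Sum>j\<in>UNIV. \<Sum>i\<in>UNIV. x $ i $ j * (of_int (q $ i) * of_int (k $ j)))"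
    by (rule sum.swap)
  also have "\<dots> = (\<Sum>j\<in>UNIV. of_int (k $ j) * (real_vec q \<bullet> column j x))"
    by (intro sum.cong refl) (simp add: inner_vec_def real_vec_def column_def sum_distrib_left mult_ac)
  finally show ?thesis .
qed

lemma abs_nth_le_infnorm: "\<bar>x $ i $ j\<bar> \<le> infnorm (x :: real ^ 'm::finite ^ 'n::finite)"
proof -
  have "axis i (axis j 1) \<in> (Basis :: (real ^ 'm ^ 'n) set)" by (auto simp: Basis_vec_def)
  from Basis_le_infnorm[OF this, of x] show ?thesis by (simp add: inner_axis)
qed

lemma infnorm_le_iff: "infnorm (x :: real ^ 'm::finite ^ 'n::finite) \<le> c \<longleftrightarrow> (\<forall>i j. \<bar>x $ i $ j\<bar> \<le> c)"
proof
  assume "\<forall>i j. \<bar>x $ i $ j\<bar> \<le> c"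
  hence "\<bar>x \<bullet> b\<bar> \<le> c" if "b \<in> Basis" for b
    using that by (auto simp: Basis_vec_def inner_axis)
  thus "infnorm x \<le> c" unfolding infnorm_Max by (subst Max_le_iff) auto
qed (use abs_nth_le_infnorm order_trans in blast)

lemma one_plus_infnorm_le:
  "1 + infnorm (x + y) \<le> (1 + infnorm x) * (1 + infnorm (y :: 'a::euclidean_space))"
proof -
  have "infnorm (x + y) \<le> infnorm x + infnorm y" by (rule infnorm_triangle)
  thus ?thesis using mult_nonneg_nonneg[OF infnorm_pos_le[of x] infnorm_pos_le[of y]] by (simp add: algebra_simps)
qed

lemma abs_nth_le_sup_abs: "\<bar>real_of_int (q $ i)\<bar> \<le> sup_abs (q :: int ^ 'n::finite)"
proof -
  have "\<bar>q $ i\<bar> \<le> Max (range (\<lambda>i. \<bar>q $ i\<bar>))" by (intro Max_ge) auto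
  thus ?thesis unfolding sup_abs_def by (metis of_int_abs of_int_le_iff)
qed

lemma sup_abs_attained: "\<exists>i. \<bar>real_of_int (q $ i)\<bar> = sup_abs (q :: int ^ 'n::finite)"
proof -
  have "Max (range (\<lambda>i. \<bar>q $ i\<bar>)) \<in> range (\<lambda>i. \<bar>q $ i\<bar>)" by (intro Max_in) auto
  then obtain i where "Max (range (\<lambda>i. \<bar>q $ i\<bar>)) = \<bar>q $ i\<bar>" by blast
  thus ?thesis by (auto simp: sup_abs_def intro!: exI[of _ i])
qed

lemma sup_abs_nonneg [simp]: "0 \<le> sup_abs (q :: int ^ 'n::finite)"
  using sup_abs_attained[of q] by (metis abs_ge_zero)

lemma sup_abs_ge_1: "q \<noteq> 0 \<Longrightarrow> 1 \<le> sup_abs (q :: int ^ 'n::finite)"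
proof -
  assume "q \<noteq> 0"
  then obtain i where "q $ i \<noteq> 0" by (auto simp: vec_eq_iff)
  hence "1 \<le> \<bar>real_of_int (q $ i)\<bar>" by linarith
  thus ?thesis using abs_nth_le_sup_abs[of q i] by linarith
qed

lemma finite_sup_abs_le: "finite {q :: int ^ 'n::finite. sup_abs q \<le> M}"
proof (rule finite_subset)
  show "{q :: int ^ 'n. sup_abs q \<le> M} \<subseteq> {q. \<forall>i. q $ i \<in> {- \<lceil>M\<rceil>..\<lceil>M\<rceil>}}"
  proof safe
    fix q :: "int ^ 'n" and i assume "sup_abs q \<le> M"
    hence "\<bar>real_of_int (q $ i)\<bar> \<le> M" using abs_nth_le_sup_abs[of q i] by linarith
    thus "q $ i \<in> {- \<lceil>M\<rceil>..\<lceil>M\<rceil>}" by auto linarith+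
  qed
qed (rule finite_vec_box, simp)

lemma infnorm_outer_ge: "sup_abs q * \<bar>of_int (k $ j)\<bar> \<le> infnorm (real_mat (outer q (k :: int ^ 'm::finite) :: int ^ 'm ^ 'n::finite))"
proof -
  obtain i where i: "\<bar>real_of_int (q $ i)\<bar> = sup_abs q" using sup_abs_attained by blast
  have "sup_abs q * \<bar>of_int (k $ j)\<bar> = \<bar>real_mat (outer q k) $ i $ j\<bar>" by (simp add: abs_mult i)
  thus ?thesis using abs_nth_le_infnorm by metis
qed

text \<open>The sup norm is exactly multiplicative on rank-one matrices; decay in the frequency
  therefore splits into a factor for \<open>q\<close> and one for \<open>k\<close> without
  loss.\<close>

lemma infnorm_outer: "infnorm (real_mat (outer q (k :: int ^ 'm::finite) :: int ^ 'm ^ 'n::finite)) = sup_abs q * sup_abs k"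
proof (rule antisym)
  show "infnorm (real_mat (outer q k)) \<le> sup_abs q * sup_abs k"
    by (auto simp: infnorm_le_iff abs_mult intro!: mult_mono abs_nth_le_sup_abs)
  obtain j where "\<bar>real_of_int (k $ j)\<bar> = sup_abs k" using sup_abs_attained by blast
  thus "sup_abs q * sup_abs k \<le> infnorm (real_mat (outer q k))" using infnorm_outer_ge[of q k j] by simp
qed

section \<open>Sums over the integers\<close>

lemma sum_int_abs_le:
  fixes f :: "nat \<Rightarrow> real"
  assumes "finite Y" "\<And>k. k \<in> Y \<Longrightarrow> nat \<bar>k\<bar> \<le> N" "\<And>n. 0 \<le> f n"
  shows "(\<Sum>k\<in>Y. f (nat \<bar>k\<bar>)) \<le> 2 * (\<Sum>n\<le>N. f n)"
proof -
  have half: "(\<Sum>k\<in>Z. f (nat \<bar>k\<bar>)) \<le> (\<Sum>n\<le>N. f n)" if "Z \<subseteq> Y" "inj_on (\<lambda>k. nat \<bar>k\<bar>) Z" for Z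
  proof -
    have "(\<Sum>k\<in>Z. f (nat \<bar>k\<bar>)) = sum f ((\<lambda>k. nat \<bar>k\<bar>) ` Z)" using that by (simp add: sum.reindex)
    also have "\<dots> \<le> (\<Sum>n\<le>N. f n)" using assms that by (intro sum_mono2) auto
    finally show ?thesis .
  qed
  have "Y = {k\<in>Y. 0 \<le> k} \<union> {k\<in>Y. k < 0}" by auto
  hence "(\<Sum>k\<in>Y. f (nat \<bar>k\<bar>)) = (\<Sum>k\<in>{k\<in>Y. 0 \<le> k}. f (nat \<bar>k\<bar>)) + (\<Sum>k\<in>{k\<in>Y. k < 0}. f (nat \<bar>k\<bar>))"
    using assms(1) by (subst sum.union_disjoint[symmetric]) auto
  also have "\<dots> \<le> (\<Sum>n\<le>N. f n) + (\<Sum>n\<le>N. f n)"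
    by (intro add_mono half) (auto simp: inj_on_def)
  finally show ?thesis by simp
qed

text \<open>Replacing \<open>u\<close> by its floor moves each distance by at most 1, which costs
  the factor \<open>2 powr p\<close>. Uniformity in the real shift \<open>u\<close> is the point: it
  yields bounds on all cosets of the lattice at once.\<close>

lemma lattice_sum_bound:
  assumes p: "p > 1"
  obtains C :: real where "\<And>(u :: real) (Y :: int set). finite Y \<Longrightarrow> (\<Sum>k\<in>Y. (1 + \<bar>u - of_int k\<bar>) powr - p) \<le> C"
proof -
  have sm: "summable (\<lambda>n. real (Suc n) powr - p)"
    using p by (subst summable_Suc_iff) (simp add: summable_real_powr_iff)
  define C where "C = 2 powr p * (2 * (\<Sum>n. real (Suc n) powr - p))"
  show ?thesis
  proof
    fix u :: real and Y :: "int set" assume Y: "finite Y"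
    define Z where "Z = (\<lambda>k. k - \<lfloor>u\<rfloor>) ` Y"
    have le: "(1 + \<bar>u - of_int k\<bar>) powr - p \<le> 2 powr p * real (Suc (nat \<bar>k - \<lfloor>u\<rfloor>\<bar>)) powr - p" for k
    proof -
      have "(1 + \<bar>real_of_int (k - \<lfloor>u\<rfloor>)\<bar>) / 2 \<le> 1 + \<bar>u - of_int k\<bar>"
      proof -
        define v where "v = real_of_int \<lfloor>u\<rfloor>"
        have "v \<le> u" "u < v + 1" unfolding v_def by linarith+
        hence ab: "\<bar>real_of_int k - v\<bar> \<le> \<bar>u - of_int k\<bar> + 1" by linarith
        have "(1 + a) / 2 \<le> 1 + b" if "a \<le> b + 1" "0 \<le> b" for a b :: real
          using that by (simp add: field_simps)
        from this[OF ab abs_ge_zero]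
        have "(1 + \<bar>real_of_int k - v\<bar>) / 2 \<le> 1 + \<bar>u - of_int k\<bar>" .
        thus ?thesis by (simp add: v_def)
      qed
      hence "(1 + \<bar>u - of_int k\<bar>) powr - p \<le> ((1 + \<bar>real_of_int (k - \<lfloor>u\<rfloor>)\<bar>) / 2) powr - p"
        using p by (intro powr_mono2') auto
      also have "\<dots> = 2 powr p * (1 + \<bar>real_of_int (k - \<lfloor>u\<rfloor>)\<bar>) powr - p"
        by (simp add: powr_divide powr_minus field_simps)
      also have "1 + \<bar>real_of_int (k - \<lfloor>u\<rfloor>)\<bar> = real (Suc (nat \<bar>k - \<lfloor>u\<rfloor>\<bar>))" by simp
      finally show ?thesis .
    qed
    have "(\<Sum>k\<in>Y. (1 + \<bar>u - of_int k\<bar>) powr - p) \<le> (\<Sum>k\<in>Y. 2 powr p * real (Suc (nat \<bar>k - \<lfloor>u\<rfloor>\<bar>)) powr - p)"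
      by (intro sum_mono le)
    also have "\<dots> = 2 powr p * (\<Sum>k\<in>Z. real (Suc (nat \<bar>k\<bar>)) powr - p)"
      unfolding Z_def by (subst sum.reindex) (auto simp: inj_on_def sum_distrib_left)
    also have "\<dots> \<le> 2 powr p * (2 * (\<Sum>n\<le>Max ((\<lambda>k. nat \<bar>k\<bar>) ` Z). real (Suc n) powr - p))"
      by (intro mult_left_mono sum_int_abs_le[where f = "\<lambda>n. real (Suc n) powr - p"]) (auto simp: Z_def Y)
    also have "\<dots> \<le> C" unfolding C_def
      by (intro mult_left_mono sum_le_suminf sm) auto
    finally show "(\<Sum>k\<in>Y. (1 + \<bar>u - of_int k\<bar>) powr - p) \<le> C" .
  qed
qed

section \<open>The divisor bound\<close>

lemma card_divisors_prime_power_mult: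
  fixes p m :: nat
  assumes "prime p" "m > 0"
  shows "card {d. d dvd p ^ a * m} \<le> (a + 1) * card {d. d dvd m}"
proof -
  have "{d. d dvd p ^ a * m} \<subseteq> (\<lambda>(i, d). p ^ i * d) ` ({..a} \<times> {d. d dvd m})"
  proof safe
    fix d assume "d dvd p ^ a * m"
    then obtain b c where bc: "d = b * c" "b dvd p ^ a" "c dvd m" using division_decomp by blast
    then obtain i where "i \<le> a" "b = p ^ i" using divides_primepow_nat assms(1) by blast
    thus "d \<in> (\<lambda>(i, d). p ^ i * d) ` ({..a} \<times> {d. d dvd m})"
      using bc by (intro image_eqI[where x = "(i, c)"]) auto
  qed
  hence "card {d. d dvd p ^ a * m} \<le> card ((\<lambda>(i, d). p ^ i * d) ` ({..a} \<times> {d. d dvd m}))"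
    using assms by (intro card_mono) auto
  also have "\<dots> \<le> card ({..a} \<times> {d. d dvd m})" using assms by (intro card_image_le) auto
  finally show ?thesis by (simp add: card_cartesian_product)
qed

text \<open>A prime with \<open>p powr \<epsilon> \<ge> 2\<close> contributes
  \<open>a + 1 \<le> 2 ^ a \<le> p powr (\<epsilon> * a)\<close>, with no loss. Each smaller prime
  costs at most a constant factor \<open>B\<close>, and there are at most \<open>P\<close> of these,
  whatever \<open>n\<close> is.\<close>

lemma divisor_bound:
  assumes "\<epsilon> > 0"
  obtains C :: real where "\<And>n::nat. n > 0 \<Longrightarrow> real (card {d. d dvd n}) \<le> C * real n powr \<epsilon>"
proof -
  define x where "x = 2 powr \<epsilon>"
  have x: "x > 1" using assms by (simp add: x_def)
  \<comment> \<open>By Bernoulli \<open>x ^ a \<ge> 1 + a * (x - 1)\<close>; the condition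
    \<open>B \<ge> 1\<close> absorbs the summand 1 of \<open>a + 1\<close>, and
    \<open>B * (x - 1) \<ge> 1\<close> absorbs \<open>a\<close>.\<close>
  define B where "B = max 1 (1 / (x - 1))"
  have B1: "B \<ge> 1" by (simp add: B_def)
  have Bb: "real a + 1 \<le> B * x ^ a" for a
  proof -
    have "1 + real a * (x - 1) \<le> (1 + (x - 1)) ^ a" using x by (intro Bernoulli_inequality) auto
    hence "B * (1 + real a * (x - 1)) \<le> B * x ^ a" using B1 by (intro mult_left_mono) auto
    moreover have "real a * 1 \<le> real a * (B * (x - 1))"
    proof (intro mult_left_mono)
      have "1 / (x - 1) * (x - 1) \<le> B * (x - 1)" using x by (intro mult_right_mono) (auto simp: B_def)
      thus "1 \<le> B * (x - 1)" using x by simp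
    qed auto
    ultimately show ?thesis using B1 by (simp add: algebra_simps)
  qed
  define P where "P = nat \<lceil>2 powr (1 / \<epsilon>)\<rceil>"
  have step: "real (a + 1) \<le> (if p < P then B else 1) * (real p powr \<epsilon>) ^ a" if "prime p" for p a :: nat
  proof (cases "p < P")
    case True
    have "x ^ a \<le> (real p powr \<epsilon>) ^ a"
      using prime_ge_2_nat[OF that] assms x unfolding x_def by (intro power_mono powr_mono2) auto
    hence "B * x ^ a \<le> B * (real p powr \<epsilon>) ^ a" using B1 by (intro mult_left_mono) auto
    thus ?thesis using True Bb[of a] by simp
  next
    case False
    hence "2 powr (1 / \<epsilon>) \<le> real p" by (simp add: P_def) linarith
    hence "(2 powr (1 / \<epsilon>)) powr \<epsilon> \<le> real p powr \<epsilon>" using assms by (intro powr_mono2) auto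
    hence "2 \<le> real p powr \<epsilon>" using assms by (simp add: powr_powr)
    hence "2 ^ a \<le> (real p powr \<epsilon>) ^ a" by (intro power_mono) auto
    moreover have "real (a + 1) \<le> 2 ^ a"
      using Bernoulli_inequality[of "1::real" a] by simp
    ultimately show ?thesis using False by simp
  qed
  have main: "real (card {d. d dvd n}) \<le> (\<Prod>p\<in>prime_factors n. if p < P then B else 1) * real n powr \<epsilon>"
    if "n > 0" for n :: nat
    using that
  proof (induction n rule: less_induct)
    case (less n)
    show ?case
    proof (cases "n = 1")
      case False
      then obtain p where p: "prime p" "p dvd n" using prime_factor_nat by blast
      define a where "a = multiplicity p n"
      obtain m where m: "n = p ^ a * m" "\<not> p dvd m"
        unfolding a_def using multiplicity_decompose'[of n p] p less.prems by (metis not_prime_unit neq0_conv)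
      have a0: "a > 0" using p less.prems m(1,2) by (metis gr0I mult_1 power_0)
      have m0: "m > 0" using m less.prems by (intro gr0I) auto
      have "p ^ a > 1" using p a0 by (metis prime_gt_1_nat one_less_power)
      hence "m < n" using m(1) m0 by simp
      note IH = less.IH[OF this m0]
      have pf: "prime_factors n = insert p (prime_factors m)"
        unfolding m(1) using p m0 a0 prime_gt_0_nat[OF p(1)]
        by (auto simp: in_prime_factors_iff prime_dvd_mult_iff prime_dvd_power_iff primes_dvd_imp_eq)
      have np: "p \<notin> prime_factors m" using m(2) by auto
      have "real (card {d. d dvd n}) \<le> real ((a + 1) * card {d. d dvd m})"
        using card_divisors_prime_power_mult[OF p(1) m0, of a] by (simp only: m(1) of_nat_le_iff)
      also have "\<dots> = real (a + 1) * real (card {d. d dvd m})" by (rule of_nat_mult)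
      also have "\<dots> \<le> ((if p < P then B else 1) * (real p powr \<epsilon>) ^ a) *
            ((\<Prod>p\<in>prime_factors m. if p < P then B else 1) * real m powr \<epsilon>)"
        using B1 by (intro mult_mono step p IH mult_nonneg_nonneg) auto
      also have "\<dots> = (\<Prod>p\<in>prime_factors n. if p < P then B else 1) * real n powr \<epsilon>"
        unfolding pf using np by (simp add: m(1) powr_mult powr_power mult_ac powr_realpow[symmetric] powr_powr prime_gt_0_nat p)
      finally show ?thesis .
    qed simp
  qed
  show ?thesis
  proof
    fix n :: nat assume n: "n > 0"
    have "(\<Prod>p\<in>prime_factors n. if p < P then B else 1) = (\<Prod>p\<in>{p\<in>prime_factors n. p < P}. B)"
      by (subst prod.inter_filter) auto
    also have "\<dots> = B ^ card {p\<in>prime_factors n. p < P}" by simp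
    also have "\<dots> \<le> B ^ P"
    proof (intro power_increasing B1)
      have "card {p\<in>prime_factors n. p < P} \<le> card {..<P}" by (intro card_mono) auto
      thus "card {p\<in>prime_factors n. p < P} \<le> P" by simp
    qed
    finally have "(\<Prod>p\<in>prime_factors n. if p < P then B else 1) * real n powr \<epsilon> \<le> B ^ P * real n powr \<epsilon>"
      by (intro mult_right_mono) auto
    thus "real (card {d. d dvd n}) \<le> B ^ P * real n powr \<epsilon>" using main[OF n] by linarith
  qed
qed

text \<open>
  A factorisation \<open>l = outer q k\<close> is determined by the single entry \<open>k $ j\<close>, which divides a
  nonzero entry of \<open>l\<close>.
\<close>

lemma outer_fiber_bound:
  assumes "\<epsilon> > 0"
  obtains C :: real where "C > 0"
    "\<And>(l :: int ^ 'm::finite ^ 'n::finite) P. l \<noteq> 0 \<Longrightarrow> P \<subseteq> {p. outer (fst p) (snd p) = l} \<Longrightarrow>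
       real (card P) \<le> C * infnorm (real_mat l) powr \<epsilon>"
proof -
  obtain C where C: "\<And>n::nat. n > 0 \<Longrightarrow> real (card {d. d dvd n}) \<le> C * real n powr \<epsilon>"
    using divisor_bound[OF assms] by blast
  have C1: "C \<ge> 1" using C[of 1] by simp
  show ?thesis
  proof
    show "2 * C > 0" using C1 by simp
    fix l :: "int ^ 'm ^ 'n" and P
    assume l: "l \<noteq> 0" and P: "P \<subseteq> {p. outer (fst p) (snd p) = l}"
    obtain i j where ij: "l $ i $ j \<noteq> 0" using l by (auto simp: vec_eq_iff)
    define N where "N = nat \<bar>l $ i $ j\<bar>"
    have N0: "N > 0" using ij by (simp add: N_def)
    have inj: "inj_on (\<lambda>p. snd p $ j) P"
    proof (rule inj_onI)
      fix p p' assume pp: "p \<in> P" "p' \<in> P" "snd p $ j = snd p' $ j"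
      have e: "fst p $ a * snd p $ b = fst p' $ a * snd p' $ b" for a b
      proof -
        have "outer (fst p) (snd p) = l" "outer (fst p') (snd p') = l" using pp P by auto
        thus ?thesis by (metis outer_nth)
      qed
      have "outer (fst p) (snd p) $ i $ j \<noteq> 0" using ij pp P by auto
      hence nz: "fst p $ i \<noteq> 0" "snd p $ j \<noteq> 0" by auto
      have f: "fst p = fst p'" using e[of _ j] nz pp(3) by (simp add: vec_eq_iff)
      have "snd p = snd p'" using e[of i] nz f by (simp add: vec_eq_iff)
      with f show "p = p'" by (simp add: prod_eq_iff)
    qed
    \<comment> \<open>Divisors are counted as natural numbers; the two copies account for the sign
      of \<open>k $ j\<close> and give the factor 2.\<close>
    have img: "(\<lambda>p. snd p $ j) ` P \<subseteq> int ` {d. d dvd N} \<union> (\<lambda>d. - int d) ` {d. d dvd N}"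
    proof safe
      fix q k assume qk: "(q, k) \<in> P" and not: "snd (q, k) $ j \<notin> (\<lambda>d. - int d) ` {d. d dvd N}"
      have "outer q k = l" using P qk by auto
      hence "q $ i * k $ j = l $ i $ j" by auto
      hence "k $ j dvd l $ i $ j" by (metis dvd_triv_right)
      hence d: "nat \<bar>k $ j\<bar> dvd N" by (simp add: N_def nat_dvd_iff)
      have "k $ j \<ge> 0"
      proof (rule ccontr)
        assume "\<not> k $ j \<ge> 0"
        hence "snd (q, k) $ j = - int (nat \<bar>k $ j\<bar>)" by simp
        thus False using not d by blast
      qed
      hence "snd (q, k) $ j = int (nat \<bar>k $ j\<bar>)" by simp
      thus "snd (q, k) $ j \<in> int ` {d. d dvd N}" using d by blast
    qed
    have fin: "finite {d. d dvd N}" using N0 by simp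
    have "card P = card ((\<lambda>p. snd p $ j) ` P)" using inj by (simp add: card_image)
    also have "\<dots> \<le> card (int ` {d. d dvd N} \<union> (\<lambda>d. - int d) ` {d. d dvd N})"
      using fin by (intro card_mono img) auto
    also have "\<dots> \<le> card {d. d dvd N} + card {d. d dvd N}"
      using fin by (intro order_trans[OF card_Un_le] add_mono card_image_le)
    finally have "real (card P) \<le> 2 * real (card {d. d dvd N})" by simp
    also have "\<dots> \<le> 2 * (C * real N powr \<epsilon>)" using C[OF N0] by simp
    also have "\<dots> \<le> 2 * (C * infnorm (real_mat l) powr \<epsilon>)"
    proof -
      have "real N = \<bar>real_mat l $ i $ j\<bar>" by (simp add: N_def)
      hence "real N \<le> infnorm (real_mat l)" by (metis abs_nth_le_infnorm)
      thus ?thesis using C1 assms by (intro mult_left_mono powr_mono2) auto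
    qed
    finally show "real (card P) \<le> 2 * C * infnorm (real_mat l) powr \<epsilon>" by simp
  qed
qed

section \<open>The upper bound\<close>

text \<open>Every point outside the support has a basic neighbourhood of measure zero, and a
  countable basis offers only countably many of these.\<close>

lemma AE_measure_support:
  fixes \<mu> :: "'a::second_countable_topology measure"
  assumes [simp, measurable_cong]: "sets \<mu> = sets borel"
  shows "AE x in \<mu>. x \<in> measure_support \<mu>"
proof -
  obtain B :: "'a set set" where B: "countable B" "topological_basis B" using ex_countable_basis by blast
  define N where "N = {U\<in>B. emeasure \<mu> U = 0}"
  have "(\<Union>U\<in>N. U) \<in> null_sets \<mu>"
  proof (rule null_sets_UN')
    show "countable N" using B by (simp add: N_def)
    show "U \<in> null_sets \<mu>" if "U \<in> N" for U
      using that B by (auto simp: N_def null_sets_def topological_basis_open)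
  qed
  moreover have "{x\<in>space \<mu>. x \<notin> measure_support \<mu>} \<subseteq> (\<Union>U\<in>N. U)"
  proof safe
    fix x assume "x \<notin> measure_support \<mu>"
    then obtain U where U: "open U" "x \<in> U" "emeasure \<mu> U = 0" by (auto simp: measure_support_def)
    then obtain V where V: "V \<in> B" "x \<in> V" "V \<subseteq> U" using B(2) topological_basisE by blast
    have "emeasure \<mu> V \<le> emeasure \<mu> U" using V U by (intro emeasure_mono) auto
    thus "x \<in> (\<Union>U\<in>N. U)" using V U by (auto simp: N_def)
  qed
  ultimately show ?thesis by (rule AE_I')
qed

text \<open>For \<open>N \<le> 1 / (6 * \<psi>)\<close> all phases \<open>a * t\<close>,
  \<open>a < N\<close>, lie within 1/6 of an integer, so each term has real part at least
  \<open>cos (pi / 3) = 1/2\<close>. The maximum with 1 covers large \<open>\<psi>\<close>, where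
  the sum may be the single term 1. In the constant 12, a factor 2 is lost to the floor.\<close>

lemma dirichlet_lower_bound:
  assumes \<psi>: "\<psi> > 0" and N: "N = max 1 (nat \<lfloor>1 / (6 * \<psi>)\<rfloor>)"
  shows "int_dist t < \<psi> \<Longrightarrow> real N / 2 \<le> cmod (\<Sum>a<N. echar (real a * t))"
    and "1 / real N \<le> 12 * \<psi>"
proof -
  assume t: "int_dist t < \<psi>"
  show "real N / 2 \<le> cmod (\<Sum>a<N. echar (real a * t))"
  proof (cases "N = 1")
    case False
    obtain k where k: "int_dist t = \<bar>t - of_int k\<bar>" using int_dist_attained by blast
    define w where "w = t - of_int k"
    have "real N \<le> 1 / (6 * \<psi>)" using False N \<psi> by (simp add: max_def split: if_splits)
    hence Nw: "real N * \<bar>w\<bar> \<le> 1 / 6"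
      using mult_mono[of "real N" "1 / (6 * \<psi>)" "\<bar>w\<bar>" \<psi>] t k \<psi> by (simp add: w_def)
    have "1 / 2 \<le> Re (echar (real a * t))" if "a < N" for a
    proof -
      have "real a * t = real a * w + of_int (int a * k)" by (simp add: w_def algebra_simps)
      hence "echar (real a * t) = echar (real a * w)" by (simp only: echar_add echar_of_int mult_1_right)
      hence "Re (echar (real a * t)) = cos \<bar>2 * pi * (real a * w)\<bar>" by (simp add: echar_def)
      moreover have "cos (pi / 3) \<le> cos \<bar>2 * pi * (real a * w)\<bar>"
      proof (rule cos_monotone_0_pi_le)
        have "real a * \<bar>w\<bar> \<le> real N * \<bar>w\<bar>" using that by (intro mult_right_mono) auto
        hence "2 * pi * (real a * \<bar>w\<bar>) \<le> 2 * pi * (1 / 6)" using Nw by (intro mult_left_mono) auto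
        thus "\<bar>2 * pi * (real a * w)\<bar> \<le> pi / 3" by (simp add: abs_mult)
      qed auto
      ultimately show ?thesis by (simp add: cos_60)
    qed
    hence "(\<Sum>a<N. 1 / 2) \<le> (\<Sum>a<N. Re (echar (real a * t)))" by (intro sum_mono) auto
    also have "\<dots> = Re (\<Sum>a<N. echar (real a * t))" by simp
    also have "\<dots> \<le> cmod (\<Sum>a<N. echar (real a * t))" by (rule complex_Re_le_cmod)
    finally show ?thesis by simp
  qed simp
next
  show "1 / real N \<le> 12 * \<psi>"
  proof (cases "1 \<le> 1 / (6 * \<psi>)")
    case True
    hence "1 \<le> \<lfloor>1 / (6 * \<psi>)\<rfloor>" by (simp add: le_floor_iff)
    hence "1 / (6 * \<psi>) < 2 * real_of_int \<lfloor>1 / (6 * \<psi>)\<rfloor>" by linarith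
    also have "real_of_int \<lfloor>1 / (6 * \<psi>)\<rfloor> \<le> real N" using N by linarith
    finally have "1 / (6 * \<psi>) \<le> 2 * real N" by simp
    thus ?thesis using \<psi> N by (simp add: field_simps)
  next
    case False
    hence "1 \<le> 12 * \<psi>" using \<psi> by (simp add: field_simps)
    moreover have "1 / real N \<le> 1" using N by simp
    ultimately show ?thesis by linarith
  qed
qed

text \<open>Each term is compared with the increment of \<open>x powr (1 - s) / (1 - s)\<close>, and
  these telescope; the leading 1 is the term \<open>n = 0\<close>.\<close>

lemma sum_powr_le:
  assumes s: "0 < s" "s < 1"
  shows "(\<Sum>n\<le>N. max 1 (real n) powr - s) \<le> 1 + real N powr (1 - s) / (1 - s)"
proof (induction N)
  case (Suc N)
  have "real (Suc N) powr - s \<le> (real (Suc N) powr (1 - s) - real N powr (1 - s)) / (1 - s)"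
  proof (cases "N = 0")
    case False
    have "((\<lambda>x. x powr (1 - s)) has_real_derivative (1 - s) * x powr (1 - s - 1)) (at x)" if "real N \<le> x" for x
      using that False by (intro has_real_derivative_powr) auto
    then obtain z where z: "real N < z" "z < real (Suc N)"
      "real (Suc N) powr (1 - s) - real N powr (1 - s) = (real (Suc N) - real N) * ((1 - s) * z powr (1 - s - 1))"
      using MVT2[of "real N" "real (Suc N)" "\<lambda>x. x powr (1 - s)" "\<lambda>x. (1 - s) * x powr (1 - s - 1)"] by auto
    have "real (Suc N) powr - s \<le> z powr - s" using z s by (intro powr_mono2') auto
    thus ?thesis using z s by simp
  qed (use s in simp)
  thus ?case using Suc.IH by (simp add: diff_divide_distrib)
qed (use assms in simp)

text \<open>For \<open>s < 1\<close> the average of \<open>\<bar>k\<bar> powr - s\<close> over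
  \<open>\<bar>k\<bar> \<le> N\<close> has the size of its value at the end,
  \<open>N powr - s\<close>. Beyond 1 the small \<open>k\<close> dominate and the average is only of
  order \<open>1 / N\<close>; this is how exponents below 1 enter the upper bound.\<close>

lemma fejer_average_bound:
  assumes s: "0 < s" "s < 1" and N: "N > 0"
  shows "(\<Sum>k\<in>{- int N..int N}. real (pair_diffs N k) / (real N)\<^sup>2 * max 1 \<bar>of_int k\<bar> powr - s)
           \<le> 2 * (1 + 1 / (1 - s)) * (1 / real N) powr s"
proof -
  have "(\<Sum>k\<in>{- int N..int N}. real (pair_diffs N k) / (real N)\<^sup>2 * max 1 \<bar>of_int k\<bar> powr - s)
     \<le> (\<Sum>k\<in>{- int N..int N}. 1 / real N * max 1 \<bar>of_int k\<bar> powr - s)"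
    using pair_diffs_le[of N] N by (intro sum_mono mult_right_mono) (auto simp: field_simps power2_eq_square)
  also have "\<dots> = 1 / real N * (\<Sum>k\<in>{- int N..int N}. max 1 (real (nat \<bar>k\<bar>)) powr - s)"
    unfolding sum_distrib_left by (intro sum.cong refl) (simp add: of_nat_nat)
  also have "\<dots> \<le> 1 / real N * (2 * (\<Sum>n\<le>N. max 1 (real n) powr - s))"
    by (intro mult_left_mono sum_int_abs_le[where f = "\<lambda>n. max 1 (real n) powr - s"]) auto
  also have "\<dots> \<le> 1 / real N * (2 * (1 + real N powr (1 - s) / (1 - s)))"
    by (intro mult_left_mono sum_powr_le s) auto
  also have "\<dots> \<le> 1 / real N * (2 * (real N powr (1 - s) + real N powr (1 - s) / (1 - s)))"
    using N s by (intro mult_left_mono add_right_mono ge_one_powr_ge_zero) auto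
  also have "\<dots> = 2 * (1 + 1 / (1 - s)) * (real N powr (1 - s) / real N)"
    by (simp add: algebra_simps)
  also have "real N powr (1 - s) / real N = (1 / real N) powr s"
    using N by (simp add: powr_diff powr_divide)
  finally show ?thesis .
qed

lemma integrable_echar:
  fixes \<mu> :: "'a::euclidean_space measure"
  assumes "finite_measure \<mu>" and [measurable_cong]: "sets \<mu> = sets borel"
  shows "integrable \<mu> (\<lambda>x. echar (- (x \<bullet> y)))"
proof -
  interpret finite_measure \<mu> by fact
  show ?thesis by (rule integrable_const_bound[where B = 1]) auto
qed

lemma norm_fourier_transform_le_1:
  assumes "prob_space \<mu>" shows "cmod (fourier_transform \<mu> x) \<le> 1"
proof -
  interpret prob_space \<mu> by fact
  have "cmod (fourier_transform \<mu> x) \<le> (LINT y|\<mu>. cmod (echar (- (y \<bullet> x))))"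
    unfolding fourier_transform_echar by (rule integral_norm_bound)
  thus ?thesis by (simp add: prob_space)
qed

text \<open>The product term comes from frequency 0, the other from the nonzero frequencies. For
  these only the coordinate \<open>k $ j0\<close> is kept in the decay, and the averages over the
  other coordinates equal 1. As \<open>j0\<close> is free, it can later be taken to be the index of
  the minimum.\<close>

lemma measure_approx_set_le:
  fixes \<mu> :: "(real ^ 'm::finite ^ 'n::finite) measure" and \<psi> :: "'m \<Rightarrow> real"
  assumes prob: "prob_space \<mu>" and S [simp, measurable_cong]: "sets \<mu> = sets borel"
    and s: "0 < s" "s < 1" and C: "C \<ge> 0"
    and decay: "\<And>x. 1 \<le> infnorm x \<Longrightarrow> cmod (fourier_transform \<mu> x) \<le> C * infnorm x powr - s"
    and q: "q \<noteq> 0" and \<psi>: "\<And>j. \<psi> j > 0"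
  shows "measure \<mu> {x. \<forall>j. int_dist (real_vec q \<bullet> column j x) < \<psi> j} \<le>
           4 ^ CARD('m) * (12 ^ CARD('m) * (\<Prod>j\<in>UNIV. \<psi> j) +
             C * (2 * (1 + 1 / (1 - s)) * (12 * \<psi> j0 / sup_abs q) powr s))"
proof -
  interpret prob_space \<mu> by fact
  have [simp]: "space \<mu> = UNIV" using sets_eq_imp_space_eq[OF S] by simp
  define A where "A = {x. \<forall>j. int_dist (real_vec q \<bullet> column j x) < \<psi> j}"
  define N where "N j = max 1 (nat \<lfloor>1 / (6 * \<psi> j)\<rfloor>)" for j
  have N0: "N j > 0" for j by (simp add: N_def)
  define p where "p j k = real (pair_diffs (N j) k) / (real (N j))\<^sup>2" for j k
  have p0: "p j k \<ge> 0" for j k by (simp add: p_def)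
  define t where "t j x = real_vec q \<bullet> column j x" for j and x :: "real ^ 'm ^ 'n"
  \<comment> \<open>Each squared Dirichlet sum is divided by its peak value
    \<open>(N j)\<^sup>2\<close>, not by \<open>N j\<close> as in the Fejer kernel: \<open>T\<close>
    is then at most 1, at least \<open>(1/4) ^ CARD('m)\<close> on \<open>A\<close>, and the weights
    \<open>p j\<close> sum to 1.\<close>
  define T where "T x = (\<Prod>j\<in>UNIV. (cmod (\<Sum>a<N j. echar (real a * t j x)))\<^sup>2 / (real (N j))\<^sup>2)" for x
  define K where "K = {k :: int ^ 'm. \<forall>j. k $ j \<in> {- int (N j)..int (N j)}}"
  have fK: "finite K" unfolding K_def by (rule finite_vec_box) simp
  define P where "P k = (\<Prod>j\<in>UNIV. p j (k $ j))" for k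
  have P0: "P k \<ge> 0" for k unfolding P_def by (intro prod_nonneg ballI p0)
  have tcont: "continuous_on UNIV (t j)" for j
    unfolding t_def column_def by (intro continuous_intros)
  have [measurable]: "t j \<in> borel_measurable borel" for j
    by (rule borel_measurable_continuous_onI[OF tcont])
  have [measurable]: "T \<in> borel_measurable borel" unfolding T_def by measurable
  have T0: "T x \<ge> 0" for x unfolding T_def by (intro prod_nonneg) auto
  have T1: "T x \<le> 1" for x
    unfolding T_def
  proof (intro prod_le_1 conjI)
    fix j
    have "cmod (\<Sum>a<N j. echar (real a * t j x)) \<le> real (N j)"
      by (rule order_trans[OF norm_sum]) simp
    hence "(cmod (\<Sum>a<N j. echar (real a * t j x)))\<^sup>2 \<le> (real (N j))\<^sup>2" by (intro power_mono) auto
    thus "(cmod (\<Sum>a<N j. echar (real a * t j x)))\<^sup>2 / (real (N j))\<^sup>2 \<le> 1" using N0[of j] by (simp add: divide_le_eq_1)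
  qed auto
  have Tint: "integrable \<mu> T"
    by (rule integrable_const_bound[where B = 1]) (use T0 T1 in auto)
  have "A = (\<Inter>j. {x. int_dist (t j x) < \<psi> j})" by (auto simp: A_def t_def)
  hence "open A"
    by (auto intro!: open_INT open_Collect_less continuous_intros tcont)
  hence [measurable, simp]: "A \<in> sets borel" by simp
  have TA: "(1 / 4) ^ CARD('m) * indicator A x \<le> T x" for x
  proof (cases "x \<in> A")
    case True
    have "(\<Prod>j\<in>(UNIV::'m set). 1 / 4) \<le> T x" unfolding T_def
    proof (intro prod_mono conjI)
      fix j
      have "real (N j) / 2 \<le> cmod (\<Sum>a<N j. echar (real a * t j x))"
        using dirichlet_lower_bound(1)[OF \<psi> N_def] True by (auto simp: A_def t_def)
      hence "(real (N j) / 2)\<^sup>2 \<le> (cmod (\<Sum>a<N j. echar (real a * t j x)))\<^sup>2" by (intro power_mono) auto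
      thus "1 / 4 \<le> (cmod (\<Sum>a<N j. echar (real a * t j x)))\<^sup>2 / (real (N j))\<^sup>2"
        using N0[of j] by (simp add: field_simps power2_eq_square)
    qed simp
    thus ?thesis using True by simp
  qed (use T0 in simp)
  have "(1 / 4) ^ CARD('m) * measure \<mu> A = (LINT x|\<mu>. (1 / 4) ^ CARD('m) * indicator A x)" by simp
  also have "\<dots> \<le> (LINT x|\<mu>. T x)"
    by (intro integral_mono TA Tint integrable_mult_right integrable_real_indicator)
       (auto simp: emeasure_eq_measure)
  finally have m1: "measure \<mu> A \<le> 4 ^ CARD('m) * (LINT x|\<mu>. T x)" by (simp add: power_one_over field_simps)
  have Teq: "complex_of_real (T x) = (\<Sum>k\<in>K. P k * echar (- (x \<bullet> - real_mat (outer q k))))" for x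
  proof -
    have "complex_of_real (T x) = (\<Prod>j\<in>UNIV. \<Sum>k\<in>{- int (N j)..int (N j)}. p j k * echar (of_int k * t j x))"
      unfolding T_def of_real_prod
    proof (intro prod.cong refl)
      fix j
      have "complex_of_real ((cmod (\<Sum>a<N j. echar (real a * t j x)))\<^sup>2) =
          (\<Sum>k\<in>{- int (N j)..int (N j)}. of_nat (pair_diffs (N j) k) * echar (of_int k * t j x))"
        unfolding dirichlet_square by (rule sum_pair_diffs)
      thus "complex_of_real ((cmod (\<Sum>a<N j. echar (real a * t j x)))\<^sup>2 / (real (N j))\<^sup>2) =
          (\<Sum>k\<in>{- int (N j)..int (N j)}. p j k * echar (of_int k * t j x))"
        by (simp add: p_def sum_divide_distrib)
    qed
    also have "\<dots> = (\<Sum>k\<in>K. \<Prod>j\<in>UNIV. p j (k $ j) * echar (of_int (k $ j) * t j x))"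
      unfolding K_def by (rule prod_sum_vec) simp
    also have "\<dots> = (\<Sum>k\<in>K. P k * echar (- (x \<bullet> - real_mat (outer q k))))"
      by (intro sum.cong refl)
         (simp add: P_def prod.distrib inner_real_mat_outer echar_sum t_def)
    finally show ?thesis .
  qed
  have "complex_of_real (LINT x|\<mu>. T x) = (LINT x|\<mu>. complex_of_real (T x))" by simp
  also have "\<dots> = (\<Sum>k\<in>K. P k * fourier_transform \<mu> (- real_mat (outer q k)))"
    unfolding Teq fourier_transform_echar
    using integrable_echar[OF finite_measure_axioms S]
    by (subst Bochner_Integration.integral_sum) (simp_all del: inner_minus_right)
  finally have "(LINT x|\<mu>. T x) = cmod (\<Sum>k\<in>K. P k * fourier_transform \<mu> (- real_mat (outer q k)))"
    using Bochner_Integration.integral_nonneg[of \<mu> T, OF T0] by (metis norm_of_real abs_of_nonneg)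
  also have "\<dots> \<le> (\<Sum>k\<in>K. P k * cmod (fourier_transform \<mu> (- real_mat (outer q k))))"
    by (rule order_trans[OF norm_sum]) (simp add: norm_mult P0)
  also have "\<dots> = P 0 * cmod (fourier_transform \<mu> (- real_mat (outer q 0))) +
      (\<Sum>k\<in>K - {0}. P k * cmod (fourier_transform \<mu> (- real_mat (outer q k))))"
    using fK by (intro sum.remove) (auto simp: K_def)
  also have "P 0 * cmod (fourier_transform \<mu> (- real_mat (outer q 0))) \<le> 12 ^ CARD('m) * (\<Prod>j\<in>UNIV. \<psi> j)"
  proof -
    have "P 0 * cmod (fourier_transform \<mu> (- real_mat (outer q 0))) \<le> P 0 * 1"
      by (intro mult_left_mono norm_fourier_transform_le_1 prob P0)
    also have "P 0 * 1 \<le> (\<Prod>j\<in>UNIV. 12 * \<psi> j)"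
      unfolding P_def mult_1_right
    proof (intro prod_mono conjI p0)
      fix j
      have "p j 0 = 1 / real (N j)" using N0[of j] by (simp add: p_def power2_eq_square)
      thus "p j (0 $ j) \<le> 12 * \<psi> j" using dirichlet_lower_bound(2)[OF \<psi> N_def] by simp
    qed
    finally show ?thesis by (simp add: prod.distrib)
  qed
  also have "(\<Sum>k\<in>K - {0}. P k * cmod (fourier_transform \<mu> (- real_mat (outer q k)))) \<le>
      (\<Sum>k\<in>K - {0}. P k * (C * (sup_abs q powr - s * max 1 \<bar>of_int (k $ j0)\<bar> powr - s)))"
  proof (intro sum_mono mult_left_mono P0)
    fix k assume k: "k \<in> K - {0}"
    have k1: "1 \<le> sup_abs k" using k by (intro sup_abs_ge_1) auto
    have q1: "1 \<le> sup_abs q" using q by (rule sup_abs_ge_1)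
    have nm: "infnorm (- real_mat (outer q k)) = sup_abs q * sup_abs k"
      by (simp add: infnorm_neg infnorm_outer)
    have "1 * 1 \<le> sup_abs q * sup_abs k" using q1 k1 by (intro mult_mono) auto
    hence "cmod (fourier_transform \<mu> (- real_mat (outer q k))) \<le> C * (sup_abs q * sup_abs k) powr - s"
      using decay[of "- real_mat (outer q k)"] nm by simp
    also have "(sup_abs q * sup_abs k) powr - s = sup_abs q powr - s * sup_abs k powr - s"
      using q1 k1 by (simp add: powr_mult)
    also have "C * \<dots> \<le> C * (sup_abs q powr - s * max 1 \<bar>of_int (k $ j0)\<bar> powr - s)"
      using C s k1 abs_nth_le_sup_abs[of k j0] by (intro mult_left_mono powr_mono2') auto
    finally show "cmod (fourier_transform \<mu> (- real_mat (outer q k))) \<le> C * (sup_abs q powr - s * max 1 \<bar>of_int (k $ j0)\<bar> powr - s)" .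
  qed
  \<comment> \<open>The nonnegative summand at \<open>k = 0\<close> is put back so that the sum runs
    over a full box and factorises.\<close>
  also have "\<dots> \<le> (\<Sum>k\<in>K. P k * (C * (sup_abs q powr - s * max 1 \<bar>of_int (k $ j0)\<bar> powr - s)))"
    using fK C by (intro sum_mono2) (auto intro!: mult_nonneg_nonneg P0)
  also have "\<dots> = C * sup_abs q powr - s * (\<Sum>k\<in>K. P k * max 1 \<bar>of_int (k $ j0)\<bar> powr - s)"
    by (simp add: sum_distrib_left mult_ac)
  also have "(\<Sum>k\<in>K. P k * max 1 \<bar>of_int (k $ j0)\<bar> powr - s) =
     (\<Sum>k\<in>K. \<Prod>j\<in>UNIV. p j (k $ j) * (if j = j0 then max 1 \<bar>of_int (k $ j)\<bar> powr - s else 1))"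
    by (simp add: P_def prod.distrib prod.delta)
  also have "\<dots> = (\<Prod>j\<in>UNIV. \<Sum>k\<in>{- int (N j)..int (N j)}. p j k * (if j = j0 then max 1 \<bar>of_int k\<bar> powr - s else 1))"
    unfolding K_def by (rule prod_sum_vec[symmetric]) simp
  also have "\<dots> = (\<Prod>j\<in>UNIV. if j = j0 then \<Sum>k\<in>{- int (N j)..int (N j)}. p j k * max 1 \<bar>of_int k\<bar> powr - s else 1)"
  proof (intro prod.cong refl)
    fix j
    have "(\<Sum>k\<in>{- int (N j)..int (N j)}. p j k) = 1"
      using sum_pair_diffs_eq[of "N j"] N0[of j] by (simp add: p_def flip: sum_divide_distrib)
    thus "(\<Sum>k\<in>{- int (N j)..int (N j)}. p j k * (if j = j0 then max 1 \<bar>of_int k\<bar> powr - s else 1)) =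
       (if j = j0 then \<Sum>k\<in>{- int (N j)..int (N j)}. p j k * max 1 \<bar>of_int k\<bar> powr - s else 1)" by simp
  qed
  also have "\<dots> = (\<Sum>k\<in>{- int (N j0)..int (N j0)}. p j0 k * max 1 \<bar>of_int k\<bar> powr - s)"
    by (simp add: prod.delta)
  also have "C * sup_abs q powr - s * \<dots> \<le> C * sup_abs q powr - s * (2 * (1 + 1 / (1 - s)) * (12 * \<psi> j0) powr s)"
  proof (intro mult_left_mono)
    have "(\<Sum>k\<in>{- int (N j0)..int (N j0)}. p j0 k * max 1 \<bar>of_int k\<bar> powr - s) \<le> 2 * (1 + 1 / (1 - s)) * (1 / real (N j0)) powr s"
      unfolding p_def by (rule fejer_average_bound[OF s N0])
    also have "\<dots> \<le> 2 * (1 + 1 / (1 - s)) * (12 * \<psi> j0) powr s"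
      using s dirichlet_lower_bound(2)[OF \<psi> N_def, of j0] by (intro mult_left_mono powr_mono2) auto
    finally show "(\<Sum>k\<in>{- int (N j0)..int (N j0)}. p j0 k * max 1 \<bar>of_int k\<bar> powr - s) \<le> 2 * (1 + 1 / (1 - s)) * (12 * \<psi> j0) powr s" .
  qed (use C in auto)
  also have "C * sup_abs q powr - s * (2 * (1 + 1 / (1 - s)) * (12 * \<psi> j0) powr s) =
     C * (2 * (1 + 1 / (1 - s)) * (12 * \<psi> j0 / sup_abs q) powr s)"
    using \<psi>[of j0] by (simp add: powr_divide powr_minus field_simps)
  finally have "(LINT x|\<mu>. T x) \<le> 12 ^ CARD('m) * (\<Prod>j\<in>UNIV. \<psi> j) + C * (2 * (1 + 1 / (1 - s)) * (12 * \<psi> j0 / sup_abs q) powr s)"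
    by simp
  hence "4 ^ CARD('m) * (LINT x|\<mu>. T x) \<le> 4 ^ CARD('m) * (12 ^ CARD('m) * (\<Prod>j\<in>UNIV. \<psi> j) + C * (2 * (1 + 1 / (1 - s)) * (12 * \<psi> j0 / sup_abs q) powr s))"
    by (intro mult_left_mono) auto
  thus ?thesis using m1 unfolding A_def by linarith
qed

section \<open>Summability and Borel--Cantelli\<close>

lemma finite_superlevel_summable:
  fixes f :: "'a \<Rightarrow> real"
  assumes f: "f summable_on A" "\<And>x. x \<in> A \<Longrightarrow> 0 \<le> f x" and e: "e > 0"
  shows "finite {x\<in>A. e \<le> f x}"
proof (rule ccontr)
  assume inf: "infinite {x\<in>A. e \<le> f x}"
  obtain n :: nat where n: "infsum f A < real n * e" using reals_Archimedean3[OF e] by blast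
  obtain T where T: "T \<subseteq> {x\<in>A. e \<le> f x}" "finite T" "card T = n"
    using infinite_arbitrarily_large[OF inf] by blast
  have "real n * e = (\<Sum>x\<in>T. e)" using T by simp
  also have "\<dots> \<le> sum f T" using T by (intro sum_mono) auto
  also have "\<dots> \<le> infsum f A" using T f by (intro finite_sum_le_infsum) auto
  finally show False using n by simp
qed

text \<open>On values at most 1 a larger exponent gives a smaller power, and larger values occur
  only finitely often. At \<open>s = 0\<close> the set \<open>T\<close> consists of the points where
  \<open>f\<close> is nonzero, so the argument persists.\<close>

lemma summable_on_powr_mono:
  fixes f :: "'a \<Rightarrow> real"
  assumes f: "(\<lambda>x. f x powr s) summable_on A" "\<And>x. x \<in> A \<Longrightarrow> 0 \<le> f x" and s: "0 \<le> s" "s \<le> t"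
  shows "(\<lambda>x. f x powr t) summable_on A"
proof -
  define T where "T = {x\<in>A. 1 \<le> f x powr s}"
  have "(\<lambda>x. f x powr t) summable_on (A - T)"
  proof (rule summable_on_comparison_test)
    show "(\<lambda>x. f x powr s) summable_on (A - T)" using f(1) by (rule summable_on_subset_banach) auto
    fix x assume x: "x \<in> A - T"
    show "f x powr t \<le> f x powr s"
    proof (cases "f x = 0")
      case False
      have "\<not> 1 \<le> f x" using x ge_one_powr_ge_zero[of "f x" s] s by (auto simp: T_def)
      thus ?thesis using f(2)[of x] x False s by (intro powr_mono') auto
    qed simp
  qed simp
  moreover have "finite T" unfolding T_def by (rule finite_superlevel_summable[OF f(1)]) auto
  hence "(\<lambda>x. f x powr t) summable_on T" by simp
  ultimately have "(\<lambda>x. f x powr t) summable_on ((A - T) \<union> T)" by (rule summable_on_Un_disjoint) auto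
  moreover have "(A - T) \<union> T = A" by (auto simp: T_def)
  ultimately show ?thesis by simp
qed

lemma summable_on_above_conv_exponent:
  fixes \<psi> :: "'m::finite \<Rightarrow> int ^ 'n::finite \<Rightarrow> real"
  assumes nonneg: "\<And>j q. \<psi> j q \<ge> 0" and s: "conv_exponent \<psi> < ennreal s"
  shows "(\<lambda>q. (Min (range (\<lambda>j. \<psi> j q / sup_abs q))) powr s) summable_on (UNIV - {0})"
proof -
  obtain r where r: "0 \<le> r" "ennreal r < ennreal s"
    "(\<lambda>q. (Min (range (\<lambda>j. \<psi> j q / sup_abs q))) powr r) summable_on (UNIV - {0})"
    using s unfolding conv_exponent_def Inf_less_iff by auto
  show ?thesis
  proof (rule summable_on_powr_mono[OF r(3) _ r(1)])
    show "0 \<le> Min (range (\<lambda>j. \<psi> j q / sup_abs q))" for q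
      by (intro Min.boundedI) (auto intro!: divide_nonneg_nonneg nonneg)
    show "r \<le> s" using r(1,2) by (simp add: ennreal_less_iff)
  qed
qed

lemma AE_finite_approximations:
  fixes \<psi> :: "'m::finite \<Rightarrow> int ^ 'n::finite \<Rightarrow> real" and \<mu> :: "(real ^ 'm ^ 'n) measure"
  assumes nonneg: "\<And>j q. \<psi> j q \<ge> 0"
    and conv: "(\<lambda>q. \<Prod>j\<in>UNIV. \<psi> j q) summable_on UNIV"
    and smb: "(\<lambda>q. (Min (range (\<lambda>j. \<psi> j q / sup_abs q))) powr s) summable_on (UNIV - {0})"
    and prob: "prob_space \<mu>" and S [simp, measurable_cong]: "sets \<mu> = sets borel"
    and s: "0 < s" "s < 1" and C: "C \<ge> 0"
    and decay: "\<And>x. 1 \<le> infnorm x \<Longrightarrow> cmod (fourier_transform \<mu> x) \<le> C * infnorm x powr - s"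
  shows "AE x in \<mu>. finite {q. \<forall>j. int_dist (real_vec q \<bullet> column j x) < \<psi> j q}"
proof -
  interpret prob_space \<mu> by fact
  have [simp]: "space \<mu> = UNIV" using sets_eq_imp_space_eq[OF S] by simp
  define A where "A q = {x :: real ^ 'm ^ 'n. \<forall>j. int_dist (real_vec q \<bullet> column j x) < \<psi> j q}" for q
  have "A q = (\<Inter>j. {x. int_dist (real_vec q \<bullet> column j x) < \<psi> j q})" for q by (auto simp: A_def)
  hence "open (A q)" for q
    unfolding column_def by (auto intro!: open_INT open_Collect_less continuous_intros)
  hence A_meas [measurable]: "A q \<in> sets \<mu>" for q by simp
  define K where "K = C * (2 * (1 + 1 / (1 - s)) * 12 powr s)"
  define g where "g q = 4 ^ CARD('m) * (12 ^ CARD('m) * (\<Prod>j\<in>UNIV. \<psi> j q) +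
      K * (Min (range (\<lambda>j. \<psi> j q / sup_abs q))) powr s)" for q
  have K0: "K \<ge> 0" using C s by (simp add: K_def)
  have bound: "measure \<mu> (A q) \<le> g q" if q: "q \<noteq> 0" for q
  proof (cases "\<forall>j. \<psi> j q > 0")
    case True
    have "Min (range (\<lambda>j. \<psi> j q / sup_abs q)) \<in> range (\<lambda>j. \<psi> j q / sup_abs q)" by (intro Min_in) auto
    then obtain j where j: "Min (range (\<lambda>j. \<psi> j q / sup_abs q)) = \<psi> j q / sup_abs q" by blast
    have "(12 * \<psi> j q / sup_abs q) powr s = 12 powr s * (\<psi> j q / sup_abs q) powr s"
      using nonneg by (subst powr_mult[symmetric]) auto
    thus ?thesis
      using measure_approx_set_le[OF prob S s C decay q, of "\<lambda>j. \<psi> j q" j] True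
      unfolding g_def j A_def K_def by (simp add: mult_ac)
  next
    case False
    \<comment> \<open>A zero value makes the strict inequality unsatisfiable, so the set is empty;
      the Fejer argument applies only to positive values.\<close>
    then obtain j where "\<psi> j q = 0" using nonneg by (metis order_le_less)
    hence "A q = {}" by (auto simp: A_def) (metis int_dist_nonneg not_less)
    thus ?thesis using K0 by (simp add: g_def prod_nonneg nonneg)
  qed
  have gs: "g summable_on (UNIV - {0})"
    unfolding g_def
    by (intro summable_on_cmult_right summable_on_add smb summable_on_subset_banach[OF conv]) auto
  have ms: "(\<lambda>q. measure \<mu> (A q)) summable_on (UNIV - {0})"
    by (rule summable_on_comparison_test[OF gs]) (auto intro: bound)
  \<comment> \<open>Borel--Cantelli runs along an enumeration of the integer vectors. The vector 0,
    for which there is no bound, is dropped without affecting finiteness.\<close>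
  define A' where "A' n = (if n \<in> to_nat ` (UNIV - {0 :: int ^ 'n}) then A (from_nat n) else {})" for n
  have "(\<lambda>n. measure \<mu> (A' n)) summable_on (to_nat ` (UNIV - {0 :: int ^ 'n}))"
    unfolding summable_on_reindex[OF inj_on_subset[OF inj_to_nat subset_UNIV]] o_def
    by (rule summable_on_cong[THEN iffD1, OF _ ms]) (auto simp: A'_def)
  hence "(\<lambda>n. measure \<mu> (A' n)) summable_on UNIV"
    by (rule summable_on_cong_neutral[THEN iffD1, rotated -1]) (auto simp: A'_def)
  hence "summable (\<lambda>n. measure \<mu> (A' n))" by (subst (asm) summable_on_UNIV_nonneg_real_iff) auto
  hence "AE x in \<mu>. eventually (\<lambda>n. x \<in> space \<mu> - A' n) sequentially"
    by (intro borel_cantelli_AE1) (use A_meas in \<open>auto simp: A'_def emeasure_eq_measure\<close>)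
  thus ?thesis
  proof (rule AE_mp, intro AE_I2 impI)
    fix x assume "eventually (\<lambda>n. x \<in> space \<mu> - A' n) sequentially"
    then obtain M where M: "\<And>n. n \<ge> M \<Longrightarrow> x \<notin> A' n" by (auto simp: eventually_sequentially)
    have "{q. x \<in> A q} \<subseteq> insert 0 (from_nat ` {..<M})"
    proof safe
      fix q assume q: "x \<in> A q" "q \<notin> from_nat ` {..<M}"
      have "\<not> to_nat q < M" using q(2) by (metis from_nat_to_nat imageI lessThan_iff)
      hence "x \<notin> A' (to_nat q)" using M by simp
      thus "q = 0" using q(1) by (cases "q = 0") (simp_all add: A'_def)
    qed
    hence "finite {q. x \<in> A q}" by (rule finite_subset) auto
    thus "finite {q. \<forall>j. int_dist (real_vec q \<bullet> column j x) < \<psi> j q}" by (simp add: A_def)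
  qed
qed

lemma fourier_dim_well_approx_le:
  fixes \<psi> :: "'m::finite \<Rightarrow> int ^ 'n::finite \<Rightarrow> real"
  assumes nonneg: "\<And>j q. \<psi> j q \<ge> 0"
    and conv: "(\<lambda>q. \<Prod>j\<in>UNIV. \<psi> j q) summable_on UNIV"
    and small: "conv_exponent \<psi> < 1"
  shows "fourier_dim (well_approx \<psi>) \<le> 2 * conv_exponent \<psi>"
  unfolding fourier_dim_def
proof (rule Sup_least, safe)
  fix t \<mu> C
  assume t: "0 \<le> t" and \<mu>: "\<mu> \<in> compact_prob_measures (well_approx \<psi>)"
    and decay: "\<forall>x. x \<noteq> 0 \<longrightarrow> cmod (fourier_transform \<mu> x) \<le> C * infnorm x powr (- t / 2)"
  interpret prob_space \<mu> using \<mu> by (simp add: compact_prob_measures_def)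
  have sets: "sets \<mu> = sets borel" using \<mu> by (simp add: compact_prob_measures_def)
  obtain r where r: "0 \<le> r" "conv_exponent \<psi> = ennreal r"
    using small by (cases "conv_exponent \<psi>" rule: ennreal_cases) auto
  have r1: "r < 1" using small r by (simp add: r(2) ennreal_less_iff flip: ennreal_1)
  show "ennreal t \<le> 2 * conv_exponent \<psi>"
  proof (rule ccontr)
    assume "\<not> ennreal t \<le> 2 * conv_exponent \<psi>"
    hence "ennreal (2 * r) < ennreal t" using r by (simp add: not_le ennreal_mult')
    hence rt: "r < t / 2" using r t by (simp add: ennreal_less_iff)
    \<comment> \<open>The given decay exponent \<open>t / 2\<close> may be 1 or more. It is weakened
      to some \<open>s < 1\<close>, which is harmless because decay is needed only for
      \<open>infnorm x \<ge> 1\<close>.\<close>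
    obtain s where s: "r < s" "s < min (t / 2) 1" using dense[of r "min (t / 2) 1"] rt r1 by auto
    have decay': "cmod (fourier_transform \<mu> x) \<le> \<bar>C\<bar> * infnorm x powr - s" if "1 \<le> infnorm x" for x
    proof -
      have "x \<noteq> 0" using that by (auto simp: infnorm_0)
      hence "cmod (fourier_transform \<mu> x) \<le> C * infnorm x powr (- t / 2)" using decay by blast
      also have "\<dots> \<le> \<bar>C\<bar> * infnorm x powr - s" using that s by (intro mult_mono powr_mono) auto
      finally show ?thesis .
    qed
    have "AE x in \<mu>. finite {q. \<forall>j. int_dist (real_vec q \<bullet> column j x) < \<psi> j q}"
    proof (rule AE_finite_approximations[OF nonneg conv, where C = "\<bar>C\<bar>"])
      show "(\<lambda>q. (Min (range (\<lambda>j. \<psi> j q / sup_abs q))) powr s) summable_on (UNIV - {0})"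
        using r s by (intro summable_on_above_conv_exponent nonneg) (simp add: ennreal_less_iff)
    qed (use sets s r decay' prob_space_axioms in auto)
    moreover have "AE x in \<mu>. x \<in> well_approx \<psi>"
      using AE_measure_support[OF sets] \<mu> by (rule_tac AE_mp) (auto simp: compact_prob_measures_def)
    ultimately have "AE x in \<mu>. False"
      by eventually_elim (auto simp: well_approx_def)
    thus False by simp
  qed
qed

section \<open>Multiplication by functions with few frequencies\<close>

text \<open>Integer frequencies couple only the values of the transform on one coset of the lattice,
  so the l1 norm is taken coset by coset, with \<open>B\<close> independent of the coset. Finite
  partial sums express summability and its bound together.\<close>

definition lattice_bounded :: "real \<Rightarrow> (real ^ 'm ^ 'n \<Rightarrow> complex) \<Rightarrow> real \<Rightarrow> bool" where
  "lattice_bounded \<tau> a B \<longleftrightarrow> (\<forall>\<xi> L. finite L \<longrightarrow>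
     (\<Sum>l\<in>L. cmod (a (\<xi> - real_mat l)) * (1 + infnorm (\<xi> - real_mat l)) powr \<tau>) \<le> B)"

lemma lattice_boundedD:
  "lattice_bounded \<tau> a B \<Longrightarrow> finite L \<Longrightarrow>
     (\<Sum>l\<in>L. cmod (a (\<xi> - real_mat l)) * (1 + infnorm (\<xi> - real_mat l)) powr \<tau>) \<le> B"
  unfolding lattice_bounded_def by blast

lemma lattice_bounded_pointwise:
  assumes "lattice_bounded \<tau> a B"
  shows "cmod (a \<xi>) * (1 + infnorm \<xi>) powr \<tau> \<le> B"
  using lattice_boundedD[OF assms, of "{0}" \<xi>] by simp

lemma weight_submult:
  fixes x y :: "'a::euclidean_space"
  assumes "\<tau> \<ge> 0"
  shows "(1 + infnorm (x + y)) powr \<tau> \<le> (1 + infnorm x) powr \<tau> * (1 + infnorm y) powr \<tau>"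
proof -
  have "(1 + infnorm (x + y)) powr \<tau> \<le> ((1 + infnorm x) * (1 + infnorm y)) powr \<tau>"
    using assms infnorm_pos_le[of "x + y"] by (intro powr_mono2 one_plus_infnorm_le) auto
  also have "\<dots> = (1 + infnorm x) powr \<tau> * (1 + infnorm y) powr \<tau>"
    using infnorm_pos_le[of x] infnorm_pos_le[of y] by (intro powr_mult)
  finally show ?thesis .
qed

text \<open>Frequencies carry labels \<open>p\<close>, and several labels may share a frequency.
  \<open>Z\<close>, a weighted l1 bound on the coefficients, propagates
  \<open>lattice_bounded\<close> and may be huge; \<open>E\<close>, a weighted bound for each
  nonzero frequency, controls the change of the transform. Both estimates are made for the
  trigonometric approximations, uniformly in \<open>N\<close>, and then passed to the limit.\<close>

lemma multiplier_step:
  fixes \<mu> :: "(real ^ 'm::finite ^ 'n::finite) measure" and F :: "real ^ 'm ^ 'n \<Rightarrow> real"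
    and fr :: "'p \<Rightarrow> int ^ 'm ^ 'n" and b :: "nat \<Rightarrow> 'p \<Rightarrow> complex" and \<beta> :: "'p \<Rightarrow> real"
  assumes fin: "finite_measure \<mu>" and S [simp, measurable_cong]: "sets \<mu> = sets borel"
    and \<tau>: "\<tau> \<ge> 0" and B: "lattice_bounded \<tau> (fourier_transform \<mu>) B"
    and F [measurable]: "F \<in> borel_measurable borel" and F0: "\<And>x. F x \<ge> 0"
    and P: "\<And>N. finite (P N)"
    and lim: "\<And>x. (\<lambda>N. \<Sum>p\<in>P N. b N p * echar (x \<bullet> real_mat (fr p))) \<longlonglongrightarrow> complex_of_real (F x)"
    and b: "\<And>N p. p \<in> P N \<Longrightarrow> cmod (b N p) \<le> \<beta> p"
    and Z: "\<And>R. finite R \<Longrightarrow> (\<Sum>p\<in>R. \<beta> p * (1 + infnorm (real_mat (fr p))) powr \<tau>) \<le> Z"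
    and \<beta>0: "\<And>p. \<beta> p \<ge> 0"
    and mean: "\<And>N. N > 0 \<Longrightarrow> (\<Sum>p\<in>{p\<in>P N. fr p = 0}. b N p) = 1"
    and fiber: "\<And>l R. l \<noteq> 0 \<Longrightarrow> finite R \<Longrightarrow> R \<subseteq> {p. fr p = l} \<Longrightarrow>
        (\<Sum>p\<in>R. \<beta> p * (1 + infnorm (real_mat (fr p))) powr \<tau>) \<le> E"
  defines "\<mu>' \<equiv> density \<mu> (\<lambda>x. ennreal (F x))"
  shows "finite_measure \<mu>'"
    and "lattice_bounded \<tau> (fourier_transform \<mu>') (Z * B)"
    and "cmod (fourier_transform \<mu>' \<xi> - fourier_transform \<mu> \<xi>) \<le> E * B * (1 + infnorm \<xi>) powr - \<tau>"
proof -
  interpret finite_measure \<mu> by fact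
  have [simp]: "space \<mu> = UNIV" using sets_eq_imp_space_eq[OF S] by simp
  let ?a = "fourier_transform \<mu>"
  let ?w = "\<lambda>x. (1 + infnorm x) powr \<tau>"
  have w1: "?w x \<ge> 1" for x :: "real ^ 'm ^ 'n"
    using \<tau> infnorm_pos_le[of x] by (intro ge_one_powr_ge_zero) auto
  have Z0: "Z \<ge> 0" using Z[of "{}"] by simp
  have E0: "E \<ge> 0" using fiber[of 1 "{}"] by simp
  have B0: "B \<ge> 0" using lattice_boundedD[OF B, of "{}"] by simp
  define FN where "FN N x = (\<Sum>p\<in>P N. b N p * echar (x \<bullet> real_mat (fr p)))" for N x
  have FNb: "cmod (FN N x) \<le> Z" for N x
  proof -
    have "cmod (FN N x) \<le> (\<Sum>p\<in>P N. cmod (b N p))"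
      unfolding FN_def by (rule order_trans[OF norm_sum]) (simp add: norm_mult)
    also have "\<dots> \<le> (\<Sum>p\<in>P N. \<beta> p * ?w (real_mat (fr p)))"
    proof (intro sum_mono)
      fix p assume p: "p \<in> P N"
      have "cmod (b N p) * 1 \<le> \<beta> p * ?w (real_mat (fr p))"
        using b[OF p] w1 \<beta>0 by (intro mult_mono) auto
      thus "cmod (b N p) \<le> \<beta> p * ?w (real_mat (fr p))" by simp
    qed
    also have "\<dots> \<le> Z" by (intro Z P)
    finally show ?thesis .
  qed
  have [measurable]: "FN N \<in> borel_measurable borel" for N unfolding FN_def by measurable
  have Fb: "F x \<le> Z" for x
  proof -
    have "(\<lambda>N. cmod (FN N x)) \<longlonglongrightarrow> cmod (complex_of_real (F x))"
      using lim[of x] unfolding FN_def by (intro tendsto_norm)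
    from LIMSEQ_le_const2[OF this] FNb F0[of x] show ?thesis by auto
  qed
  show fin': "finite_measure \<mu>'"
  proof (rule finite_measureI)
    have "emeasure \<mu>' (space \<mu>') = (\<integral>\<^sup>+x. ennreal (F x) \<partial>\<mu>)"
      unfolding \<mu>'_def by (subst emeasure_density) (auto intro!: nn_integral_cong)
    also have "\<dots> \<le> (\<integral>\<^sup>+x. ennreal Z \<partial>\<mu>)" by (intro nn_integral_mono ennreal_leI Fb)
    also have "\<dots> < \<infinity>" by (simp add: emeasure_eq_measure ennreal_mult_less_top)
    finally show "emeasure \<mu>' (space \<mu>') \<noteq> \<infinity>" by simp
  qed
  define aN where "aN N \<xi> = (\<Sum>p\<in>P N. b N p * ?a (\<xi> - real_mat (fr p)))" for N \<xi>
  have aN_lim: "(\<lambda>N. aN N \<xi>) \<longlonglongrightarrow> fourier_transform \<mu>' \<xi>" for \<xi>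
  proof -
    have "(\<lambda>N. LINT x|\<mu>. FN N x * echar (- (x \<bullet> \<xi>))) \<longlonglongrightarrow> (LINT x|\<mu>. complex_of_real (F x) * echar (- (x \<bullet> \<xi>)))"
    proof (rule integral_dominated_convergence[where w = "\<lambda>_. Z"])
      show "AE x in \<mu>. (\<lambda>N. FN N x * echar (- (x \<bullet> \<xi>))) \<longlonglongrightarrow> complex_of_real (F x) * echar (- (x \<bullet> \<xi>))"
        unfolding FN_def by (intro AE_I2 tendsto_mult lim tendsto_const)
    qed (auto simp: norm_mult FNb)
    moreover have "(LINT x|\<mu>. complex_of_real (F x) * echar (- (x \<bullet> \<xi>))) = fourier_transform \<mu>' \<xi>"
      unfolding \<mu>'_def fourier_transform_echar
      by (subst integral_density) (auto simp: F0 scaleR_conv_of_real)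
    moreover have "(LINT x|\<mu>. FN N x * echar (- (x \<bullet> \<xi>))) = aN N \<xi>" for N
    proof -
      have "FN N x * echar (- (x \<bullet> \<xi>)) = (\<Sum>p\<in>P N. b N p * echar (- (x \<bullet> (\<xi> - real_mat (fr p)))))" for x
        unfolding FN_def sum_distrib_right
        by (intro sum.cong refl) (simp add: inner_diff_right echar_diff echar_minus)
      hence "(LINT x|\<mu>. FN N x * echar (- (x \<bullet> \<xi>))) = (LINT x|\<mu>. (\<Sum>p\<in>P N. b N p * echar (- (x \<bullet> (\<xi> - real_mat (fr p))))))"
        by (simp only:)
      also have "\<dots> = (\<Sum>p\<in>P N. LINT x|\<mu>. b N p * echar (- (x \<bullet> (\<xi> - real_mat (fr p)))))"
        by (rule Bochner_Integration.integral_sum) (intro integrable_mult_right integrable_echar[OF fin S])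
      also have "\<dots> = aN N \<xi>" unfolding aN_def fourier_transform_echar by simp
      finally show ?thesis .
    qed
    ultimately show ?thesis by simp
  qed
  show "lattice_bounded \<tau> (fourier_transform \<mu>') (Z * B)"
    unfolding lattice_bounded_def
  proof (intro allI impI)
    fix \<xi> and L :: "(int ^ 'm ^ 'n) set" assume L: "finite L"
    have "(\<Sum>l\<in>L. cmod (aN N (\<xi> - real_mat l)) * ?w (\<xi> - real_mat l)) \<le> Z * B" for N
    proof -
      have "(\<Sum>l\<in>L. cmod (aN N (\<xi> - real_mat l)) * ?w (\<xi> - real_mat l)) \<le>
        (\<Sum>l\<in>L. \<Sum>p\<in>P N. (\<beta> p * ?w (real_mat (fr p))) *
            (cmod (?a (\<xi> - real_mat (fr p) - real_mat l)) * ?w (\<xi> - real_mat (fr p) - real_mat l)))"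
      proof (intro sum_mono)
        fix l assume "l \<in> L"
        have "cmod (aN N (\<xi> - real_mat l)) \<le> (\<Sum>p\<in>P N. cmod (b N p) * cmod (?a (\<xi> - real_mat l - real_mat (fr p))))"
          unfolding aN_def by (rule order_trans[OF norm_sum]) (simp add: norm_mult)
        hence "cmod (aN N (\<xi> - real_mat l)) * ?w (\<xi> - real_mat l) \<le>
           (\<Sum>p\<in>P N. cmod (b N p) * cmod (?a (\<xi> - real_mat l - real_mat (fr p)))) * ?w (\<xi> - real_mat l)"
          by (intro mult_right_mono) auto
        also have "\<dots> \<le> (\<Sum>p\<in>P N. (\<beta> p * ?w (real_mat (fr p))) *
            (cmod (?a (\<xi> - real_mat (fr p) - real_mat l)) * ?w (\<xi> - real_mat (fr p) - real_mat l)))"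
          unfolding sum_distrib_right
        proof (intro sum_mono)
          fix p assume p: "p \<in> P N"
          have eq: "\<xi> - real_mat l - real_mat (fr p) = \<xi> - real_mat (fr p) - real_mat l" by simp
          have "?w (\<xi> - real_mat l) \<le> ?w (real_mat (fr p)) * ?w (\<xi> - real_mat (fr p) - real_mat l)"
            using weight_submult[OF \<tau>, of "real_mat (fr p)" "\<xi> - real_mat (fr p) - real_mat l"] by simp
          hence "(cmod (b N p) * cmod (?a (\<xi> - real_mat l - real_mat (fr p)))) * ?w (\<xi> - real_mat l) \<le>
             (\<beta> p * cmod (?a (\<xi> - real_mat l - real_mat (fr p)))) * (?w (real_mat (fr p)) * ?w (\<xi> - real_mat (fr p) - real_mat l))"
            using b[OF p] \<beta>0 by (intro mult_mono) auto
          thus "cmod (b N p) * cmod (?a (\<xi> - real_mat l - real_mat (fr p))) * ?w (\<xi> - real_mat l) \<le>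
             (\<beta> p * ?w (real_mat (fr p))) * (cmod (?a (\<xi> - real_mat (fr p) - real_mat l)) * ?w (\<xi> - real_mat (fr p) - real_mat l))"
            unfolding eq by (simp add: mult_ac)
        qed
        finally show "cmod (aN N (\<xi> - real_mat l)) * ?w (\<xi> - real_mat l) \<le> \<dots>" .
      qed
      also have "\<dots> = (\<Sum>p\<in>P N. (\<beta> p * ?w (real_mat (fr p))) *
          (\<Sum>l\<in>L. cmod (?a (\<xi> - real_mat (fr p) - real_mat l)) * ?w (\<xi> - real_mat (fr p) - real_mat l)))"
        by (subst sum.swap) (simp add: sum_distrib_left)
      also have "\<dots> \<le> (\<Sum>p\<in>P N. (\<beta> p * ?w (real_mat (fr p))) * B)"
        using \<beta>0 by (intro sum_mono mult_left_mono lattice_boundedD[OF B L]) auto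
      also have "\<dots> = (\<Sum>p\<in>P N. (\<beta> p * ?w (real_mat (fr p)))) * B" by (simp add: sum_distrib_right)
      also have "\<dots> \<le> Z * B" by (intro mult_right_mono Z P B0)
      finally show ?thesis .
    qed
    moreover have "(\<lambda>N. \<Sum>l\<in>L. cmod (aN N (\<xi> - real_mat l)) * ?w (\<xi> - real_mat l)) \<longlonglongrightarrow>
       (\<Sum>l\<in>L. cmod (fourier_transform \<mu>' (\<xi> - real_mat l)) * ?w (\<xi> - real_mat l))"
      by (intro tendsto_sum tendsto_mult tendsto_norm aN_lim tendsto_const)
    ultimately show "(\<Sum>l\<in>L. cmod (fourier_transform \<mu>' (\<xi> - real_mat l)) * ?w (\<xi> - real_mat l)) \<le> Z * B"
      by (intro LIMSEQ_le_const2) auto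
  qed
  have diffN: "cmod (aN N \<xi> - ?a \<xi>) \<le> E * B * (1 + infnorm \<xi>) powr - \<tau>" if "N > 0" for N
  proof -
    define R where "R = {p\<in>P N. fr p \<noteq> 0}"
    have fR: "finite R" using P by (simp add: R_def)
    have "P N = {p\<in>P N. fr p = 0} \<union> R" by (auto simp: R_def)
    hence "aN N \<xi> = (\<Sum>p\<in>{p\<in>P N. fr p = 0}. b N p * ?a (\<xi> - real_mat (fr p))) + (\<Sum>p\<in>R. b N p * ?a (\<xi> - real_mat (fr p)))"
      unfolding aN_def using P[of N] fR by (subst sum.union_disjoint[symmetric]) (auto simp: R_def)
    \<comment> \<open>The labels of frequency 0 have total coefficient 1 and reproduce the transform
      of \<open>\<mu>\<close>, which cancels in the difference.\<close>
    also have "(\<Sum>p\<in>{p\<in>P N. fr p = 0}. b N p * ?a (\<xi> - real_mat (fr p))) = (\<Sum>p\<in>{p\<in>P N. fr p = 0}. b N p) * ?a \<xi>"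
      by (simp add: sum_distrib_right)
    finally have "aN N \<xi> - ?a \<xi> = (\<Sum>p\<in>R. b N p * ?a (\<xi> - real_mat (fr p)))" using mean[OF that] by simp
    hence "cmod (aN N \<xi> - ?a \<xi>) \<le> (\<Sum>p\<in>R. cmod (b N p) * cmod (?a (\<xi> - real_mat (fr p))))"
      by (simp add: order_trans[OF norm_sum] norm_mult)
    hence "cmod (aN N \<xi> - ?a \<xi>) * ?w \<xi> \<le> (\<Sum>p\<in>R. cmod (b N p) * cmod (?a (\<xi> - real_mat (fr p)))) * ?w \<xi>"
      by (intro mult_right_mono) auto
    also have "\<dots> \<le> (\<Sum>p\<in>R. (\<beta> p * ?w (real_mat (fr p))) * (cmod (?a (\<xi> - real_mat (fr p))) * ?w (\<xi> - real_mat (fr p))))"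
      unfolding sum_distrib_right
    proof (intro sum_mono)
      fix p assume "p \<in> R"
      hence p: "p \<in> P N" by (simp add: R_def)
      have "?w \<xi> \<le> ?w (real_mat (fr p)) * ?w (\<xi> - real_mat (fr p))"
        using weight_submult[OF \<tau>, of "real_mat (fr p)" "\<xi> - real_mat (fr p)"] by simp
      hence "(cmod (b N p) * cmod (?a (\<xi> - real_mat (fr p)))) * ?w \<xi> \<le>
         (\<beta> p * cmod (?a (\<xi> - real_mat (fr p)))) * (?w (real_mat (fr p)) * ?w (\<xi> - real_mat (fr p)))"
        using b[OF p] \<beta>0 by (intro mult_mono) auto
      thus "cmod (b N p) * cmod (?a (\<xi> - real_mat (fr p))) * ?w \<xi> \<le>
         (\<beta> p * ?w (real_mat (fr p))) * (cmod (?a (\<xi> - real_mat (fr p))) * ?w (\<xi> - real_mat (fr p)))"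
        by (simp add: mult_ac)
    qed
    \<comment> \<open>Grouped by frequency, the coefficients are bounded by \<open>E\<close>; what
      remains is a sum of the transform over distinct lattice points, to which \<open>B\<close>
      applies.\<close>
    also have "\<dots> = (\<Sum>l\<in>fr ` R. \<Sum>p\<in>{p\<in>R. fr p = l}. (\<beta> p * ?w (real_mat (fr p))) * (cmod (?a (\<xi> - real_mat (fr p))) * ?w (\<xi> - real_mat (fr p))))"
      by (rule sum.image_gen[OF fR])
    also have "\<dots> = (\<Sum>l\<in>fr ` R. (\<Sum>p\<in>{p\<in>R. fr p = l}. \<beta> p * ?w (real_mat (fr p))) * (cmod (?a (\<xi> - real_mat l)) * ?w (\<xi> - real_mat l)))"
      unfolding sum_distrib_right by (intro sum.cong refl) auto
    also have "\<dots> \<le> (\<Sum>l\<in>fr ` R. E * (cmod (?a (\<xi> - real_mat l)) * ?w (\<xi> - real_mat l)))"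
    proof (intro sum_mono mult_right_mono)
      fix l assume "l \<in> fr ` R"
      thus "(\<Sum>p\<in>{p\<in>R. fr p = l}. \<beta> p * ?w (real_mat (fr p))) \<le> E"
        using P[of N] by (intro fiber[of l]) (auto simp: R_def)
    qed auto
    also have "\<dots> \<le> E * B"
      unfolding sum_distrib_left[symmetric] using fR by (intro mult_left_mono lattice_boundedD[OF B] E0) auto
    finally have "cmod (aN N \<xi> - ?a \<xi>) * ?w \<xi> \<le> E * B" .
    moreover have "?w \<xi> > 0" using w1[of \<xi>] by linarith
    ultimately show ?thesis by (simp add: powr_minus field_simps)
  qed
  have "(\<lambda>N. cmod (aN N \<xi> - ?a \<xi>)) \<longlonglongrightarrow> cmod (fourier_transform \<mu>' \<xi> - ?a \<xi>)"
    by (intro tendsto_norm tendsto_diff aN_lim tendsto_const)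
  thus "cmod (fourier_transform \<mu>' \<xi> - ?a \<xi>) \<le> E * B * (1 + infnorm \<xi>) powr - \<tau>"
    by (rule LIMSEQ_le_const2) (auto intro!: exI[of _ 1] diffN)
qed

section \<open>Averages of bumps around rational hyperplanes\<close>

text \<open>Bounds the \<open>k\<close>-th Fourier coefficient of the triangle of half-width
  \<open>d / 2\<close>. The case \<open>k = 0\<close> is separate because division by zero gives 0,
  which would make the minimum 0.\<close>

definition tri_coeff_bound :: "real \<Rightarrow> int \<Rightarrow> real" where
  "tri_coeff_bound d k = (if k = 0 then 1 else min 1 (1 / (d * of_int k)\<^sup>2))"

lemma tri_coeff_bound_nonneg [simp]: "0 \<le> tri_coeff_bound d k"
  by (simp add: tri_coeff_bound_def)

lemma tri_coeff_bound_le_1: "tri_coeff_bound d k \<le> 1"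
  by (simp add: tri_coeff_bound_def)

text \<open>The minimum of \<open>y powr 0\<close> and \<open>y powr - 2\<close> lies below every
  intermediate power of \<open>y\<close>. The exact dependence on \<open>d\<close> is kept, since it
  has to cancel against the weights of the average.\<close>

lemma tri_coeff_bound_le_powr:
  assumes "d > 0" "k \<noteq> 0" "0 \<le> t" "t \<le> 2"
  shows "tri_coeff_bound d k \<le> (d * \<bar>of_int k\<bar>) powr - t"
proof -
  define y where "y = d * \<bar>real_of_int k\<bar>"
  have y: "y > 0" using assms by (simp add: y_def)
  have eq: "tri_coeff_bound d k = min 1 (1 / y\<^sup>2)" using assms by (simp add: tri_coeff_bound_def y_def power_mult_distrib)
  have "min 1 (1 / y\<^sup>2) \<le> y powr - t"
  proof (cases "y \<ge> 1")
    case True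
    have "1 / y\<^sup>2 = y powr - 2" using y by (simp add: powr_minus divide_inverse powr_numeral)
    also have "\<dots> \<le> y powr - t" using True assms by (intro powr_mono) auto
    finally show ?thesis by linarith
  next
    case False
    hence "y powr 0 \<le> y powr - t" using y assms by (intro powr_mono') auto
    thus ?thesis using y by simp
  qed
  thus ?thesis by (simp add: eq y_def)
qed

text \<open>Summable even against a weight of order below 1, at the price of a constant depending on
  \<open>d\<close>. It serves the l1 bound, which may be arbitrarily large.\<close>

lemma tri_coeff_bound_le_weight:
  assumes "0 < d" "d \<le> 1"
  shows "tri_coeff_bound d k \<le> 4 / d\<^sup>2 * (1 + \<bar>of_int k\<bar>) powr - 2"
proof (cases "k = 0")
  case True
  have "d\<^sup>2 \<le> 1" using assms by (simp add: power_le_one)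
  thus ?thesis using True assms by (simp add: tri_coeff_bound_def field_simps)
next
  case False
  hence k: "1 \<le> \<bar>real_of_int k\<bar>" by linarith
  have "(1 + \<bar>real_of_int k\<bar>)\<^sup>2 \<le> (2 * \<bar>real_of_int k\<bar>)\<^sup>2" using k by (intro power_mono) auto
  hence "1 / (d * of_int k)\<^sup>2 \<le> 4 / d\<^sup>2 / (1 + \<bar>of_int k\<bar>)\<^sup>2"
    using assms k by (simp add: field_simps power_mult_distrib)
  moreover have "(1 + \<bar>of_int k\<bar>) powr - 2 = 1 / (1 + \<bar>real_of_int k\<bar>)\<^sup>2"
    by (simp add: powr_minus divide_inverse powr_numeral)
  ultimately show ?thesis using False by (simp add: tri_coeff_bound_def)
qed

lemma one_plus_sup_abs_le_prod:
  fixes k :: "int ^ 'm::finite"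
  shows "1 + sup_abs k \<le> (\<Prod>j\<in>UNIV. 1 + \<bar>real_of_int (k $ j)\<bar>)"
proof -
  obtain j where j: "\<bar>real_of_int (k $ j)\<bar> = sup_abs k" using sup_abs_attained by blast
  have "(1 + sup_abs k) * 1 \<le> (1 + \<bar>real_of_int (k $ j)\<bar>) * (\<Prod>j\<in>UNIV - {j}. 1 + \<bar>real_of_int (k $ j)\<bar>)"
    unfolding j by (intro mult_left_mono prod_ge_1) auto
  also have "\<dots> = (\<Prod>j\<in>UNIV. 1 + \<bar>real_of_int (k $ j)\<bar>)" by (rule prod.remove[symmetric]) auto
  finally show ?thesis by simp
qed

text \<open>Crude, but the right side factorises over the coordinates of \<open>k\<close>, so sums
  over \<open>k\<close> become products of one-dimensional sums.\<close>

lemma powr_weight_outer_le: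
  fixes k :: "int ^ 'm::finite" and q :: "int ^ 'n::finite"
  assumes "\<tau> \<ge> 0"
  shows "(1 + infnorm (real_mat (outer q k))) powr \<tau> \<le> (1 + sup_abs q) powr \<tau> * (\<Prod>j\<in>UNIV. (1 + \<bar>real_of_int (k $ j)\<bar>) powr \<tau>)"
proof -
  have "1 + infnorm (real_mat (outer q k)) \<le> (1 + sup_abs q) * (1 + sup_abs k)"
    by (simp add: infnorm_outer algebra_simps)
  also have "\<dots> \<le> (1 + sup_abs q) * (\<Prod>j\<in>UNIV. 1 + \<bar>real_of_int (k $ j)\<bar>)"
    by (intro mult_left_mono one_plus_sup_abs_le_prod) simp
  finally have "(1 + infnorm (real_mat (outer q k))) powr \<tau> \<le> ((1 + sup_abs q) * (\<Prod>j\<in>UNIV. 1 + \<bar>real_of_int (k $ j)\<bar>)) powr \<tau>"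
    using assms infnorm_pos_le[of "real_mat (outer q k)"] by (intro powr_mono2) auto
  also have "\<dots> = (1 + sup_abs q) powr \<tau> * (\<Prod>j\<in>UNIV. (1 + \<bar>real_of_int (k $ j)\<bar>) powr \<tau>)"
    by (subst powr_mult) (auto simp: prod_powr_distrib prod_nonneg)
  finally show ?thesis .
qed

lemma infnorm_real_mat_ge_1: "l \<noteq> 0 \<Longrightarrow> 1 \<le> infnorm (real_mat (l :: int ^ 'm::finite ^ 'n::finite))"
proof -
  assume "l \<noteq> 0"
  then obtain i j where "l $ i $ j \<noteq> 0" by (auto simp: vec_eq_iff)
  hence "1 \<le> \<bar>real_mat l $ i $ j\<bar>" by simp
  thus ?thesis using abs_nth_le_infnorm[of "real_mat l" i j] by linarith
qed

text \<open>
  The weights \<open>(\<delta> q / \<bar>q\<bar>) powr t\<close> are chosen so that they exactly compensate the width \<open>\<delta> q\<close>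
  of the bumps: at a frequency \<open>l = outer q k\<close> weight times coefficient is at most \<open>\<bar>l\<bar> powr - t\<close>,
  uniformly in \<open>q\<close>.
\<close>

lemma approx_multiplier:
  fixes \<mu> :: "(real ^ 'm::finite ^ 'n::finite) measure" and \<delta> :: "int ^ 'n \<Rightarrow> real"
  assumes fin: "finite_measure \<mu>" and S: "sets \<mu> = sets borel"
    and \<tau>: "0 < \<tau>" "\<tau> < t" "t \<le> 1" and B: "lattice_bounded \<tau> (fourier_transform \<mu>) B"
    and C: "C > 0" "\<And>(l :: int ^ 'm ^ 'n) P. l \<noteq> 0 \<Longrightarrow> P \<subseteq> {p. outer (fst p) (snd p) = l} \<Longrightarrow>
       real (card P) \<le> C * infnorm (real_mat l) powr \<epsilon>"
    and \<epsilon>: "\<epsilon> \<le> t - \<tau>"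
    and Q: "finite Q" "\<And>q. q \<in> Q \<Longrightarrow> q \<noteq> 0 \<and> 0 < \<delta> q \<and> \<delta> q \<le> 1 \<and> M \<le> sup_abs q"
    and M: "M > 0" and sum1: "1 \<le> (\<Sum>q\<in>Q. (\<delta> q / sup_abs q) powr t)"
  obtains F B' where
    "F \<in> borel_measurable borel" "\<And>x. 0 \<le> F x"
    "\<And>x. F x \<noteq> 0 \<Longrightarrow> \<exists>q\<in>Q. \<forall>j. int_dist (real_vec q \<bullet> column j x) \<le> \<delta> q / 2"
    "finite_measure (density \<mu> (\<lambda>x. ennreal (F x)))"
    "lattice_bounded \<tau> (fourier_transform (density \<mu> (\<lambda>x. ennreal (F x)))) B'"
    "\<And>\<xi>. cmod (fourier_transform (density \<mu> (\<lambda>x. ennreal (F x))) \<xi> - fourier_transform \<mu> \<xi>) \<le>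
       2 * C * M powr - (t - \<tau> - \<epsilon>) * B * (1 + infnorm \<xi>) powr - \<tau>"
proof -
  define good where "good q c \<longleftrightarrow> (\<forall>N k. cmod (c N k) \<le> tri_coeff_bound (\<delta> q) k) \<and> (\<forall>N>0. c N 0 = 1) \<and>
    (\<forall>t. (\<lambda>N. \<Sum>k\<in>{- int N..int N}. c N k * echar (of_int k * t)) \<longlonglongrightarrow> complex_of_real (tri (\<delta> q / 2) (int_dist t)))"
    for q and c :: "nat \<Rightarrow> int \<Rightarrow> complex"
  have "\<exists>c. good q c" if q: "q \<in> Q" for q
  proof -
    have d: "0 < \<delta> q / 2" "\<delta> q / 2 \<le> 1 / 2" using Q(2)[OF q] by auto
    obtain c :: "nat \<Rightarrow> int \<Rightarrow> complex" where c: "\<And>N k. cmod (c N k) \<le> 1" "\<And>N k. cmod (c N k) * (2 * (\<delta> q / 2) * of_int k)\<^sup>2 \<le> 1"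
      "\<And>N. N > 0 \<Longrightarrow> c N 0 = 1"
      "\<And>t. (\<lambda>N. \<Sum>k\<in>{- int N..int N}. c N k * echar (of_int k * t)) \<longlonglongrightarrow> complex_of_real (tri (\<delta> q / 2) (int_dist t))"
      using triangle_fejer_approximation[OF d] by blast
    have "cmod (c N k) \<le> tri_coeff_bound (\<delta> q) k" for N k
    proof (cases "k = 0")
      case False
      hence "0 < (2 * (\<delta> q / 2) * of_int k)\<^sup>2" using d(1) by simp
      thus ?thesis
        using c(1)[of N k] c(2)[of N k] False by (simp add: tri_coeff_bound_def pos_le_divide_eq)
    qed (use c(1) in \<open>simp add: tri_coeff_bound_def\<close>)
    hence "good q c" unfolding good_def using c(3,4) by blast
    thus ?thesis by blast
  qed
  then obtain c where c: "\<And>q. q \<in> Q \<Longrightarrow> good q (c q)" by metis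
  have cb: "cmod (c q N k) \<le> tri_coeff_bound (\<delta> q) k" if "q \<in> Q" for q N k
    using c[OF that] unfolding good_def by blast
  have c0: "c q N 0 = 1" if "q \<in> Q" "N > 0" for q N
    using c[OF that(1)] that(2) unfolding good_def by blast
  have cl: "(\<lambda>N. \<Sum>k\<in>{- int N..int N}. c q N k * echar (of_int k * t)) \<longlonglongrightarrow> complex_of_real (tri (\<delta> q / 2) (int_dist t))"
    if "q \<in> Q" for q t
    using c[OF that] unfolding good_def by blast
  define s where "s = (\<Sum>q\<in>Q. (\<delta> q / sup_abs q) powr t)"
  \<comment> \<open>As \<open>s \<ge> 1\<close>, normalising the total weight to 1 only lowers the
    weights.\<close>
  define w where "w q = (\<delta> q / sup_abs q) powr t / s" for q
  have s1: "s \<ge> 1" using sum1 by (simp add: s_def)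
  have w0: "w q \<ge> 0" for q using s1 by (simp add: w_def)
  have wsum: "(\<Sum>q\<in>Q. w q) = 1" using s1 by (simp add: w_def s_def flip: sum_divide_distrib)
  define \<beta> where "\<beta> p = (if fst p \<in> Q then w (fst p) * (\<Prod>j\<in>UNIV. tri_coeff_bound (\<delta> (fst p)) (snd p $ j)) else 0)"
    for p :: "(int ^ 'n) \<times> (int ^ 'm)"
  define fr where "fr p = outer (fst p) (snd p)" for p :: "(int ^ 'n) \<times> (int ^ 'm)"
  define box where "box N = {k :: int ^ 'm. \<forall>j. k $ j \<in> {- int N..int N}}" for N
  have fbox: "finite (box N)" for N unfolding box_def by (rule finite_vec_box) simp
  define b where "b N p = w (fst p) * (\<Prod>j\<in>UNIV. c (fst p) N (snd p $ j))" for N and p :: "(int ^ 'n) \<times> (int ^ 'm)"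
  define F where "F x = (\<Sum>q\<in>Q. w q * (\<Prod>j\<in>UNIV. tri (\<delta> q / 2) (int_dist (real_vec q \<bullet> column j x))))" for x :: "real ^ 'm ^ 'n"
  have Fcont: "continuous_on UNIV F"
    unfolding F_def column_def by (intro continuous_intros)
  have [measurable]: "F \<in> borel_measurable borel" by (rule borel_measurable_continuous_onI[OF Fcont])
  have F0: "F x \<ge> 0" for x
    unfolding F_def using Q by (intro sum_nonneg mult_nonneg_nonneg w0 prod_nonneg) auto
  have Fsupp: "\<exists>q\<in>Q. \<forall>j. int_dist (real_vec q \<bullet> column j x) \<le> \<delta> q / 2" if Fx: "F x \<noteq> 0" for x
  proof -
    obtain q where q: "q \<in> Q" "w q * (\<Prod>j\<in>UNIV. tri (\<delta> q / 2) (int_dist (real_vec q \<bullet> column j x))) \<noteq> 0"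
      using Fx unfolding F_def by (meson sum.not_neutral_contains_not_neutral)
    have "int_dist (real_vec q \<bullet> column j x) \<le> \<delta> q / 2" for j
      using q tri_eq_0[of "\<delta> q / 2" "int_dist (real_vec q \<bullet> column j x)"] Q(2)[OF q(1)]
      by (cases "int_dist (real_vec q \<bullet> column j x) \<le> \<delta> q / 2") auto
    thus ?thesis using q by blast
  qed
  \<comment> \<open>Coefficient decay of order 2 against a weight of order \<open>\<tau> < 1\<close>
    leaves an exponent above 1.\<close>
  obtain A where A: "\<And>(u :: real) (Y :: int set). finite Y \<Longrightarrow> (\<Sum>k\<in>Y. (1 + \<bar>u - of_int k\<bar>) powr - (2 - \<tau>)) \<le> A"
    using lattice_sum_bound[of "2 - \<tau>"] \<tau> by auto
  define G where "G q k = tri_coeff_bound (\<delta> q) k * (1 + \<bar>of_int k\<bar>) powr \<tau>" for q k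
  have Gb: "(\<Sum>k\<in>Y. G q k) \<le> 4 / (\<delta> q)\<^sup>2 * A" if "q \<in> Q" "finite Y" for q Y
  proof -
    have "(\<Sum>k\<in>Y. G q k) \<le> (\<Sum>k\<in>Y. 4 / (\<delta> q)\<^sup>2 * (1 + \<bar>0 - of_int k\<bar>) powr - (2 - \<tau>))"
    proof (intro sum_mono)
      fix k
      have "G q k \<le> (4 / (\<delta> q)\<^sup>2 * (1 + \<bar>of_int k\<bar>) powr - 2) * (1 + \<bar>of_int k\<bar>) powr \<tau>"
        unfolding G_def using Q(2)[OF that(1)] by (intro mult_right_mono tri_coeff_bound_le_weight) auto
      also have "\<dots> = 4 / (\<delta> q)\<^sup>2 * (1 + \<bar>0 - of_int k\<bar>) powr - (2 - \<tau>)"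
        by (simp flip: powr_add)
      finally show "G q k \<le> 4 / (\<delta> q)\<^sup>2 * (1 + \<bar>0 - of_int k\<bar>) powr - (2 - \<tau>)" .
    qed
    also have "\<dots> \<le> 4 / (\<delta> q)\<^sup>2 * A"
      unfolding sum_distrib_left[symmetric] using A[OF that(2), of 0] by (intro mult_left_mono) auto
    finally show ?thesis .
  qed
  define Z where "Z = (\<Sum>q\<in>Q. w q * ((1 + sup_abs q) powr \<tau> * (\<Prod>j\<in>(UNIV::'m set). 4 / (\<delta> q)\<^sup>2 * A)))"
  have Zb: "(\<Sum>p\<in>R. \<beta> p * (1 + infnorm (real_mat (fr p))) powr \<tau>) \<le> Z" if R: "finite R" for R
  proof -
    have "(\<Sum>p\<in>R. \<beta> p * (1 + infnorm (real_mat (fr p))) powr \<tau>) =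
        (\<Sum>p\<in>{p\<in>R. fst p \<in> Q}. \<beta> p * (1 + infnorm (real_mat (fr p))) powr \<tau>)"
      using R by (intro sum.mono_neutral_right) (auto simp: \<beta>_def)
    also have "\<dots> \<le> (\<Sum>p\<in>Q \<times> snd ` R. \<beta> p * (1 + infnorm (real_mat (fr p))) powr \<tau>)"
      using R Q(1) w0 by (intro sum_mono2) (force simp: \<beta>_def prod_nonneg)+
    also have "\<dots> = (\<Sum>q\<in>Q. w q * (\<Sum>k\<in>snd ` R. (\<Prod>j\<in>UNIV. tri_coeff_bound (\<delta> q) (k $ j)) * (1 + infnorm (real_mat (outer q k))) powr \<tau>))"
      unfolding sum_distrib_left sum.cartesian_product by (intro sum.cong refl) (auto simp: \<beta>_def fr_def)
    also have "\<dots> \<le> Z"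
      unfolding Z_def
    proof (intro sum_mono mult_left_mono w0)
      fix q assume q: "q \<in> Q"
      have "(\<Sum>k\<in>snd ` R. (\<Prod>j\<in>UNIV. tri_coeff_bound (\<delta> q) (k $ j)) * (1 + infnorm (real_mat (outer q k))) powr \<tau>) \<le>
         (\<Sum>k\<in>snd ` R. (\<Prod>j\<in>UNIV. tri_coeff_bound (\<delta> q) (k $ j)) *
            ((1 + sup_abs q) powr \<tau> * (\<Prod>j\<in>UNIV. (1 + \<bar>real_of_int (k $ j)\<bar>) powr \<tau>)))"
        using \<tau> by (intro sum_mono mult_left_mono powr_weight_outer_le prod_nonneg) auto
      also have "\<dots> = (1 + sup_abs q) powr \<tau> * (\<Sum>k\<in>snd ` R. \<Prod>j\<in>UNIV. G q (k $ j))"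
        by (simp add: G_def prod.distrib sum_distrib_left mult_ac)
      also have "\<dots> \<le> (1 + sup_abs q) powr \<tau> * (\<Prod>j\<in>(UNIV::'m set). 4 / (\<delta> q)\<^sup>2 * A)"
        using R q by (intro mult_left_mono sum_prod_vec_le[where g = "\<lambda>_. G q"] Gb) (auto simp: G_def)
      finally show "(\<Sum>k\<in>snd ` R. (\<Prod>j\<in>UNIV. tri_coeff_bound (\<delta> q) (k $ j)) * (1 + infnorm (real_mat (outer q k))) powr \<tau>) \<le>
         (1 + sup_abs q) powr \<tau> * (\<Prod>j\<in>(UNIV::'m set). 4 / (\<delta> q)\<^sup>2 * A)" .
    qed
    finally show ?thesis .
  qed
  have lim: "(\<lambda>N. \<Sum>p\<in>Q \<times> box N. b N p * echar (x \<bullet> real_mat (fr p))) \<longlonglongrightarrow> complex_of_real (F x)" for x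
  proof -
    have "(\<Sum>p\<in>Q \<times> box N. b N p * echar (x \<bullet> real_mat (fr p))) =
       (\<Sum>q\<in>Q. w q * (\<Prod>j\<in>UNIV. \<Sum>k\<in>{- int N..int N}. c q N k * echar (of_int k * (real_vec q \<bullet> column j x))))" for N
    proof -
      have "(\<Sum>p\<in>Q \<times> box N. b N p * echar (x \<bullet> real_mat (fr p))) =
         (\<Sum>q\<in>Q. \<Sum>k\<in>box N. w q * (\<Prod>j\<in>UNIV. c q N (k $ j) * echar (of_int (k $ j) * (real_vec q \<bullet> column j x))))"
        unfolding sum.cartesian_product
        by (intro sum.cong refl) (auto simp: b_def fr_def inner_real_mat_outer echar_sum prod.distrib)
      also have "\<dots> = (\<Sum>q\<in>Q. w q * (\<Prod>j\<in>UNIV. \<Sum>k\<in>{- int N..int N}. c q N k * echar (of_int k * (real_vec q \<bullet> column j x))))"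
        unfolding sum_distrib_left[symmetric] box_def by (subst prod_sum_vec) auto
      finally show ?thesis .
    qed
    moreover have "(\<lambda>N. \<Sum>q\<in>Q. complex_of_real (w q) * (\<Prod>j\<in>UNIV. \<Sum>k\<in>{- int N..int N}. c q N k * echar (of_int k * (real_vec q \<bullet> column j x))))
      \<longlonglongrightarrow> (\<Sum>q\<in>Q. complex_of_real (w q) * (\<Prod>j\<in>UNIV. complex_of_real (tri (\<delta> q / 2) (int_dist (real_vec q \<bullet> column j x)))))"
      by (intro tendsto_sum tendsto_mult tendsto_prod tendsto_const cl)
    ultimately show ?thesis by (simp add: F_def)
  qed
  have bb: "cmod (b N p) \<le> \<beta> p" if "p \<in> Q \<times> box N" for N p
  proof -
    have q: "fst p \<in> Q" using that by auto
    have "cmod (b N p) = w (fst p) * (\<Prod>j\<in>UNIV. cmod (c (fst p) N (snd p $ j)))"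
      by (simp add: b_def norm_mult w0 flip: prod_norm)
    also have "\<dots> \<le> \<beta> p" unfolding \<beta>_def using q by (simp add: mult_left_mono prod_mono cb w0)
    finally show ?thesis .
  qed
  have \<beta>0: "\<beta> p \<ge> 0" for p by (simp add: \<beta>_def w0 prod_nonneg)
  have mean: "(\<Sum>p\<in>{p\<in>Q \<times> box N. fr p = 0}. b N p) = 1" if N: "N > 0" for N
  proof -
    \<comment> \<open>Since \<open>q \<noteq> 0\<close>, frequency 0 arises only from
      \<open>k = 0\<close>: one label for each \<open>q\<close>, with coefficient
      \<open>w q\<close>.\<close>
    have "k = 0" if q: "q \<in> Q" "outer q k = 0" for q and k :: "int ^ 'm"
    proof -
      obtain i where "q $ i \<noteq> 0" using Q(2)[OF q(1)] by (auto simp: vec_eq_iff)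
      moreover have "q $ i * k $ j = 0" for j using q(2) by (metis outer_nth zero_index)
      ultimately show ?thesis by (simp add: vec_eq_iff)
    qed
    hence "{p\<in>Q \<times> box N. fr p = 0} = (\<lambda>q. (q, 0)) ` Q" by (auto simp: fr_def box_def)
    hence "(\<Sum>p\<in>{p\<in>Q \<times> box N. fr p = 0}. b N p) = (\<Sum>q\<in>Q. b N (q, 0))"
      by (simp add: sum.reindex inj_on_def)
    also have "\<dots> = (\<Sum>q\<in>Q. complex_of_real (w q))" by (intro sum.cong refl) (simp add: b_def c0 N)
    also have "\<dots> = 1" using wsum by (metis of_real_sum of_real_1)
    finally show ?thesis .
  qed
  \<comment> \<open>A frequency of norm \<open>y\<close> has at most
    \<open>C * y powr \<epsilon>\<close> factorisations, each contributing at most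
    \<open>2 * y powr (\<tau> - t)\<close>, where the 2 comes from \<open>1 + y \<le> 2 * y\<close>.
    Moreover \<open>y \<ge> M\<close>, because \<open>q\<close> has norm at least \<open>M\<close>
    and \<open>k \<noteq> 0\<close>.\<close>
  define E where "E = 2 * C * M powr - (t - \<tau> - \<epsilon>)"
  have fiber: "(\<Sum>p\<in>R. \<beta> p * (1 + infnorm (real_mat (fr p))) powr \<tau>) \<le> E"
    if l: "l \<noteq> 0" and R: "finite R" "R \<subseteq> {p. fr p = l}" for l R
  proof -
    define R' where "R' = {p\<in>R. fst p \<in> Q}"
    define y where "y = infnorm (real_mat l)"
    have y1: "y \<ge> 1" using infnorm_real_mat_ge_1[OF l] by (simp add: y_def)
    have each: "\<beta> p * (1 + infnorm (real_mat (fr p))) powr \<tau> \<le> 2 * y powr (\<tau> - t)" if p: "p \<in> R'" for p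
    proof -
      define q where "q = fst p"
      define k where "k = snd p"
      have q: "q \<in> Q" and lq: "l = outer q k" using p R by (auto simp: R'_def q_def k_def fr_def)
      have k0: "k \<noteq> 0" using lq l by auto
      have y: "y = sup_abs q * sup_abs k" by (simp add: y_def lq infnorm_outer)
      have q1: "1 \<le> sup_abs q" using Q(2)[OF q] by (intro sup_abs_ge_1) auto
      have k1: "1 \<le> sup_abs k" using k0 by (rule sup_abs_ge_1)
      have d: "0 < \<delta> q" using Q(2)[OF q] by auto
      obtain j where j: "\<bar>real_of_int (k $ j)\<bar> = sup_abs k" using sup_abs_attained by blast
      have kj: "k $ j \<noteq> 0" using j k1 by auto
      \<comment> \<open>Decay is taken from a coordinate of maximal modulus; the other factors are
        at most 1.\<close>
      have "(\<Prod>j\<in>UNIV. tri_coeff_bound (\<delta> q) (k $ j)) = tri_coeff_bound (\<delta> q) (k $ j) * (\<Prod>j\<in>UNIV - {j}. tri_coeff_bound (\<delta> q) (k $ j))"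
        by (rule prod.remove) auto
      also have "\<dots> \<le> tri_coeff_bound (\<delta> q) (k $ j) * 1"
        by (intro mult_left_mono prod_le_1) (auto intro: tri_coeff_bound_le_1)
      also have "\<dots> \<le> (\<delta> q * sup_abs k) powr - t"
        using tri_coeff_bound_le_powr[OF d kj, of t] \<tau> j by simp
      finally have pr: "(\<Prod>j\<in>UNIV. tri_coeff_bound (\<delta> q) (k $ j)) \<le> (\<delta> q * sup_abs k) powr - t" .
      have "w q \<le> (\<delta> q / sup_abs q) powr t"
        unfolding w_def using s1 by (simp add: divide_le_eq mult_left_le mult_le_cancel_left1)
      hence "\<beta> p \<le> (\<delta> q / sup_abs q) powr t * (\<delta> q * sup_abs k) powr - t"
        unfolding \<beta>_def using q pr by (simp add: q_def[symmetric] k_def[symmetric] mult_mono prod_nonneg w0)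
      also have "\<dots> = y powr - t"
        using d q1 k1 by (simp add: y powr_divide powr_mult powr_minus field_simps)
      finally have b1: "\<beta> p \<le> y powr - t" .
      have "fr p = l" using p R by (auto simp: R'_def)
      have "(1 + y) powr \<tau> \<le> (2 * y) powr \<tau>" using y1 \<tau> by (intro powr_mono2) auto
      also have "\<dots> = 2 powr \<tau> * y powr \<tau>" using y1 by (simp add: powr_mult)
      also have "\<dots> \<le> 2 powr 1 * y powr \<tau>" using \<tau> by (intro mult_right_mono powr_mono) auto
      finally have "(1 + y) powr \<tau> \<le> 2 * y powr \<tau>" by simp
      hence "\<beta> p * (1 + y) powr \<tau> \<le> y powr - t * (2 * y powr \<tau>)"
        using b1 \<beta>0 by (intro mult_mono) auto
      also have "\<dots> = 2 * y powr (\<tau> - t)" using y1 by (simp add: powr_diff powr_minus field_simps)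
      finally show ?thesis using \<open>fr p = l\<close> by (simp add: y_def)
    qed
    have "(\<Sum>p\<in>R. \<beta> p * (1 + infnorm (real_mat (fr p))) powr \<tau>) = (\<Sum>p\<in>R'. \<beta> p * (1 + infnorm (real_mat (fr p))) powr \<tau>)"
      unfolding R'_def using R by (intro sum.mono_neutral_right) (auto simp: \<beta>_def)
    also have "\<dots> \<le> E"
    proof (cases "R' = {}")
      case True
      thus ?thesis using C(1) by (simp add: E_def)
    next
      case False
      then obtain q k where qk: "(q, k) \<in> R'" by auto
      hence q: "q \<in> Q" and lq: "l = outer q k" using R by (auto simp: R'_def fr_def)
      have "M * 1 \<le> sup_abs q * sup_abs k"
        using Q(2)[OF q] M l lq by (intro mult_mono sup_abs_ge_1) auto
      hence My: "M \<le> y" by (simp add: y_def lq infnorm_outer)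
      have "(\<Sum>p\<in>R'. \<beta> p * (1 + infnorm (real_mat (fr p))) powr \<tau>) \<le> (\<Sum>p\<in>R'. 2 * y powr (\<tau> - t))"
        by (intro sum_mono each)
      also have "\<dots> = real (card R') * (2 * y powr (\<tau> - t))" by simp
      also have "\<dots> \<le> (C * y powr \<epsilon>) * (2 * y powr (\<tau> - t))"
        unfolding y_def using R by (intro mult_right_mono C(2)[OF l]) (auto simp: R'_def fr_def)
      also have "\<dots> = 2 * C * y powr - (t - \<tau> - \<epsilon>)"
        by (simp add: powr_add[symmetric] algebra_simps)
      also have "\<dots> \<le> E"
        unfolding E_def using C(1) \<epsilon> M My by (intro mult_left_mono powr_mono2') auto
      finally show ?thesis .
    qed
    finally show ?thesis .
  qed
  note step = multiplier_step[where F = F and P = "\<lambda>N. Q \<times> box N" and b = b and fr = fr and \<beta> = \<beta> and Z = Z and E = E,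
      OF fin S less_imp_le[OF \<tau>(1)] B]
  show ?thesis
  proof
    show "finite_measure (density \<mu> (\<lambda>x. ennreal (F x)))"
      by (rule step(1)) (use F0 fbox Q(1) lim bb Zb \<beta>0 mean fiber in auto)
    show "lattice_bounded \<tau> (fourier_transform (density \<mu> (\<lambda>x. ennreal (F x)))) (Z * B)"
      by (rule step(2)) (use F0 fbox Q(1) lim bb Zb \<beta>0 mean fiber in auto)
    show "cmod (fourier_transform (density \<mu> (\<lambda>x. ennreal (F x))) \<xi> - fourier_transform \<mu> \<xi>) \<le>
       2 * C * M powr - (t - \<tau> - \<epsilon>) * B * (1 + infnorm \<xi>) powr - \<tau>" for \<xi>
      unfolding E_def[symmetric] by (rule step(3)) (use F0 fbox Q(1) lim bb Zb \<beta>0 mean fiber in auto)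
  qed (use F0 Fsupp in auto)
qed

section \<open>Weak limits of measures on a box\<close>

text \<open>The first nonzero digit contributes \<open>(1/4) ^ i\<close> and all later ones together
  at most a third of that, so two thirds remain. In base 2 the tail could cancel the leading
  term.\<close>

lemma quaternary_separation:
  fixes d :: "nat \<Rightarrow> real"
  assumes b: "\<And>k. \<bar>d k\<bar> \<le> 1" and z: "\<And>k. k < i \<Longrightarrow> d k = 0" and i: "\<bar>d i\<bar> = 1"
  shows "(1/4) ^ Suc i \<le> \<bar>\<Sum>k. (1/4) ^ k * d k\<bar>"
proof -
  have bk: "norm ((1/4) ^ k * d k) \<le> (1/4) ^ k" for k
    using mult_left_mono[OF b[of k], of "(1/4) ^ k"] by (simp add: abs_mult)
  have sg: "summable (\<lambda>k. (1/4::real) ^ k)" by (rule summable_geometric) simp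
  have s: "summable (\<lambda>k. (1/4) ^ k * d k)"
    by (rule summable_comparison_test'[OF sg, of 0]) (use bk in auto)
  have sg': "summable (\<lambda>k. (1/4::real) ^ (k + Suc i))" using sg by (subst summable_iff_shift)
  have "(\<Sum>k. (1/4) ^ k * d k) = (\<Sum>k. (1/4) ^ (k + Suc i) * d (k + Suc i)) + (\<Sum>k<Suc i. (1/4) ^ k * d k)"
    by (rule suminf_split_initial_segment[OF s])
  also have "(\<Sum>k<Suc i. (1/4) ^ k * d k) = (1/4) ^ i * d i" using z by simp
  finally have e: "(\<Sum>k. (1/4) ^ k * d k) = (\<Sum>k. (1/4) ^ (k + Suc i) * d (k + Suc i)) + (1/4) ^ i * d i" .
  have "norm (\<Sum>k. (1/4) ^ (k + Suc i) * d (k + Suc i)) \<le> (\<Sum>k. (1/4) ^ (k + Suc i))"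
    by (rule norm_suminf_le[OF bk sg'])
  also have "\<dots> = (\<Sum>k. (1/4) ^ Suc i * (1/4::real) ^ k)" by (simp add: power_add mult_ac)
  also have "\<dots> = (1/4) ^ Suc i * (4/3)" using suminf_geometric[of "1/4::real"] sg by (subst suminf_mult) auto
  finally have "\<bar>\<Sum>k. (1/4) ^ (k + Suc i) * d (k + Suc i)\<bar> \<le> (1/4) ^ i / 3" by simp
  moreover have "\<bar>(1/4) ^ i * d i\<bar> = (1/4::real) ^ i" using i by (simp add: abs_mult)
  moreover have "(0::real) < (1/4) ^ i" by simp
  ultimately have "(1/4) ^ i / 4 \<le> \<bar>(\<Sum>k. (1/4) ^ (k + Suc i) * d (k + Suc i)) + (1/4) ^ i * d i\<bar>" by linarith
  thus ?thesis unfolding e by simp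
qed

text \<open>
  A point of a box is encoded by the digits recording on which side of the countably many rational
  coordinate hyperplanes it lies. The code is not continuous, but its inverse is uniformly
  continuous, so weak compactness on the line transfers to the box.
\<close>

lemma box_coding:
  fixes a b :: "'a::euclidean_space"
  obtains s :: "'a \<Rightarrow> real" and \<pi> :: "real \<Rightarrow> 'a" where
    "s \<in> borel_measurable borel" "\<And>x. 0 \<le> s x" "\<And>x. s x \<le> 2" "continuous_on UNIV \<pi>"
    "\<And>x. x \<in> cbox a b \<Longrightarrow> \<pi> (s x) = x"
proof -
  define T where "T = (Basis :: 'a set) \<times> (UNIV :: rat set)"
  have T: "countable T" "T \<noteq> {}" unfolding T_def by (auto intro!: countable_SIGMA countable_finite[OF finite_Basis])
  define e where "e = from_nat_into T"
  define U where "U i = {x :: 'a. x \<bullet> fst (e i) < real_of_rat (snd (e i))}" for i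
  have "open (U i)" for i unfolding U_def by (intro open_Collect_less continuous_intros)
  hence [measurable]: "U i \<in> sets borel" for i by simp
  define s where "s x = (\<Sum>k. (1/4) ^ k * (indicator (U k) x :: real))" for x
  have sg: "summable (\<lambda>k. (1/4::real) ^ k)" by (rule summable_geometric) simp
  have sm: "summable (\<lambda>k. (1/4) ^ k * (indicator (U k) x :: real))" for x
    by (rule summable_comparison_test'[OF sg, of 0]) (auto simp: indicator_def)
  have smeas: "s \<in> borel_measurable borel" unfolding s_def by measurable
  have s0: "0 \<le> s x" for x unfolding s_def by (intro suminf_nonneg sm) auto
  have "s x \<le> (\<Sum>k. (1/4) ^ k)" for x unfolding s_def
    by (intro suminf_le sm sg) (auto simp: indicator_def)
  also have "(\<Sum>k. (1/4::real) ^ k) = 4/3" using suminf_geometric[of "1/4::real"] by simp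
  also have "\<dots> \<le> (2::real)" by simp
  finally have s2: "s x \<le> 2" for x .
  \<comment> \<open>The codes may already differ at a digit before \<open>i\<close>, which only
    widens the gap.\<close>
  have sep: "(1/4) ^ N \<le> \<bar>s x - s y\<bar>" if "i < N" "x \<in> U i" "y \<notin> U i" for x y i N
  proof -
    define d where "d k = (indicator (U k) x :: real) - indicator (U k) y" for k
    define i0 where "i0 = (LEAST k. d k \<noteq> 0)"
    have di: "d i \<noteq> 0" using that by (simp add: d_def)
    have nz: "d i0 \<noteq> 0" unfolding i0_def by (rule LeastI[of "\<lambda>k. d k \<noteq> 0", OF di])
    have "i0 \<le> i" unfolding i0_def by (rule Least_le[of "\<lambda>k. d k \<noteq> 0", OF di])
    have "s x - s y = (\<Sum>k. (1/4) ^ k * d k)"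
      unfolding s_def d_def by (subst suminf_diff[OF sm sm]) (simp add: right_diff_distrib)
    moreover have "(1/4) ^ Suc i0 \<le> \<bar>\<Sum>k. (1/4) ^ k * d k\<bar>"
    proof (rule quaternary_separation)
      show "d k = 0" if "k < i0" for k using that not_less_Least unfolding i0_def by blast
      show "\<bar>d i0\<bar> = 1" using nz by (auto simp: d_def indicator_def split: if_splits)
    qed (auto simp: d_def indicator_def)
    moreover have "(1/4::real) ^ N \<le> (1/4) ^ Suc i0" using \<open>i0 \<le> i\<close> that by (intro power_decreasing) auto
    ultimately show ?thesis by linarith
  qed
  have uc: "\<exists>\<eta>>0. \<forall>x\<in>cbox a b. \<forall>y\<in>cbox a b. \<bar>s x - s y\<bar> < \<eta> \<longrightarrow> dist x y < \<epsilon>" if \<epsilon>: "\<epsilon> > 0" for \<epsilon>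
  proof -
    obtain M :: nat where M: "real DIM('a) / \<epsilon> < real M" using reals_Archimedean2 by blast
    have M0: "real M > 0" using M \<epsilon> by (smt (verit) divide_nonneg_pos of_nat_0_le_iff)
    have bd: "bounded (cbox a b)" by (rule bounded_cbox)
    then obtain K where K: "\<And>x. x \<in> cbox a b \<Longrightarrow> norm x \<le> K" unfolding bounded_iff by blast
    \<comment> \<open>\<open>J\<close> collects the hyperplanes of a grid of mesh
      \<open>1 / M\<close> across the box, and \<open>N\<close> exceeds all their indices. Points
      with codes closer than \<open>(1/4) ^ N\<close> are on the same side of each of them, hence
      within \<open>1 / M\<close> in every coordinate.\<close>
    define L where "L = \<lceil>K * M\<rceil> + 1"
    define J where "J = (Basis :: 'a set) \<times> (\<lambda>n. of_int n / of_nat M :: rat) ` {-L..L}"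
    have fJ: "finite J" by (simp add: J_def)
    have JT: "J \<subseteq> T" by (auto simp: J_def T_def)
    define N where "N = Suc (Max (to_nat_on T ` J))"
    have one: "(1/4) ^ N \<le> \<bar>s x - s y\<bar>" if xy: "x \<in> cbox a b" "c \<in> Basis" "x \<bullet> c + 1 / M \<le> y \<bullet> c" for x y c
    proof -
      \<comment> \<open>The first grid value strictly above \<open>x \<bullet> c\<close> exceeds it
        by at most \<open>1 / M\<close>, so it separates \<open>x\<close> from \<open>y\<close>;
        that \<open>U\<close> is defined by a strict inequality settles the case of equality for
        \<open>y\<close>.\<close>
      define n where "n = \<lfloor>x \<bullet> c * M\<rfloor> + 1"
      define j where "j = (c, of_int n / of_nat M :: rat)"
      have "\<bar>x \<bullet> c\<bar> \<le> K" using Basis_le_norm[OF xy(2), of x] K[OF xy(1)] by linarith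
      hence "\<bar>x \<bullet> c * M\<bar> \<le> K * M" using M0 by (simp add: abs_mult)
      hence "n \<in> {-L..L}" unfolding n_def L_def by auto linarith+
      hence j: "j \<in> J" using xy by (auto simp: j_def J_def)
      define i where "i = to_nat_on T j"
      have ei: "e i = j" unfolding e_def i_def using T j JT by (intro from_nat_into_to_nat_on) auto
      have iN: "i < N" unfolding N_def i_def using fJ j by (simp add: less_Suc_eq_le)
      have r: "real_of_rat (snd j) = real_of_int n / real M" by (simp add: j_def of_rat_divide)
      have "x \<bullet> c * M < of_int n" "of_int n \<le> x \<bullet> c * M + 1" unfolding n_def by linarith+
      hence "x \<bullet> c < real_of_int n / M" "real_of_int n / M \<le> x \<bullet> c + 1 / M" using M0 by (auto simp: field_simps)
      hence "x \<in> U i" "y \<notin> U i" using xy(3) unfolding U_def ei r by (auto simp: j_def)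
      thus ?thesis using sep iN by blast
    qed
    show ?thesis
    proof (intro exI[of _ "(1/4) ^ N"] conjI ballI impI)
      fix x y assume x: "x \<in> cbox a b" and y: "y \<in> cbox a b" and less: "\<bar>s x - s y\<bar> < (1/4) ^ N"
      have "\<bar>(x - y) \<bullet> c\<bar> < 1 / M" if c: "c \<in> Basis" for c
      proof (rule ccontr)
        assume "\<not> \<bar>(x - y) \<bullet> c\<bar> < 1 / M"
        hence "x \<bullet> c + 1 / M \<le> y \<bullet> c \<or> y \<bullet> c + 1 / M \<le> x \<bullet> c" by (simp add: inner_diff_left) linarith
        thus False using one[OF x c, of y] one[OF y c, of x] less by (auto simp: abs_minus_commute)
      qed
      hence "(\<Sum>c\<in>Basis. \<bar>(x - y) \<bullet> c\<bar>) \<le> (\<Sum>c\<in>(Basis :: 'a set). 1 / M)" by (intro sum_mono less_imp_le)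
      also have "\<dots> = real DIM('a) / M" by simp
      also have "\<dots> < \<epsilon>" using M M0 \<epsilon> by (simp add: field_simps)
      finally show "dist x y < \<epsilon>" using norm_le_l1[of "x - y"] by (simp add: dist_norm)
    qed simp
  qed
  have inj: "inj_on s (cbox a b)"
  proof (rule inj_onI, rule ccontr)
    fix x y assume xy: "x \<in> cbox a b" "y \<in> cbox a b" "s x = s y" "x \<noteq> y"
    obtain \<eta> where "\<eta> > 0" "\<And>u v. u \<in> cbox a b \<Longrightarrow> v \<in> cbox a b \<Longrightarrow> \<bar>s u - s v\<bar> < \<eta> \<Longrightarrow> dist u v < dist x y"
      using uc[of "dist x y"] xy(4) by auto
    from this(2)[of x y] this(1) xy show False by simp
  qed
  define g where "g = inv_into (cbox a b) s"
  have gs: "g (s x) = x" if "x \<in> cbox a b" for x using inj that by (simp add: g_def)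
  have "uniformly_continuous_on (s ` cbox a b) g"
    unfolding uniformly_continuous_on_def
  proof (intro allI impI)
    fix \<epsilon> :: real assume "\<epsilon> > 0"
    from uc[OF this] obtain \<eta> where \<eta>: "\<eta> > 0"
      "\<And>x y. x \<in> cbox a b \<Longrightarrow> y \<in> cbox a b \<Longrightarrow> \<bar>s x - s y\<bar> < \<eta> \<Longrightarrow> dist x y < \<epsilon>" by blast
    show "\<exists>d>0. \<forall>x\<in>s ` cbox a b. \<forall>x'\<in>s ` cbox a b. dist x' x < d \<longrightarrow> dist (g x') (g x) < \<epsilon>"
      using \<eta> by (intro exI[of _ \<eta>]) (auto simp: gs dist_real_def)
  qed
  \<comment> \<open>A weak limit may charge points that are not codes, so decoding has to make sense
    on the whole line: uniform continuity extends it to the closure, Tietze's theorem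
    beyond.\<close>
  then obtain g' where g': "uniformly_continuous_on (closure (s ` cbox a b)) g'" "\<And>x. x \<in> s ` cbox a b \<Longrightarrow> g x = g' x"
    using uniformly_continuous_on_extension_on_closure by metis
  obtain \<pi> where \<pi>: "continuous_on UNIV \<pi>" "\<And>x. x \<in> closure (s ` cbox a b) \<Longrightarrow> \<pi> x = g' x"
    using Tietze_unbounded[of "closure (s ` cbox a b)" g' UNIV] uniformly_continuous_imp_continuous[OF g'(1)]
    by (metis closed_closure closed_closedin subtopology_UNIV)
  show ?thesis
  proof
    show "\<pi> (s x) = x" if x: "x \<in> cbox a b" for x
      using \<pi>(2)[of "s x"] g'(2)[of "s x"] gs[OF x] x closure_subset[of "s ` cbox a b"] by auto
  qed (use smeas s0 s2 \<pi>(1) in auto)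
qed

text \<open>All codes lie in \<open>[0, 2]\<close>, so the image measures on the line are tight and
  have a weak limit, whose image under \<open>\<pi>\<close> is \<open>\<nu>\<close>. The test
  function \<open>f \<circ> \<pi>\<close> is continuous although \<open>s\<close> is not, and
  composing it with \<open>s\<close> gives back \<open>f\<close> on the box.\<close>

lemma weak_limit_on_box:
  fixes \<mu> :: "nat \<Rightarrow> 'a::euclidean_space measure"
  assumes prob: "\<And>n. prob_space (\<mu> n)" and S: "\<And>n. sets (\<mu> n) = sets borel"
    and box: "\<And>n. AE x in \<mu> n. x \<in> cbox a b"
  obtains \<nu> r where "strict_mono (r :: nat \<Rightarrow> nat)" "prob_space \<nu>" "sets \<nu> = sets borel"
    "\<And>(f :: 'a \<Rightarrow> complex) B. continuous_on UNIV f \<Longrightarrow> (\<And>x. cmod (f x) \<le> B) \<Longrightarrow>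
       (\<lambda>n. LINT x|\<mu> (r n). f x) \<longlonglongrightarrow> (LINT x|\<nu>. f x)"
proof -
  obtain s :: "'a \<Rightarrow> real" and \<pi> where s [measurable]: "s \<in> borel_measurable borel" and s0: "\<And>x. 0 \<le> s x" "\<And>x. s x \<le> 2"
    and \<pi>: "continuous_on UNIV \<pi>" and \<pi>s: "\<And>x. x \<in> cbox a b \<Longrightarrow> \<pi> (s x) = x"
    using box_coding[of a b] by blast
  have [measurable]: "\<pi> \<in> borel_measurable borel" by (rule borel_measurable_continuous_onI[OF \<pi>])
  define \<rho> where "\<rho> n = distr (\<mu> n) borel s" for n
  have sm: "s \<in> borel_measurable (\<mu> n)" for n using s by (subst measurable_cong_sets[OF S refl])
  have rd: "real_distribution (\<rho> n)" for n
    unfolding \<rho>_def real_distribution_def real_distribution_axioms_def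
    using prob_space.prob_space_distr[OF prob sm] by simp
  have tight: "tight \<rho>"
    unfolding tight_def
  proof (intro conjI allI impI rd)
    fix e :: real assume "e > 0"
    have "measure (\<rho> n) {-1<..2} = 1" for n
    proof -
      have "measure (\<rho> n) {-1<..2} = measure (\<mu> n) (s -` {-1<..2} \<inter> space (\<mu> n))"
        unfolding \<rho>_def by (rule measure_distr[OF sm]) simp
      also have "s -` {-1<..2} \<inter> space (\<mu> n) = space (\<mu> n)"
        using s0 by (auto intro!: less_le_trans[OF _ s0(1)])
      finally show ?thesis using prob_space.prob_space[OF prob] by simp
    qed
    thus "\<exists>x y. x < y \<and> (\<forall>n. 1 - e < measure (\<rho> n) {x<..y})"
      using \<open>e > 0\<close> by (intro exI[of _ "-1"] exI[of _ 2]) auto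
  qed
  obtain r M where r: "strict_mono r" and M: "real_distribution M" and wc: "weak_conv_m (\<rho> \<circ> id \<circ> r) M"
    using tight_imp_convergent_subsubsequence[OF tight, of id] by (auto simp: strict_mono_id)
  interpret M: real_distribution M by fact
  define \<nu> where "\<nu> = distr M borel \<pi>"
  have \<pi>M: "\<pi> \<in> borel_measurable M" by simp
  show ?thesis
  proof
    show "strict_mono r" by fact
    show "prob_space \<nu>" unfolding \<nu>_def by (rule M.prob_space_distr[OF \<pi>M])
    show "sets \<nu> = sets borel" by (simp add: \<nu>_def)
    fix f :: "'a \<Rightarrow> complex" and B assume f: "continuous_on UNIV f" "\<And>x. cmod (f x) \<le> B"
    have [measurable]: "f \<in> borel_measurable borel" by (rule borel_measurable_continuous_onI[OF f(1)])
    have cf: "isCont (\<lambda>x. f (\<pi> x)) x" for x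
      using continuous_on_compose2[OF f(1) \<pi>] by (simp add: continuous_on_eq_continuous_at)
    have "(\<lambda>n. LINT x|(\<rho> \<circ> id \<circ> r) n. f (\<pi> x)) \<longlonglongrightarrow> (LINT x|M. f (\<pi> x))"
      by (rule weak_conv_imp_integral_bdd_continuous_conv[OF _ M wc cf]) (use rd f(2) in auto)
    moreover have "(LINT x|M. f (\<pi> x)) = (LINT x|\<nu>. f x)"
      unfolding \<nu>_def by (rule integral_distr[symmetric]) auto
    moreover have "(LINT x|(\<rho> \<circ> id \<circ> r) n. f (\<pi> x)) = (LINT x|\<mu> (r n). f x)" for n
    proof -
      have "(LINT x|(\<rho> \<circ> id \<circ> r) n. f (\<pi> x)) = (LINT x|\<mu> (r n). f (\<pi> (s x)))"
        unfolding o_def id_def \<rho>_def by (rule integral_distr[OF sm]) auto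
      also have "\<dots> = (LINT x|\<mu> (r n). f x)"
      proof (rule integral_cong_AE)
        show "AE x in \<mu> (r n). f (\<pi> (s x)) = f x"
          using box[of "r n"] by eventually_elim (simp add: \<pi>s)
      qed (simp_all add: measurable_cong_sets[OF S refl])
      finally show ?thesis .
    qed
    ultimately show "(\<lambda>n. LINT x|\<mu> (r n). f x) \<longlonglongrightarrow> (LINT x|\<nu>. f x)" by simp
  qed
qed

section \<open>The initial measure\<close>

definition tri_measure :: "real measure" where
  "tri_measure = density lborel (\<lambda>u. ennreal (tri (1/2) u))"

lemma borel_measurable_tri [measurable]: "tri h \<in> borel_measurable borel"
  by (intro borel_measurable_continuous_onI continuous_intros)

lemma nn_integral_tri: "(\<integral>\<^sup>+u. ennreal (tri (1/2) u) \<partial>lborel) = 1"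
proof -
  have "(tri (1/2) has_integral 1) UNIV"
    by (rule has_integral_on_superset[OF has_integral_tri[of "1/2"]]) (auto simp: tri_eq_0)
  thus ?thesis using nn_integral_has_integral_lborel[of "tri (1/2)" 1] by simp
qed

lemma prob_space_tri_measure: "prob_space tri_measure"
  by (rule prob_spaceI) (simp add: tri_measure_def emeasure_density nn_integral_tri)

lemma sets_tri_measure [simp, measurable_cong]: "sets tri_measure = sets borel"
  by (simp add: tri_measure_def)

lemma AE_tri_measure: "AE u in tri_measure. \<bar>u\<bar> \<le> 1/2"
proof -
  have "\<bar>u\<bar> \<le> 1/2" if "tri (1/2) u \<noteq> 0" for u
    using that tri_eq_0[of "1/2" u] by linarith
  thus ?thesis unfolding tri_measure_def by (subst AE_density) (auto intro!: AE_I2)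
qed

text \<open>At \<open>h = 1/2\<close> the modulus \<open>m\<close> satisfies
  \<open>m \<le> 1\<close> and \<open>m * y\<^sup>2 \<le> 1\<close>; with
  \<open>(1 + \<bar>y\<bar>)\<^sup>2 \<le> 2 * (1 + y\<^sup>2)\<close> this gives the constant
  4.\<close>

lemma tri_measure_transform:
  "cmod (LINT u|tri_measure. echar (- (u * y))) \<le> 4 * (1 + \<bar>y\<bar>) powr - 2"
proof -
  have itri: "integrable lborel (tri (1/2))"
    by (rule integrableI_nonneg) (auto simp: nn_integral_tri)
  have i: "integrable lborel (\<lambda>u. tri (1/2) u *\<^sub>R echar (- (u * y)))"
    by (rule Bochner_Integration.integrable_bound[OF itri]) auto
  have "(LINT u|tri_measure. echar (- (u * y))) = (LINT u|lborel. tri (1/2) u *\<^sub>R echar (- (u * y)))"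
    unfolding tri_measure_def by (subst integral_density) auto
  also have "\<dots> = integral {-1/2..1/2} (\<lambda>u. tri (1/2) u * echar (- y * u))"
  proof (rule has_integral_unique[OF has_integral_integral_lborel[OF i]])
    have "((\<lambda>u. tri (1/2) u * echar (- y * u)) has_integral integral {-1/2..1/2} (\<lambda>u. tri (1/2) u * echar (- y * u))) UNIV"
      by (rule has_integral_on_superset[OF integrable_integral])
         (auto intro!: integrable_continuous_interval continuous_intros simp: tri_eq_0)
    thus "((\<lambda>u. tri (1/2) u *\<^sub>R echar (- (u * y))) has_integral integral {-1/2..1/2} (\<lambda>u. tri (1/2) u * echar (- y * u))) UNIV"
      by (simp add: scaleR_conv_of_real mult.commute)
  qed
  finally have eq: "(LINT u|tri_measure. echar (- (u * y))) = integral {-(1/2)..1/2} (\<lambda>u. tri (1/2) u * echar (- y * u))" by simp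
  define m where "m = cmod (LINT u|tri_measure. echar (- (u * y)))"
  have m: "m \<le> 1" "m * y\<^sup>2 \<le> 1" "m \<ge> 0"
    using tri_transform_bounds[of "1/2" "- y"] by (auto simp: m_def eq)
  have "m * (1 + \<bar>y\<bar>)\<^sup>2 \<le> m * (2 * (1 + y\<^sup>2))"
  proof (intro mult_left_mono m)
    have "0 \<le> (1 - \<bar>y\<bar>)\<^sup>2" by simp
    thus "(1 + \<bar>y\<bar>)\<^sup>2 \<le> 2 * (1 + y\<^sup>2)" by (simp add: power2_eq_square algebra_simps)
  qed
  also have "\<dots> \<le> 4" using m by (simp add: algebra_simps)
  finally have "m \<le> 4 / (1 + \<bar>y\<bar>)\<^sup>2"
    by (simp add: pos_le_divide_eq add_pos_nonneg zero_less_power)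
  moreover have "(1 + \<bar>y\<bar>) powr - 2 = 1 / (1 + \<bar>y\<bar>)\<^sup>2"
    by (simp add: powr_minus divide_inverse powr_numeral)
  ultimately show ?thesis by (simp add: m_def)
qed

text \<open>The shift by 1/2 moves the support into the unit cube. Lebesgue measure on the cube
  would not serve: its transform decays only to first order in each coordinate, which is not
  summable along the lattice.\<close>

definition initial_measure :: "(real ^ 'm::finite ^ 'n::finite) measure" where
  "initial_measure = distr (PiM UNIV (\<lambda>_ :: 'n \<times> 'm. tri_measure)) borel (\<lambda>f. \<chi> i j. f (i, j) + 1/2)"

lemma measurable_initial [measurable]:
  "(\<lambda>f. \<chi> i j. f (i, j) + 1/2) \<in> PiM UNIV (\<lambda>_ :: 'n::finite \<times> 'm::finite. tri_measure) \<rightarrow>\<^sub>M (borel :: (real ^ 'm ^ 'n) measure)"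
proof (subst borel_measurable_euclidean_space, intro ballI)
  fix b :: "real ^ 'm ^ 'n" assume "b \<in> Basis"
  then obtain i j where b: "b = axis i (axis j 1)" by (auto simp: Basis_vec_def)
  have "(\<lambda>f. f (i, j)) \<in> PiM UNIV (\<lambda>_ :: 'n \<times> 'm. tri_measure) \<rightarrow>\<^sub>M tri_measure"
    by (rule measurable_component_singleton) simp
  hence [measurable]: "(\<lambda>f. f (i, j)) \<in> borel_measurable (PiM UNIV (\<lambda>_ :: 'n \<times> 'm. tri_measure))"
    by (simp cong: measurable_cong_sets)
  show "(\<lambda>f. (\<chi> i j. f (i, j) + 1/2) \<bullet> b) \<in> borel_measurable (PiM UNIV (\<lambda>_ :: 'n \<times> 'm. tri_measure))"
    by (simp add: b inner_axis)
qed

lemma prob_space_initial: "prob_space (initial_measure :: (real ^ 'm::finite ^ 'n::finite) measure)"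
  unfolding initial_measure_def
  by (intro prob_space.prob_space_distr prob_space_PiM prob_space_tri_measure measurable_initial)

lemma sets_initial: "sets initial_measure = sets borel"
  by (simp add: initial_measure_def)

lemma AE_initial:
  "AE x in (initial_measure :: (real ^ 'm::finite ^ 'n::finite) measure). x \<in> cbox 0 (\<chi> i j. 1)"
proof -
  have "AE f in PiM UNIV (\<lambda>_ :: 'n \<times> 'm. tri_measure). \<bar>f p\<bar> \<le> 1/2" for p
    by (rule AE_PiM_component[where P = "\<lambda>u. \<bar>u\<bar> \<le> 1/2"]) (use prob_space_tri_measure AE_tri_measure in simp_all)
  hence "AE f in PiM UNIV (\<lambda>_ :: 'n \<times> 'm. tri_measure). \<forall>p. \<bar>f p\<bar> \<le> 1/2"
    by (simp add: AE_all_countable)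
  hence "AE f in PiM UNIV (\<lambda>_ :: 'n \<times> 'm. tri_measure). (\<chi> i j. f (i, j) + 1/2) \<in> cbox 0 ((\<chi> i j. 1) :: real ^ 'm ^ 'n)"
  proof eventually_elim
    case (elim f)
    have "0 \<le> f p + 1/2 \<and> f p + 1/2 \<le> 1" for p using elim[rule_format, of p] by linarith
    thus ?case by (auto simp: mem_box Basis_vec_def inner_axis)
  qed
  thus ?thesis unfolding initial_measure_def by (subst AE_distr_iff) auto
qed

lemma initial_transform:
  fixes y :: "real ^ 'm::finite ^ 'n::finite"
  shows "cmod (fourier_transform initial_measure y) \<le> (\<Prod>i\<in>UNIV. \<Prod>j\<in>UNIV. 4 * (1 + \<bar>y $ i $ j\<bar>) powr - 2)"
proof -
  interpret product_sigma_finite "\<lambda>_ :: 'n \<times> 'm. tri_measure"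
    by (intro product_sigma_finite.intro prob_space_imp_sigma_finite prob_space_tri_measure)
  define g where "g p u = echar (- ((u + 1/2) * (y $ fst p $ snd p)))" for p and u :: real
  have int: "integrable tri_measure (g p)" for p
  proof -
    interpret prob_space tri_measure by (rule prob_space_tri_measure)
    show ?thesis unfolding g_def by (rule integrable_const_bound[where B = 1]) auto
  qed
  have "fourier_transform initial_measure y = (LINT f|PiM UNIV (\<lambda>_ :: 'n \<times> 'm. tri_measure). echar (- ((\<chi> i j. f (i, j) + 1/2) \<bullet> y)))"
    unfolding fourier_transform_echar initial_measure_def by (rule integral_distr) auto
  also have "\<dots> = (LINT f|PiM UNIV (\<lambda>_ :: 'n \<times> 'm. tri_measure). (\<Prod>p\<in>UNIV. g p (f p)))"
  proof (intro Bochner_Integration.integral_cong refl)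
    fix f :: "'n \<times> 'm \<Rightarrow> real"
    have "- ((\<chi> i j. f (i, j) + 1/2) \<bullet> y) = (\<Sum>p\<in>UNIV. - ((f p + 1/2) * (y $ fst p $ snd p)))"
      by (simp add: inner_vec_def sum_negf sum.cartesian_product split_def)
    thus "echar (- ((\<chi> i j. f (i, j) + 1/2) \<bullet> y)) = (\<Prod>p\<in>UNIV. g p (f p))"
      by (simp add: echar_sum g_def)
  qed
  also have "\<dots> = (\<Prod>p\<in>UNIV. LINT u|tri_measure. g p u)"
    by (rule product_integral_prod) (auto intro: int)
  finally have "cmod (fourier_transform initial_measure y) = (\<Prod>p\<in>UNIV. cmod (LINT u|tri_measure. g p u))"
    by (simp add: prod_norm)
  also have "\<dots> \<le> (\<Prod>p\<in>(UNIV :: ('n \<times> 'm) set). 4 * (1 + \<bar>y $ fst p $ snd p\<bar>) powr - 2)"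
  proof (intro prod_mono conjI norm_ge_zero)
    fix p
    have "g p u = echar (- (1/2 * (y $ fst p $ snd p))) * echar (- (u * (y $ fst p $ snd p)))" for u
      unfolding g_def echar_add[symmetric] by (simp add: algebra_simps)
    hence "cmod (LINT u|tri_measure. g p u) = cmod (LINT u|tri_measure. echar (- (u * (y $ fst p $ snd p))))"
      by (simp add: norm_mult)
    thus "cmod (LINT u|tri_measure. g p u) \<le> 4 * (1 + \<bar>y $ fst p $ snd p\<bar>) powr - 2"
      using tri_measure_transform by simp
  qed
  also have "\<dots> = (\<Prod>i\<in>UNIV. \<Prod>j\<in>UNIV. 4 * (1 + \<bar>y $ i $ j\<bar>) powr - 2)"
    by (simp add: prod.cartesian_product split_def)
  finally show ?thesis .
qed

lemma one_plus_infnorm_le_prod: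
  fixes y :: "real ^ 'm::finite ^ 'n::finite"
  shows "1 + infnorm y \<le> (\<Prod>i\<in>UNIV. \<Prod>j\<in>UNIV. 1 + \<bar>y $ i $ j\<bar>)"
proof -
  have ge: "1 + \<bar>y $ i $ j\<bar> \<le> (\<Prod>i\<in>UNIV. \<Prod>j\<in>UNIV. 1 + \<bar>y $ i $ j\<bar>)" for i j
  proof -
    have "(1 + \<bar>y $ i $ j\<bar>) * 1 \<le> (1 + \<bar>y $ i $ j\<bar>) * (\<Prod>j\<in>UNIV - {j}. 1 + \<bar>y $ i $ j\<bar>)"
      by (intro mult_left_mono prod_ge_1) auto
    also have "\<dots> = (\<Prod>j\<in>UNIV. 1 + \<bar>y $ i $ j\<bar>)" by (rule prod.remove[symmetric]) auto
    finally have 1: "1 + \<bar>y $ i $ j\<bar> \<le> (\<Prod>j\<in>UNIV. 1 + \<bar>y $ i $ j\<bar>)" by simp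
    have "(\<Prod>j\<in>UNIV. 1 + \<bar>y $ i $ j\<bar>) * 1 \<le> (\<Prod>j\<in>UNIV. 1 + \<bar>y $ i $ j\<bar>) * (\<Prod>i\<in>UNIV - {i}. \<Prod>j\<in>UNIV. 1 + \<bar>y $ i $ j\<bar>)"
      by (intro mult_left_mono prod_ge_1 prod_nonneg) auto
    also have "\<dots> = (\<Prod>i\<in>UNIV. \<Prod>j\<in>UNIV. 1 + \<bar>y $ i $ j\<bar>)" by (rule prod.remove[symmetric]) auto
    finally show ?thesis using 1 by simp
  qed
  have "infnorm y \<le> (\<Prod>i\<in>UNIV. \<Prod>j\<in>UNIV. 1 + \<bar>y $ i $ j\<bar>) - 1"
    unfolding infnorm_le_iff using ge by (simp add: algebra_simps)
  thus ?thesis by simp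
qed

text \<open>The lattice sum factorises over the rows and then over the entries of a row; each entry
  gives a one-dimensional sum of exponent \<open>2 - \<tau> > 1\<close>, bounded uniformly in the
  shift.\<close>

lemma lattice_bounded_initial:
  assumes \<tau>: "0 \<le> \<tau>" "\<tau> < 1"
  obtains B where "lattice_bounded \<tau> (fourier_transform (initial_measure :: (real ^ 'm::finite ^ 'n::finite) measure)) B"
proof -
  obtain A where A: "\<And>(u :: real) (Y :: int set). finite Y \<Longrightarrow> (\<Sum>k\<in>Y. (1 + \<bar>u - of_int k\<bar>) powr - (2 - \<tau>)) \<le> A"
    using lattice_sum_bound[of "2 - \<tau>"] \<tau> by auto
  show ?thesis
  proof (rule that, unfold lattice_bounded_def, intro allI impI)
    fix \<xi> :: "real ^ 'm ^ 'n" and L :: "(int ^ 'm ^ 'n) set" assume L: "finite L"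
    have "(\<Sum>l\<in>L. cmod (fourier_transform initial_measure (\<xi> - real_mat l)) * (1 + infnorm (\<xi> - real_mat l)) powr \<tau>)
       \<le> (\<Sum>l\<in>L. \<Prod>i\<in>UNIV. \<Prod>j\<in>UNIV. 4 * (1 + \<bar>\<xi> $ i $ j - of_int (l $ i $ j)\<bar>) powr - (2 - \<tau>))"
    proof (intro sum_mono)
      fix l
      let ?y = "\<xi> - real_mat l"
      have "(1 + infnorm ?y) powr \<tau> \<le> (\<Prod>i\<in>UNIV. \<Prod>j\<in>UNIV. 1 + \<bar>?y $ i $ j\<bar>) powr \<tau>"
        using \<tau> infnorm_pos_le[of ?y] by (intro powr_mono2 one_plus_infnorm_le_prod) auto
      also have "\<dots> = (\<Prod>i\<in>UNIV. \<Prod>j\<in>UNIV. (1 + \<bar>?y $ i $ j\<bar>) powr \<tau>)"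
        by (simp add: prod_powr_distrib prod_nonneg)
      finally have "cmod (fourier_transform initial_measure ?y) * (1 + infnorm ?y) powr \<tau> \<le>
         (\<Prod>i\<in>UNIV. \<Prod>j\<in>UNIV. 4 * (1 + \<bar>?y $ i $ j\<bar>) powr - 2) * (\<Prod>i\<in>UNIV. \<Prod>j\<in>UNIV. (1 + \<bar>?y $ i $ j\<bar>) powr \<tau>)"
        by (intro mult_mono initial_transform) (auto intro!: prod_nonneg)
      also have "\<dots> = (\<Prod>i\<in>UNIV. \<Prod>j\<in>UNIV. 4 * ((1 + \<bar>?y $ i $ j\<bar>) powr - 2 * (1 + \<bar>?y $ i $ j\<bar>) powr \<tau>))"
        by (simp add: prod.distrib[symmetric] mult.assoc)
      also have "\<dots> = (\<Prod>i\<in>UNIV. \<Prod>j\<in>UNIV. 4 * (1 + \<bar>\<xi> $ i $ j - of_int (l $ i $ j)\<bar>) powr - (2 - \<tau>))"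
        by (simp add: powr_add[symmetric])
      finally show "cmod (fourier_transform initial_measure ?y) * (1 + infnorm ?y) powr \<tau> \<le> \<dots>" .
    qed
    also have "\<dots> \<le> (\<Prod>i\<in>(UNIV::'n set). \<Prod>j\<in>(UNIV::'m set). 4 * A)"
    proof (rule sum_prod_vec_le[where g = "\<lambda>i v. \<Prod>j\<in>UNIV. 4 * (1 + \<bar>\<xi> $ i $ j - of_int (v $ j)\<bar>) powr - (2 - \<tau>)", OF L])
      fix i and Y :: "(int ^ 'm) set" assume Y: "finite Y"
      show "(\<Sum>v\<in>Y. \<Prod>j\<in>UNIV. 4 * (1 + \<bar>\<xi> $ i $ j - of_int (v $ j)\<bar>) powr - (2 - \<tau>)) \<le> (\<Prod>j\<in>(UNIV::'m set). 4 * A)"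
        by (rule sum_prod_vec_le[where g = "\<lambda>j k. 4 * (1 + \<bar>\<xi> $ i $ j - of_int k\<bar>) powr - (2 - \<tau>)", OF Y])
           (use A in \<open>auto simp: sum_distrib_left[symmetric]\<close>)
    qed (auto intro!: prod_nonneg)
    finally show "(\<Sum>l\<in>L. cmod (fourier_transform initial_measure (\<xi> - real_mat l)) * (1 + infnorm (\<xi> - real_mat l)) powr \<tau>)
       \<le> (\<Prod>i\<in>(UNIV::'n set). \<Prod>j\<in>(UNIV::'m set). 4 * A)" .
  qed
qed

section \<open>The lower bound\<close>

lemma closed_measure_support: "closed (measure_support (\<mu> :: 'a::topological_space measure))"
proof -
  have "- measure_support \<mu> = \<Union>{U. open U \<and> \<not> emeasure \<mu> U > 0}"
    by (auto simp: measure_support_def)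
  thus ?thesis by (simp add: closed_def open_Union)
qed

lemma measure_support_subset:
  assumes S: "sets \<mu> = sets borel" and "closed K" "AE x in \<mu>. x \<in> K"
  shows "measure_support \<mu> \<subseteq> K"
proof
  fix x assume x: "x \<in> measure_support \<mu>"
  show "x \<in> K"
  proof (rule ccontr)
    assume "x \<notin> K"
    hence "emeasure \<mu> (- K) > 0" using x assms(2) by (auto simp: measure_support_def)
    moreover have "emeasure \<mu> (- K) = 0"
    proof -
      have sp: "space \<mu> = UNIV" using sets_eq_imp_space_eq[OF S] by simp
      have "- K \<in> sets \<mu>" using assms by (simp add: S)
      hence "- K \<in> null_sets \<mu>" using assms(3) by (subst AE_iff_null_sets) auto
      thus ?thesis by auto
    qed
    ultimately show False by simp
  qed
qed

text \<open>The truncated distance to \<open>K\<close> is a bounded continuous function that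
  vanishes exactly on \<open>K\<close>. Its integrals are eventually 0, hence so is the integral
  against the limit.\<close>

lemma AE_weak_limit_closed:
  fixes \<nu> :: "'a::euclidean_space measure"
  assumes prob: "prob_space \<nu>" "\<And>n. prob_space (\<mu> n)"
    and S: "sets \<nu> = sets borel" "\<And>n. sets (\<mu> n) = sets borel"
    and lim: "\<And>(f :: 'a \<Rightarrow> complex) B. continuous_on UNIV f \<Longrightarrow> (\<And>x. cmod (f x) \<le> B) \<Longrightarrow>
       (\<lambda>n. LINT x|\<mu> n. f x) \<longlonglongrightarrow> (LINT x|\<nu>. f x)"
    and K: "closed K" "\<And>n. n \<ge> n0 \<Longrightarrow> AE x in \<mu> n. x \<in> K"
  shows "AE x in \<nu>. x \<in> K"
proof -
  interpret N: prob_space \<nu> by fact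
  \<comment> \<open>The distance to the empty set is 0 by convention, so \<open>K\<close> must be
    nonempty for the zero set of \<open>h\<close> to be \<open>K\<close>.\<close>
  have Kne: "K \<noteq> {}"
  proof
    assume "K = {}"
    hence "AE x in \<mu> n0. False" using K(2)[of n0] by simp
    thus False using prob_space.AE_False[OF prob(2)] by simp
  qed
  define h where "h x = min 1 (infdist x K)" for x
  have hc: "continuous_on UNIV h" unfolding h_def by (intro continuous_intros)
  have h0: "h x \<ge> 0" for x by (simp add: h_def infdist_nonneg)
  have h1: "h x \<le> 1" for x by (simp add: h_def)
  have [measurable]: "h \<in> borel_measurable borel" by (rule borel_measurable_continuous_onI[OF hc])
  have hm: "h \<in> borel_measurable \<nu>" by (simp add: measurable_cong_sets[OF S(1) refl])
  have hK: "h x = 0 \<longleftrightarrow> x \<in> K" for x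
    using in_closed_iff_infdist_zero[OF K(1) Kne, of x] by (simp add: h_def min_def)
  have "(\<lambda>n. LINT x|\<mu> n. complex_of_real (h x)) \<longlonglongrightarrow> (LINT x|\<nu>. complex_of_real (h x))"
    by (rule lim[of _ 1]) (use hc h0 h1 in \<open>auto intro!: continuous_intros\<close>)
  moreover have "(LINT x|\<mu> n. complex_of_real (h x)) = 0" if "n \<ge> n0" for n
  proof -
    have "(LINT x|\<mu> n. complex_of_real (h x)) = (LINT x|\<mu> n. 0)"
    proof (rule integral_cong_AE)
      show "AE x in \<mu> n. complex_of_real (h x) = 0" using K(2)[OF that] by eventually_elim (simp add: hK)
    qed (simp_all add: measurable_cong_sets[OF S(2) refl])
    thus ?thesis by simp
  qed
  hence "(\<lambda>n. LINT x|\<mu> n. complex_of_real (h x)) \<longlonglongrightarrow> 0"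
    by (intro tendsto_eventually) (auto simp: eventually_sequentially)
  ultimately have "(LINT x|\<nu>. complex_of_real (h x)) = 0" using LIMSEQ_unique by blast
  hence "(LINT x|\<nu>. h x) = 0" by simp
  moreover have "integrable \<nu> h" by (rule N.integrable_const_bound[where B = 1]) (use hm h0 h1 in auto)
  ultimately have "AE x in \<nu>. h x = 0" using integral_nonneg_eq_0_iff_AE[of \<nu> h] h0 by auto
  thus ?thesis by eventually_elim (simp add: hK)
qed

lemma fourier_transform_0: "fourier_transform \<mu> 0 = complex_of_real (measure \<mu> (space \<mu>))"
  by (simp add: fourier_transform_echar scaleR_conv_of_real)

lemma fourier_transform_density_const:
  fixes \<mu> :: "'a::euclidean_space measure"
  assumes [simp, measurable_cong]: "sets \<mu> = sets borel" and "c \<ge> 0"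
  shows "fourier_transform (density \<mu> (\<lambda>_. ennreal c)) x = complex_of_real c * fourier_transform \<mu> x"
  unfolding fourier_transform_echar using assms by (subst integral_density) (auto simp: scaleR_conv_of_real)

lemma not_summable_finite_sum_ge_1:
  fixes f :: "'a \<Rightarrow> real"
  assumes "\<not> f summable_on A" "\<And>x. x \<in> A \<Longrightarrow> f x \<ge> 0"
  obtains X where "finite X" "X \<subseteq> A" "1 \<le> sum f X"
proof (rule ccontr)
  assume "\<not> thesis"
  hence no: "\<not> (finite X \<and> X \<subseteq> A \<and> 1 \<le> sum f X)" for X using that by blast
  have "sum f X \<le> 1" if "finite X" "X \<subseteq> A" for X using no[of X] that by simp
  hence "eventually (\<lambda>X. sum f X \<le> 1) (finite_subsets_at_top A)"
    by (intro eventually_finite_subsets_at_top_weakI) auto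
  hence "f summable_on A" using assms(2) by (intro nonneg_bounded_partial_sums_imp_summable_on) auto
  thus False using assms(1) by simp
qed

text \<open>
  Successive multiplications by the functions of \<open>approx_multiplier\<close>, with ever larger \<open>q\<close>,
  concentrate the initial measure on the approximable points; the \<open>n\<close>-th step changes the
  Fourier transform by at most \<open>2 ^ - (n + 2)\<close> times the admissible decay.
\<close>

lemma approximating_measures:
  fixes \<delta> :: "int ^ 'n::finite \<Rightarrow> real"
  assumes \<tau>: "0 < \<tau>" "\<tau> < t" "t < 1"
    and dense: "\<And>M. \<exists>Q. finite Q \<and> (\<forall>q\<in>Q. q \<noteq> 0 \<and> 0 < \<delta> q \<and> \<delta> q \<le> 1 \<and> M \<le> sup_abs q) \<and>
       1 \<le> (\<Sum>q\<in>Q. (\<delta> q / sup_abs q) powr t)"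
  obtains m :: "nat \<Rightarrow> (real ^ 'm::finite ^ 'n) measure" and Q :: "nat \<Rightarrow> (int ^ 'n) set" and D where
    "\<And>n. prob_space (m n)" "\<And>n. sets (m n) = sets borel" "\<And>n. AE x in m n. x \<in> cbox 0 (\<chi> i j. 1)"
    "\<And>n. finite (Q n)" "\<And>n q. q \<in> Q n \<Longrightarrow> 0 < \<delta> q \<and> real n \<le> sup_abs q"
    "\<And>n k. n < k \<Longrightarrow> AE x in m k. \<exists>q\<in>Q n. \<forall>j. int_dist (real_vec q \<bullet> column j x) \<le> \<delta> q / 2"
    "\<And>n \<xi>. cmod (fourier_transform (m n) \<xi>) \<le> D * (1 + infnorm \<xi>) powr - \<tau>"
proof -
  \<comment> \<open>Half of the gap between \<open>\<tau>\<close> and \<open>t\<close> pays for the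
    divisor bound; the other half remains as a negative power of \<open>M\<close>.\<close>
  define \<epsilon> where "\<epsilon> = (t - \<tau>) / 2"
  have \<epsilon>: "\<epsilon> > 0" using \<tau> by (simp add: \<epsilon>_def)
  obtain C :: real where C: "C > 0"
    "\<And>(l :: int ^ 'm ^ 'n) P. l \<noteq> 0 \<Longrightarrow> P \<subseteq> {p. outer (fst p) (snd p) = l} \<Longrightarrow>
       real (card P) \<le> C * infnorm (real_mat l) powr \<epsilon>"
    using outer_fiber_bound[OF \<epsilon>] by blast
  define near where "near Q x \<longleftrightarrow> (\<exists>q\<in>Q. \<forall>j. int_dist (real_vec q \<bullet> column j x) \<le> \<delta> q / 2)"
    for Q and x :: "real ^ 'm ^ 'n"
  define inv where "inv \<mu> \<longleftrightarrow> finite_measure \<mu> \<and> sets \<mu> = sets borel \<and> (\<exists>B. lattice_bounded \<tau> (fourier_transform \<mu>) B) \<and>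
      (AE x in \<mu>. x \<in> cbox 0 (\<chi> i j. 1))" for \<mu> :: "(real ^ 'm ^ 'n) measure"
  define rel where "rel n \<mu> \<mu>' \<longleftrightarrow> (\<exists>Q F. finite Q \<and> (\<forall>q\<in>Q. 0 < \<delta> q \<and> real n \<le> sup_abs q) \<and>
      F \<in> borel_measurable borel \<and> (\<forall>x. F x \<noteq> 0 \<longrightarrow> near Q x) \<and> \<mu>' = density \<mu> (\<lambda>x. ennreal (F x))) \<and>
      (\<forall>\<xi>. cmod (fourier_transform \<mu>' \<xi> - fourier_transform \<mu> \<xi>) \<le> (1/2) ^ (n + 2) * (1 + infnorm \<xi>) powr - \<tau>)"
    for n :: nat and \<mu> \<mu>' :: "(real ^ 'm ^ 'n) measure"
  have AE_dens: "AE x in density \<mu> (\<lambda>x. ennreal (F x)). P x"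
    if "AE x in \<mu>. P x" "sets \<mu> = sets borel" "F \<in> borel_measurable borel"
    for \<mu> :: "(real ^ 'm ^ 'n) measure" and F P
    using that by (subst AE_density) (auto simp: measurable_cong_sets[OF that(2) refl])
  obtain B0 where B0: "lattice_bounded \<tau> (fourier_transform (initial_measure :: (real ^ 'm ^ 'n) measure)) B0"
    using lattice_bounded_initial[of \<tau>] \<tau> by auto
  have init: "inv initial_measure"
    unfolding inv_def using B0 sets_initial AE_initial prob_space_initial
    by (auto intro: prob_space.finite_measure)
  have step: "\<exists>\<mu>'. inv \<mu>' \<and> rel n \<mu> \<mu>'" if \<mu>: "inv \<mu>" for \<mu> n
  proof -
    obtain B where B: "lattice_bounded \<tau> (fourier_transform \<mu>) B" using \<mu> by (auto simp: inv_def)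
    have "((\<lambda>M. 2 * C * M powr - (t - \<tau> - \<epsilon>) * B) \<longlongrightarrow> 2 * C * 0 * B) at_top"
      using \<tau> by (intro tendsto_intros tendsto_neg_powr filterlim_ident) (simp add: \<epsilon>_def field_simps)
    hence "eventually (\<lambda>M. 2 * C * M powr - (t - \<tau> - \<epsilon>) * B < (1/2) ^ (n + 2)) at_top"
      by (intro order_tendstoD(2)) auto
    hence "eventually (\<lambda>M. 2 * C * M powr - (t - \<tau> - \<epsilon>) * B < (1/2) ^ (n + 2) \<and> real n \<le> M \<and> 1 \<le> M) at_top"
      using eventually_ge_at_top[of "real n"] eventually_ge_at_top[of "1::real"] by eventually_elim auto
    \<comment> \<open>\<open>M\<close> depends on \<open>B\<close>: the uncontrolled growth of
      \<open>B\<close> along the construction is absorbed here.\<close>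
    then obtain M where M: "2 * C * M powr - (t - \<tau> - \<epsilon>) * B < (1/2) ^ (n + 2)" "real n \<le> M" "1 \<le> M"
      using eventually_happens'[OF trivial_limit_at_top_linorder] by blast
    obtain Q where Q: "finite Q" "\<And>q. q \<in> Q \<Longrightarrow> q \<noteq> 0 \<and> 0 < \<delta> q \<and> \<delta> q \<le> 1 \<and> M \<le> sup_abs q"
       "1 \<le> (\<Sum>q\<in>Q. (\<delta> q / sup_abs q) powr t)" using dense[of M] by blast
    have fm: "finite_measure \<mu>" and sm: "sets \<mu> = sets borel" using \<mu> by (auto simp: inv_def)
    have t1: "t \<le> 1" and M0: "0 < M" and et: "\<epsilon> \<le> t - \<tau>" using \<tau> M by (auto simp: \<epsilon>_def)
    obtain F B' where F: "F \<in> borel_measurable borel" "\<And>x. 0 \<le> F x"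
      "\<And>x. F x \<noteq> 0 \<Longrightarrow> \<exists>q\<in>Q. \<forall>j. int_dist (real_vec q \<bullet> column j x) \<le> \<delta> q / 2"
      "finite_measure (density \<mu> (\<lambda>x. ennreal (F x)))"
      "lattice_bounded \<tau> (fourier_transform (density \<mu> (\<lambda>x. ennreal (F x)))) B'"
      "\<And>\<xi>. cmod (fourier_transform (density \<mu> (\<lambda>x. ennreal (F x))) \<xi> - fourier_transform \<mu> \<xi>) \<le>
         2 * C * M powr - (t - \<tau> - \<epsilon>) * B * (1 + infnorm \<xi>) powr - \<tau>"
      using approx_multiplier[OF fm sm \<tau>(1,2) t1 B C et Q(1,2) M0 Q(3)] by blast
    define \<mu>' where "\<mu>' = density \<mu> (\<lambda>x. ennreal (F x))"
    have "inv \<mu>'"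
      unfolding inv_def \<mu>'_def using F(1,4,5) \<mu> by (auto simp: inv_def intro!: AE_dens)
    moreover have "rel n \<mu> \<mu>'"
      unfolding rel_def
    proof (intro conjI exI[of _ Q] exI[of _ F] allI impI ballI)
      fix \<xi>
      show "cmod (fourier_transform \<mu>' \<xi> - fourier_transform \<mu> \<xi>) \<le> (1/2) ^ (n + 2) * (1 + infnorm \<xi>) powr - \<tau>"
        unfolding \<mu>'_def by (rule order_trans[OF F(6) mult_right_mono]) (use M(1) in auto)
    qed (use Q F(1,3) M(2) in \<open>force simp: near_def \<mu>'_def\<close>)+
    ultimately show ?thesis by blast
  qed
  have "\<exists>m. \<forall>n. (inv (m n) \<and> (n = 0 \<longrightarrow> m n = initial_measure)) \<and> rel n (m n) (m (Suc n))"
  proof (rule dependent_nat_choice)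
    show "\<exists>\<mu>. inv \<mu> \<and> (0 = 0 \<longrightarrow> \<mu> = initial_measure)" using init by blast
    show "\<exists>y. (inv y \<and> (Suc n = 0 \<longrightarrow> y = initial_measure)) \<and> rel n \<mu> y"
      if "inv \<mu> \<and> (n = 0 \<longrightarrow> \<mu> = initial_measure)" for \<mu> n using step that by blast
  qed
  then obtain m where m: "\<And>n. inv (m n)" "m 0 = initial_measure" "\<And>n. rel n (m n) (m (Suc n))" by blast
  have "\<exists>Q. finite Q \<and> (\<forall>q\<in>Q. 0 < \<delta> q \<and> real n \<le> sup_abs q) \<and> (\<exists>F. F \<in> borel_measurable borel \<and>
      (\<forall>x. F x \<noteq> 0 \<longrightarrow> near Q x) \<and> m (Suc n) = density (m n) (\<lambda>x. ennreal (F x)))" for n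
    using m(3)[of n] unfolding rel_def by blast
  then obtain Q where Q: "\<And>n. finite (Q n)" "\<And>n q. q \<in> Q n \<Longrightarrow> 0 < \<delta> q \<and> real n \<le> sup_abs q"
    "\<And>n. \<exists>F. F \<in> borel_measurable borel \<and>
      (\<forall>x. F x \<noteq> 0 \<longrightarrow> near (Q n) x) \<and> m (Suc n) = density (m n) (\<lambda>x. ennreal (F x))" by metis
  have sm: "sets (m n) = sets borel" for n using m(1)[of n] by (simp add: inv_def)
  \<comment> \<open>A condition once enforced persists, since passing to a density keeps null sets
    null.\<close>
  have nearAE: "AE x in m k. near (Q n) x" if "n < k" for n k
    using that
  proof (induction k)
    case (Suc k)
    obtain F where F: "F \<in> borel_measurable borel" "\<And>x. F x \<noteq> 0 \<Longrightarrow> near (Q k) x"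
      "m (Suc k) = density (m k) (\<lambda>x. ennreal (F x))" using Q(3)[of k] by blast
    show ?case
    proof (cases "n = k")
      case True
      have "AE x in m k. 0 < ennreal (F x) \<longrightarrow> near (Q k) x"
        using F(2) by (intro AE_I2) (auto simp: ennreal_neg dest: less_imp_neq)
      thus ?thesis unfolding F(3) True
        using F(1) by (subst AE_density) (auto simp: measurable_cong_sets[OF sm refl])
    next
      case False
      hence "AE x in m k. near (Q n) x" using Suc by simp
      thus ?thesis unfolding F(3) by (rule AE_dens[OF _ sm F(1)])
    qed
  qed simp
  define W where "W \<xi> = (1 + infnorm \<xi>) powr - \<tau>" for \<xi> :: "real ^ 'm ^ 'n"
  have W0: "W \<xi> \<ge> 0" for \<xi> by (simp add: W_def)
  \<comment> \<open>The factor is the sum of \<open>(1/2) ^ (i + 2)\<close> over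
    \<open>i < n\<close>.\<close>
  have diff: "cmod (fourier_transform (m n) \<xi> - fourier_transform (m 0) \<xi>) \<le> (1/2 - (1/2) ^ (n + 1)) * W \<xi>" for n \<xi>
  proof (induction n)
    case (Suc n)
    have "cmod (fourier_transform (m (Suc n)) \<xi> - fourier_transform (m 0) \<xi>) \<le>
      cmod (fourier_transform (m (Suc n)) \<xi> - fourier_transform (m n) \<xi>) + cmod (fourier_transform (m n) \<xi> - fourier_transform (m 0) \<xi>)"
      by (rule order_trans[OF _ norm_triangle_ineq]) simp
    also have "\<dots> \<le> (1/2) ^ (n + 2) * W \<xi> + (1/2 - (1/2) ^ (n + 1)) * W \<xi>"
      using m(3)[of n] Suc by (intro add_mono) (auto simp: rel_def W_def)
    finally show ?case by (simp add: algebra_simps)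
  qed simp
  have diff': "cmod (fourier_transform (m n) \<xi> - fourier_transform (m 0) \<xi>) \<le> 1/2 * W \<xi>" for n \<xi>
    by (rule order_trans[OF diff mult_right_mono[OF _ W0]]) simp
  define c where "c n = measure (m n) (space (m n))" for n
  \<comment> \<open>The transform at 0 is the total mass and the weight there is 1, so a total
    change of at most 1/2 leaves at least half of the mass; normalising then costs at most a factor
    2.\<close>
  have c_half: "c n \<ge> 1/2" for n
  proof -
    have "measure (m 0) (space (m 0)) = 1" unfolding m(2) using prob_space.prob_space[OF prob_space_initial] .
    hence "cmod (complex_of_real (c n) - 1) \<le> 1/2"
      using diff'[of n 0] by (simp add: fourier_transform_0 W_def infnorm_0 c_def)
    hence "\<bar>c n - 1\<bar> \<le> 1/2" by (metis norm_of_real of_real_1 of_real_diff)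
    thus ?thesis by linarith
  qed
  define m' where "m' n = density (m n) (\<lambda>_. ennreal (1 / c n))" for n
  have ft: "fourier_transform (m' n) \<xi> = complex_of_real (1 / c n) * fourier_transform (m n) \<xi>" for n \<xi>
    unfolding m'_def using c_half[of n] by (intro fourier_transform_density_const sm) auto
  show ?thesis
  proof
    show "prob_space (m' n)" for n
    proof (rule prob_spaceI)
      interpret finite_measure "m n" using m(1)[of n] by (simp add: inv_def)
      have "emeasure (m' n) (space (m' n)) = ennreal (1 / c n) * emeasure (m n) (space (m n))"
        unfolding m'_def by (simp add: emeasure_density nn_integral_cmult)
      also have "\<dots> = ennreal (1 / c n) * ennreal (c n)"
        by (simp only: emeasure_eq_measure c_def)
      also have "\<dots> = ennreal (1 / c n * c n)"
        using c_half[of n] by (intro ennreal_mult[symmetric]) auto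
      finally show "emeasure (m' n) (space (m' n)) = 1" using c_half[of n] by simp
    qed
    show "sets (m' n) = sets borel" for n by (simp add: m'_def sm)
    show "AE x in m' n. x \<in> cbox 0 (\<chi> i j. 1)" for n
      unfolding m'_def by (rule AE_dens[OF _ sm]) (use m(1) in \<open>auto simp: inv_def\<close>)
    show "finite (Q n)" for n by (rule Q)
    show "0 < \<delta> q \<and> real n \<le> sup_abs q" if "q \<in> Q n" for n q using Q(2)[OF that] .
    show "AE x in m' k. \<exists>q\<in>Q n. \<forall>j. int_dist (real_vec q \<bullet> column j x) \<le> \<delta> q / 2" if "n < k" for n k
      unfolding m'_def using nearAE[OF that, unfolded near_def] by (rule AE_dens[OF _ sm]) auto
    show "cmod (fourier_transform (m' n) \<xi>) \<le> (2 * B0 + 1) * (1 + infnorm \<xi>) powr - \<tau>" for n \<xi>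
    proof -
      have pos: "(1 + infnorm \<xi>) powr \<tau> > 0" using infnorm_pos_le[of \<xi>] by simp
      have "cmod (fourier_transform (m 0) \<xi>) * (1 + infnorm \<xi>) powr \<tau> \<le> B0"
        unfolding m(2) by (rule lattice_bounded_pointwise[OF B0])
      hence "cmod (fourier_transform (m 0) \<xi>) \<le> B0 * W \<xi>"
        using pos by (simp add: W_def powr_minus field_simps)
      hence "cmod (fourier_transform (m n) \<xi>) \<le> B0 * W \<xi> + 1/2 * W \<xi>"
        using diff'[of n \<xi>] norm_triangle_ineq2[of "fourier_transform (m n) \<xi>" "fourier_transform (m 0) \<xi>"] by linarith
      moreover have "1 / c n \<le> 2" using c_half[of n] by (simp add: field_simps)
      ultimately have "1 / c n * cmod (fourier_transform (m n) \<xi>) \<le> 2 * (B0 * W \<xi> + 1/2 * W \<xi>)"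
        using c_half[of n] by (intro mult_mono) auto
      moreover have "cmod (fourier_transform (m' n) \<xi>) = 1 / c n * cmod (fourier_transform (m n) \<xi>)"
        using c_half[of n] by (simp add: ft norm_mult norm_divide)
      ultimately show ?thesis by (simp add: W_def algebra_simps)
    qed
  qed
qed

text \<open>For each \<open>n\<close> the condition imposed by \<open>Q n\<close> is a finite union
  of closed sets, so it passes to every point of the support of a weak limit, not just to almost
  every point. Since \<open>Q n\<close> lies at height at least \<open>n\<close>, infinitely many
  \<open>q\<close> serve each such point.\<close>

lemma decaying_measure_exists:
  fixes \<psi> :: "'m::finite \<Rightarrow> int ^ 'n::finite \<Rightarrow> real"
  assumes nonneg: "\<And>j q. \<psi> j q \<ge> 0"
    and conv: "(\<lambda>q. \<Prod>j\<in>UNIV. \<psi> j q) summable_on UNIV"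
    and small: "conv_exponent \<psi> < 1" and \<tau>: "0 < \<tau>" "ennreal \<tau> < conv_exponent \<psi>"
  obtains \<nu> D where "\<nu> \<in> compact_prob_measures (well_approx \<psi>)"
    "\<And>x. x \<noteq> 0 \<Longrightarrow> cmod (fourier_transform \<nu> x) \<le> D * infnorm x powr - \<tau>"
proof -
  obtain r where r: "0 \<le> r" "conv_exponent \<psi> = ennreal r"
    using small by (cases "conv_exponent \<psi>" rule: ennreal_cases) auto
  have r1: "r < 1" using small r by (simp add: r(2) ennreal_less_iff flip: ennreal_1)
  have "\<tau> < r" using \<tau> r by (simp add: ennreal_less_iff)
  then obtain t where t: "\<tau> < t" "t < r" using dense by blast
  define \<delta> where "\<delta> q = Min (range (\<lambda>j. \<psi> j q))" for q
  have \<delta>le: "\<delta> q \<le> \<psi> j q" for q j unfolding \<delta>_def by (intro Min_le) auto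
  have \<delta>0: "0 \<le> \<delta> q" for q unfolding \<delta>_def by (intro Min.boundedI) (auto simp: nonneg)
  have \<delta>eq: "Min (range (\<lambda>j. \<psi> j q / sup_abs q)) = \<delta> q / sup_abs q" for q
  proof -
    have "\<delta> q \<in> range (\<lambda>j. \<psi> j q)" unfolding \<delta>_def by (intro Min_in) auto
    thus ?thesis by (intro Min_eqI) (auto intro!: divide_right_mono \<delta>le)
  qed
  have ns: "\<not> (\<lambda>q. (\<delta> q / sup_abs q) powr t) summable_on (UNIV - {0})"
  proof
    assume "(\<lambda>q. (\<delta> q / sup_abs q) powr t) summable_on (UNIV - {0})"
    hence "(\<lambda>q. (Min (range (\<lambda>j. \<psi> j q / sup_abs q))) powr t) summable_on (UNIV - {0})"
      by (rule summable_on_cong[THEN iffD1, rotated]) (auto simp: \<delta>eq)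
    hence "conv_exponent \<psi> \<le> ennreal t"
      unfolding conv_exponent_def using t \<tau> by (intro Inf_lower) auto
    hence "r \<le> t" using t \<tau> by (simp add: r(2) ennreal_le_iff)
    thus False using t by simp
  qed
  \<comment> \<open>\<open>\<delta> q > 1\<close> makes the product of the \<open>\<psi> j q\<close>
    at least 1, which summability permits only finitely often.\<close>
  have fin1: "finite {q. 1 < \<delta> q}"
  proof (rule finite_subset)
    show "{q. 1 < \<delta> q} \<subseteq> {q\<in>UNIV. 1 \<le> (\<Prod>j\<in>UNIV. \<psi> j q)}"
    proof safe
      fix q assume "1 < \<delta> q"
      hence "1 \<le> \<psi> j q" for j using \<delta>le[of q j] by linarith
      thus "1 \<le> (\<Prod>j\<in>UNIV. \<psi> j q)" by (intro prod_ge_1)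
    qed auto
    show "finite {q\<in>UNIV. 1 \<le> (\<Prod>j\<in>UNIV. \<psi> j q)}"
      by (rule finite_superlevel_summable[OF conv]) (auto intro: prod_nonneg nonneg)
  qed
  have many: "\<exists>Q. finite Q \<and> (\<forall>q\<in>Q. q \<noteq> 0 \<and> 0 < \<delta> q \<and> \<delta> q \<le> 1 \<and> M \<le> sup_abs q) \<and>
       1 \<le> (\<Sum>q\<in>Q. (\<delta> q / sup_abs q) powr t)" for M
  proof -
    define A where "A = {q. q \<noteq> 0 \<and> 0 < \<delta> q \<and> \<delta> q \<le> 1 \<and> M \<le> sup_abs q}"
    \<comment> \<open>A nonzero \<open>q\<close> outside this finite set and outside
      \<open>A\<close> has \<open>\<delta> q = 0\<close> and adds nothing, so divergence is
      inherited by \<open>A\<close>.\<close>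
    define X where "X = {q. 1 < \<delta> q} \<union> {q. sup_abs q \<le> M}"
    have "finite X" unfolding X_def using fin1 finite_sup_abs_le by blast
    have "\<not> (\<lambda>q. (\<delta> q / sup_abs q) powr t) summable_on A"
    proof
      assume "(\<lambda>q. (\<delta> q / sup_abs q) powr t) summable_on A"
      hence "(\<lambda>q. (\<delta> q / sup_abs q) powr t) summable_on (A \<union> (X - A))"
        using \<open>finite X\<close> by (intro summable_on_Un_disjoint) auto
      hence "(\<lambda>q. (\<delta> q / sup_abs q) powr t) summable_on (UNIV - {0})"
      proof (rule summable_on_cong_neutral[THEN iffD1, rotated -1])
        fix q assume "q \<in> (UNIV - {0}) - (A \<union> (X - A))"
        hence "\<delta> q = 0" using \<delta>0[of q] by (auto simp: A_def X_def)
        thus "(\<delta> q / sup_abs q) powr t = 0" by simp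
      next
        fix q assume "q \<in> (A \<union> (X - A)) - (UNIV - {0})"
        hence "q = 0" by auto
        \<comment> \<open>\<open>X\<close> may contain 0, where division by zero makes the summand
          0.\<close>
        moreover have "sup_abs (0 :: int ^ 'n) = 0" by (simp add: sup_abs_def)
        ultimately show "(\<delta> q / sup_abs q) powr t = 0" by simp
      qed simp
      thus False using ns by simp
    qed
    then obtain Q where "finite Q" "Q \<subseteq> A" "1 \<le> (\<Sum>q\<in>Q. (\<delta> q / sup_abs q) powr t)"
      by (rule not_summable_finite_sum_ge_1) auto
    thus ?thesis by (intro exI[of _ Q]) (auto simp: A_def)
  qed
  have t1: "t < 1" using t r1 by simp
  show ?thesis
  proof (rule approximating_measures[OF \<tau>(1) t(1) t1 many])
    fix m :: "nat \<Rightarrow> (real ^ 'm ^ 'n) measure" and Q D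
    assume m: "\<And>n. prob_space (m n)" "\<And>n. sets (m n) = sets borel" "\<And>n. AE x in m n. x \<in> cbox 0 (\<chi> i j. 1)"
      and Q: "\<And>n. finite (Q n)" "\<And>n q. q \<in> Q n \<Longrightarrow> 0 < \<delta> q \<and> real n \<le> sup_abs q"
      and near: "\<And>n k. n < k \<Longrightarrow> AE x in m k. \<exists>q\<in>Q n. \<forall>j. int_dist (real_vec q \<bullet> column j x) \<le> \<delta> q / 2"
      and D: "\<And>n \<xi>. cmod (fourier_transform (m n) \<xi>) \<le> D * (1 + infnorm \<xi>) powr - \<tau>"
    show thesis
    proof (rule weak_limit_on_box[OF m])
      fix \<nu> r
      assume r: "strict_mono (r :: nat \<Rightarrow> nat)" and \<nu>: "prob_space \<nu>" "sets \<nu> = sets borel"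
        and lim: "\<And>(f :: real ^ 'm ^ 'n \<Rightarrow> complex) B. continuous_on UNIV f \<Longrightarrow> (\<And>x. cmod (f x) \<le> B) \<Longrightarrow>
           (\<lambda>n. LINT x|m (r n). f x) \<longlonglongrightarrow> (LINT x|\<nu>. f x)"
      have supp: "measure_support \<nu> \<subseteq> K" if "closed K" "\<And>n. n \<ge> n0 \<Longrightarrow> AE x in m (r n). x \<in> K" for K n0
        by (rule measure_support_subset[OF \<nu>(2) that(1) AE_weak_limit_closed[OF \<nu>(1) m(1) \<nu>(2) m(2) lim that]])
      have cube: "measure_support \<nu> \<subseteq> cbox 0 (\<chi> i j. 1)"
        by (rule supp[of _ 0]) (auto intro: m closed_cbox)
      have Kn: "measure_support \<nu> \<subseteq> {x. \<exists>q\<in>Q n. \<forall>j. int_dist (real_vec q \<bullet> column j x) \<le> \<delta> q / 2}" for n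
      proof (rule supp[of _ "Suc n"])
        have "{x :: real ^ 'm ^ 'n. \<exists>q\<in>Q n. \<forall>j. int_dist (real_vec q \<bullet> column j x) \<le> \<delta> q / 2} =
          (\<Union>q\<in>Q n. \<Inter>j. {x. int_dist (real_vec q \<bullet> column j x) \<le> \<delta> q / 2})" by auto
        also have "closed \<dots>" unfolding column_def
          by (intro closed_UN closed_INT Q(1) ballI closed_Collect_le continuous_intros)
        finally show "closed {x :: real ^ 'm ^ 'n. \<exists>q\<in>Q n. \<forall>j. int_dist (real_vec q \<bullet> column j x) \<le> \<delta> q / 2}" .
        fix k assume "Suc n \<le> k"
        hence "n < r k" using strict_mono_imp_increasing[OF r, of k] by linarith
        thus "AE x in m (r k). x \<in> {x. \<exists>q\<in>Q n. \<forall>j. int_dist (real_vec q \<bullet> column j x) \<le> \<delta> q / 2}"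
          using near by simp
      qed
      have "measure_support \<nu> \<subseteq> well_approx \<psi>"
      proof
        fix x assume x: "x \<in> measure_support \<nu>"
        have "0 \<le> x $ i $ j \<and> x $ i $ j \<le> 1" for i j
        proof -
          have "x \<in> cbox 0 (\<chi> i j. 1)" using cube x by blast
          hence box: "\<forall>b\<in>Basis. 0 \<bullet> b \<le> x \<bullet> b \<and> x \<bullet> b \<le> (\<chi> i j. 1) \<bullet> b" by (simp add: mem_box)
          have "axis i (axis j 1) \<in> (Basis :: (real ^ 'm ^ 'n) set)" by (auto simp: Basis_vec_def)
          from bspec[OF box this] show ?thesis by (simp add: inner_axis)
        qed
        moreover have "infinite {q. \<forall>j. int_dist (real_vec q \<bullet> column j x) < \<psi> j q}"
        proof
          assume fin: "finite {q. \<forall>j. int_dist (real_vec q \<bullet> column j x) < \<psi> j q}"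
          define M where "M = Max (sup_abs ` {q. \<forall>j. int_dist (real_vec q \<bullet> column j x) < \<psi> j q})"
          obtain n :: nat where n: "M < real n" using reals_Archimedean2 by blast
          obtain q where q: "q \<in> Q n" "\<And>j. int_dist (real_vec q \<bullet> column j x) \<le> \<delta> q / 2" using Kn[of n] x by blast
          have "int_dist (real_vec q \<bullet> column j x) < \<psi> j q" for j
            using q(2)[of j] Q(2)[OF q(1)] \<delta>le[of q j] by linarith
          hence "sup_abs q \<le> M" unfolding M_def using fin by (intro Max_ge) auto
          thus False using n Q(2)[OF q(1)] by linarith
        qed
        ultimately show "x \<in> well_approx \<psi>" by (simp add: well_approx_def)
      qed
      moreover have "compact (measure_support \<nu>)"
        using closed_measure_support bounded_subset[OF bounded_cbox cube] by (simp add: compact_eq_bounded_closed)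
      ultimately have "\<nu> \<in> compact_prob_measures (well_approx \<psi>)"
        using \<nu> by (simp add: compact_prob_measures_def)
      moreover have "cmod (fourier_transform \<nu> x) \<le> \<bar>D\<bar> * infnorm x powr - \<tau>" if x: "x \<noteq> 0" for x
      proof -
        have "(\<lambda>n. fourier_transform (m (r n)) x) \<longlonglongrightarrow> fourier_transform \<nu> x"
          unfolding fourier_transform_echar by (rule lim[of _ 1]) (auto intro!: continuous_intros)
        hence "(\<lambda>n. cmod (fourier_transform (m (r n)) x)) \<longlonglongrightarrow> cmod (fourier_transform \<nu> x)" by (rule tendsto_norm)
        hence "cmod (fourier_transform \<nu> x) \<le> D * (1 + infnorm x) powr - \<tau>"
          by (rule LIMSEQ_le_const2) (use D in auto)
        also have "\<dots> \<le> \<bar>D\<bar> * infnorm x powr - \<tau>"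
          using infnorm_pos_lt[of x] x \<tau>(1) by (intro mult_mono powr_mono2') auto
        finally show ?thesis .
      qed
      ultimately show thesis by (rule that)
    qed
  qed
qed

text \<open>In dimension one, \<open>2 s(\<Psi>)\<close> does not exceed the dimension: this is Young's inequality.\<close>

lemma conv_exponent_le_half:
  fixes \<psi> :: "'m::finite \<Rightarrow> int ^ 'n::finite \<Rightarrow> real"
  assumes nonneg: "\<And>j q. \<psi> j q \<ge> 0"
    and conv: "(\<lambda>q. \<Prod>j\<in>UNIV. \<psi> j q) summable_on UNIV"
    and card: "CARD('n) = 1" "CARD('m) = 1"
  shows "conv_exponent \<psi> \<le> ennreal (1/2)"
proof -
  obtain i0 where i0: "(UNIV :: 'n set) = {i0}" using card(1) card_1_singletonE by blast
  obtain j0 where j0: "(UNIV :: 'm set) = {j0}" using card(2) card_1_singletonE by blast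
  have le: "conv_exponent \<psi> \<le> ennreal s" if s: "1/2 < s" "s < 1" for s
    unfolding conv_exponent_def
  proof (rule Inf_lower, clarify, intro exI conjI)
    \<comment> \<open>Chosen so that \<open>p * (1 - s) = s\<close>; then \<open>p > 1\<close>,
      which makes the sum over the integers converge, exactly because
      \<open>s > 1/2\<close>.\<close>
    define p where "p = s / (1 - s)"
    have p: "p > 1" using s by (simp add: p_def field_simps)
    have sp: "(\<lambda>q :: int ^ 'n. sup_abs q powr - p) summable_on (UNIV - {0})"
    proof -
      obtain A where A: "\<And>(u :: real) (Y :: int set). finite Y \<Longrightarrow> (\<Sum>k\<in>Y. (1 + \<bar>u - of_int k\<bar>) powr - p) \<le> A"
        using lattice_sum_bound[OF p] by blast
      have "(\<Sum>q\<in>X. sup_abs q powr - p) \<le> 2 powr p * A" if X: "finite X" "X \<subseteq> UNIV - {0}" for X :: "(int ^ 'n) set"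
      proof -
        have "(\<Sum>q\<in>X. sup_abs q powr - p) \<le> (\<Sum>q\<in>X. \<Prod>i\<in>UNIV. 2 powr p * (1 + \<bar>0 - of_int (q $ i)\<bar>) powr - p)"
        proof (intro sum_mono)
          fix q assume "q \<in> X"
          hence "1 \<le> sup_abs q" using X by (intro sup_abs_ge_1) auto
          moreover have eq: "sup_abs q = \<bar>of_int (q $ i0)\<bar>" by (simp add: sup_abs_def i0)
          ultimately have "sup_abs q powr - p \<le> ((1 + \<bar>real_of_int (q $ i0)\<bar>) / 2) powr - p"
            using p by (intro powr_mono2') auto
          also have "\<dots> = 2 powr p * (1 + \<bar>0 - of_int (q $ i0)\<bar>) powr - p"
            by (simp add: powr_divide powr_minus field_simps)
          finally show "sup_abs q powr - p \<le> (\<Prod>i\<in>UNIV. 2 powr p * (1 + \<bar>0 - of_int (q $ i)\<bar>) powr - p)"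
            by (simp add: i0)
        qed
        also have "\<dots> \<le> (\<Prod>i\<in>(UNIV :: 'n set). 2 powr p * A)"
          by (rule sum_prod_vec_le[where g = "\<lambda>i k. 2 powr p * (1 + \<bar>0 - of_int k\<bar>) powr - p", OF X(1)])
             (use A[of _ 0] in \<open>auto simp: sum_distrib_left[symmetric]\<close>)
        finally show ?thesis by (simp add: i0)
      qed
      hence "eventually (\<lambda>X. (\<Sum>q\<in>X. sup_abs q powr - p) \<le> 2 powr p * A) (finite_subsets_at_top (UNIV - {0 :: int ^ 'n}))"
        by (intro eventually_finite_subsets_at_top_weakI) auto
      thus ?thesis by (intro nonneg_bounded_partial_sums_imp_summable_on) auto
    qed
    show "(\<lambda>q. (Min (range (\<lambda>j. \<psi> j q / sup_abs q))) powr s) summable_on (UNIV - {0})"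
    proof (rule summable_on_comparison_test)
      show "(\<lambda>q. (\<Prod>j\<in>UNIV. \<psi> j q) + sup_abs q powr - p) summable_on (UNIV - {0})"
        by (intro summable_on_add sp summable_on_subset_banach[OF conv]) auto
      fix q :: "int ^ 'n" assume "q \<in> UNIV - {0}"
      hence Q: "1 \<le> sup_abs q" by (intro sup_abs_ge_1) auto
      define y where "y = \<psi> j0 q"
      have y0: "y \<ge> 0" by (simp add: y_def nonneg)
      \<comment> \<open>The left side is
        \<open>y powr s * (sup_abs q powr - p) powr (1 - s)\<close>, a weighted geometric mean,
        hence at most the larger of the two terms on the right.\<close>
      have "(y / sup_abs q) powr s \<le> y + sup_abs q powr - p"
      proof (cases "sup_abs q powr - p \<le> y")
        case True
        have yp: "y > 0" using True Q by (intro less_le_trans[OF _ True]) auto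
        have "(sup_abs q powr - p) powr (1 - s) \<le> y powr (1 - s)" using True s by (intro powr_mono2) auto
        moreover have "(sup_abs q powr - p) powr (1 - s) = sup_abs q powr - s"
          using s by (simp add: powr_powr p_def)
        ultimately have "y powr s * sup_abs q powr - s \<le> y powr s * y powr (1 - s)" by (intro mult_left_mono) auto
        also have "\<dots> = y" using yp by (simp flip: powr_add)
        finally have "y powr s * sup_abs q powr - s \<le> y" .
        moreover have "(y / sup_abs q) powr s = y powr s * sup_abs q powr - s"
          using Q y0 by (simp add: powr_divide powr_minus_divide)
        ultimately show ?thesis by (simp add: add_increasing2)
      next
        case False
        hence "y powr s \<le> (sup_abs q powr - p) powr s" using y0 s by (intro powr_mono2) auto
        hence "y powr s * sup_abs q powr - s \<le> (sup_abs q powr - p) powr s * sup_abs q powr - s" by (intro mult_right_mono) auto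
        also have "\<dots> = sup_abs q powr (- p * s + - s)" unfolding powr_powr powr_add by simp
        also have "- p * s + - s = - p" using s by (simp add: p_def field_simps)
        finally have "y powr s * sup_abs q powr - s \<le> sup_abs q powr - p" .
        moreover have "(y / sup_abs q) powr s = y powr s * sup_abs q powr - s"
          using Q y0 by (simp add: powr_divide powr_minus_divide)
        ultimately show ?thesis using y0 by simp
      qed
      thus "(Min (range (\<lambda>j. \<psi> j q / sup_abs q))) powr s \<le> (\<Prod>j\<in>UNIV. \<psi> j q) + sup_abs q powr - p"
        by (simp add: j0 y_def)
    qed simp
  qed (use s in auto)
  show ?thesis
  proof (rule ccontr)
    assume "\<not> conv_exponent \<psi> \<le> ennreal (1/2)"
    hence half: "ennreal (1/2) < conv_exponent \<psi>" by simp
    \<comment> \<open>\<open>le\<close> is available only below 1; any value strictly between 1/2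
      and 1 would do here to keep every \<open>s < r\<close> in its range.\<close>
    have upper: "conv_exponent \<psi> \<le> ennreal (3/4)" by (rule le) auto
    hence "conv_exponent \<psi> < top" by (rule le_less_trans) (rule ennreal_less_top)
    then obtain r where r: "0 \<le> r" "conv_exponent \<psi> = ennreal r"
      by (cases "conv_exponent \<psi>" rule: ennreal_cases) auto
    have r2: "1/2 < r" using half unfolding r(2) by (subst (asm) ennreal_less_iff) auto
    have r3: "r \<le> 3/4" using upper unfolding r(2) by (subst (asm) ennreal_le_iff) auto
    obtain s where s: "1/2 < s" "s < r" using dense[OF r2] by blast
    have "ennreal r \<le> ennreal s" using le[of s] s r3 unfolding r(2) by simp
    hence "r \<le> s" by (subst (asm) ennreal_le_iff) (use s in auto)
    thus False using s by simp
  qed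
qed

lemma fourier_dim_well_approx_ge:
  fixes \<psi> :: "'m::finite \<Rightarrow> int ^ 'n::finite \<Rightarrow> real"
  assumes nonneg: "\<And>j q. \<psi> j q \<ge> 0"
    and conv: "(\<lambda>q. \<Prod>j\<in>UNIV. \<psi> j q) summable_on UNIV"
    and small: "conv_exponent \<psi> < 1"
  shows "2 * conv_exponent \<psi> \<le> fourier_dim (well_approx \<psi>)"
proof (rule ccontr)
  assume "\<not> 2 * conv_exponent \<psi> \<le> fourier_dim (well_approx \<psi>)"
  hence less: "fourier_dim (well_approx \<psi>) < 2 * conv_exponent \<psi>" by simp
  obtain r where r: "0 \<le> r" "conv_exponent \<psi> = ennreal r"
    using small by (cases "conv_exponent \<psi>" rule: ennreal_cases) auto
  have r1: "r < 1" using small r by (simp add: r(2) ennreal_less_iff flip: ennreal_1)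
  have two: "2 * conv_exponent \<psi> = ennreal (2 * r)" using r by (simp add: ennreal_mult')
  obtain d where d: "0 \<le> d" "fourier_dim (well_approx \<psi>) = ennreal d"
    using less two by (cases "fourier_dim (well_approx \<psi>)" rule: ennreal_cases) auto
  have "d / 2 < r" using less two d by (simp add: ennreal_less_iff)
  then obtain \<tau> where \<tau>: "d / 2 < \<tau>" "\<tau> < r" using dense by blast
  have \<tau>0: "0 < \<tau>" using \<tau> d by linarith
  \<comment> \<open>Exponents in \<open>fourier_dim\<close> are capped by the dimension. As
    \<open>\<tau> < 1\<close>, the cap could interfere only in dimension one.\<close>
  have dim: "2 * \<tau> \<le> real DIM(real ^ 'm ^ 'n)"
  proof (cases "CARD('n) = 1 \<and> CARD('m) = 1")
    case True
    hence "ennreal r \<le> ennreal (1/2)" using conv_exponent_le_half[OF nonneg conv] r(2) by metis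
    hence "r \<le> 1/2" by (subst (asm) ennreal_le_iff) auto
    thus ?thesis using \<tau> True by simp
  next
    case False
    have pos: "1 \<le> CARD('n)" "1 \<le> CARD('m)" by (simp_all add: Suc_le_eq)
    hence "2 \<le> CARD('n) \<or> 2 \<le> CARD('m)" using False by linarith
    hence "2 \<le> CARD('n) * CARD('m)"
      using mult_le_mono[of 2 "CARD('n)" 1 "CARD('m)"] mult_le_mono[of 1 "CARD('n)" 2 "CARD('m)"] pos by linarith
    hence "2 \<le> real (CARD('n) * CARD('m))" by linarith
    thus ?thesis using \<tau> r1 by simp
  qed
  have "ennreal \<tau> < conv_exponent \<psi>" using \<tau> \<tau>0 r by (simp add: ennreal_less_iff)
  then obtain \<nu> D where \<nu>: "\<nu> \<in> compact_prob_measures (well_approx \<psi>)"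
    "\<And>x. x \<noteq> 0 \<Longrightarrow> cmod (fourier_transform \<nu> x) \<le> D * infnorm x powr - \<tau>"
    using decaying_measure_exists[OF nonneg conv small \<tau>0] by blast
  have "ennreal (2 * \<tau>) \<le> fourier_dim (well_approx \<psi>)"
    unfolding fourier_dim_def
  proof (rule Sup_upper, clarify, intro exI conjI)
    show "\<exists>\<mu>\<in>compact_prob_measures (well_approx \<psi>). \<exists>C. \<forall>x. x \<noteq> 0 \<longrightarrow>
        cmod (fourier_transform \<mu> x) \<le> C * infnorm x powr (- (2 * \<tau>) / 2)"
      using \<nu> by (intro bexI[of _ \<nu>] exI[of _ D]) auto
  qed (use \<tau>0 dim in auto)
  thus False using d \<tau> \<tau>0 by (simp add: ennreal_le_iff)
qed

theorem theorem1p18: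
  fixes \<psi> :: "'m::finite \<Rightarrow> int ^ 'n::finite \<Rightarrow> real"
  assumes nonneg: "\<And>j q. \<psi> j q \<ge> 0"
    and conv: "(\<lambda>q. \<Prod>j\<in>UNIV. \<psi> j q) summable_on UNIV"
    and small: "conv_exponent \<psi> < 1"
  shows "fourier_dim (well_approx \<psi>) = 2 * conv_exponent \<psi>"
  using fourier_dim_well_approx_le[OF assms] fourier_dim_well_approx_ge[OF assms] by (rule antisym)

end
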